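(* Let $\delta>0$ and $\vec\tau_0\in K:=\{\vec\tau\in L^2(\Omega,\mathbb{R}^2):\operatorname{div}\vec\tau=0\}$. Let $\vec\tau$ be the solution of $$\min_{\vec\tau\in BV(\Omega,\mathbb{R}^2)\cap L^2(\Omega,\mathbb{R}^2)}\Big\{TV(\vec\tau)+\frac{1}{2\delta}\|\vec\tau-\vec\tau_0\|_{L^2}^2\Big\}\quad\text{subject to }\operatorname{div}\vec\tau=0 .$$ Then $\vec\tau$ fulfills $$\vec\tau=\vec\tau_0-\delta\,\mathcal{P}_K\,\mathbf{div}\,\vec p,$$ where $\vec p$ is a solution (any solution) of the optimization problem $$\min_{\vec p\in \mathbf{B}(H_0^{\operatorname{div}}(\Omega,\mathbb{R}^{2\times 2}))}\big\|\mathcal{P}_K\,\mathbf{div}\,\vec p-\delta^{-1}\vec\tau_0\big\|_{L^2}^2 .$$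
   Context: $\Omega\subset\mathbb{R}^2$ is an open, bounded, simply connected domain with Lipschitz boundary. For $c\in\mathbb{N}$ and $\vec p=(\vec p_1,\dots,\vec p_c):\Omega\to\mathbb{R}^{2\times c}$ (columns $\vec p_i$ with values in $\mathbb{R}^2$), $\mathbf{div}\,\vec p=(\operatorname{div}\vec p_1,\dots,\operatorname{div}\vec p_c)$ is the column-wise divergence. For a set $X$ of functions $\vec p:\Omega\to\mathbb{R}^{2\times c}$, $\mathbf{B}(X):=\{\vec p\in X: |\vec p_i|\le 1 \text{ a.e. in }\Omega,\ i=1,\dots,c\}$, with $|\cdot|$ the Euclidean norm. The total variation of $\vec v\in L^1(\Omega,\mathbb{R}^c)$ is $TV(\vec v)=\sup\{\int_\Omega \vec v\cdot\mathbf{div}\,\vec p\,dx:\vec p\in\mathbf{B}(C_0^1(\Omega,\mathbb{R}^{2\times c}))\}$, where $C_0^1$ denotes compactly supported $C^1$ functions, and $BV(\Omega,\mathbb{R}^c)=\{\vec v\in L^1(\Omega,\mathbb{R}^c):TV(\vec v)<\infty\}$. Moreover $H_0^{\operatorname{div}}(\Omega,\mathbb{R}^{2\times c})=\{\vec p\in L^2(\Omega,\mathbb{R}^{2\times c}):\operatorname{div}\vec p_i\in L^2(\Omega,\mathbb{R}),\ \vec p_i\cdot\vec e|_{\partial\Omega}=0,\ i=1,\dots,c\}$, with $\vec e$ the outward normal on $\partial\Omega$. The divergence on $L^2(\Omega,\mathbb{R}^2)$ is understood distributionally, $\operatorname{div}:L^2(\Omega,\mathbb{R}^2)\to H^{-1}(\Omega,\mathbb{R})$,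 $\langle\operatorname{div}\vec\tau,\phi\rangle_{H^{-1},H_0^1}=\langle\vec\tau,-\nabla\phi\rangle_{L^2}$ for $\phi\in H_0^1(\Omega,\mathbb{R})$. $K$ is a closed subspace of $L^2(\Omega,\mathbb{R}^2)$ and $\mathcal{P}_K:L^2(\Omega,\mathbb{R}^2)\to K$ is the orthogonal projection onto it. *)

theory Defs
  imports "HOL-Analysis.Analysis"
begin

text \<open>
  Functions on a domain \<open>\<Omega>\<close> are represented by functions on the whole plane of which only
  the values on \<open>\<Omega>\<close> matter, and elements of \<open>L\<^sup>1\<close>, \<open>L\<^sup>2\<close>, \<open>H\<^sup>1\<close>, \<dots> by representatives;
  equality in these spaces is equality almost everywhere in \<open>\<Omega>\<close>.
  The matrix space \<open>\<real>\<^bsup>2\<times>c\<^esup>\<close> is the type \<open>real ^ 'c ^ 2\<close>, with columns \<open>column i A :: real ^ 2\<close>.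
\<close>

section \<open>Lipschitz domains\<close>

text \<open>Near each boundary point, in suitable Cartesian coordinates, the set is the strict
  epigraph of a Lipschitz function.\<close>

definition lipschitz_boundary :: "(real ^ 2) set \<Rightarrow> bool" where
  "lipschitz_boundary \<Omega> \<longleftrightarrow>
     (\<forall>z \<in> frontier \<Omega>. \<exists>r > 0. \<exists>T :: real ^ 2 \<Rightarrow> real ^ 2. \<exists>\<gamma> :: real \<Rightarrow> real. \<exists>L.
        orthogonal_transformation T \<and> L-lipschitz_on UNIV \<gamma> \<and>
        \<Omega> \<inter> ball z r = {y \<in> ball z r. \<gamma> (T y $ 1) < T y $ 2})"

definition lipschitz_domain :: "(real ^ 2) set \<Rightarrow> bool" where
  "lipschitz_domain \<Omega> \<longleftrightarrow> \<Omega> \<noteq> {} \<and> open \<Omega> \<and> bounded \<Omega> \<and> simply_connected \<Omega> \<and> lipschitz_boundary \<Omega>"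


section \<open>Lebesgue spaces\<close>

definition L1 :: "(real ^ 2) set \<Rightarrow> (real ^ 2 \<Rightarrow> 'b::euclidean_space) set" where
  "L1 \<Omega> = {f. integrable (lebesgue_on \<Omega>) f}"

definition L2 :: "(real ^ 2) set \<Rightarrow> (real ^ 2 \<Rightarrow> 'b::euclidean_space) set" where
  "L2 \<Omega> = {f \<in> borel_measurable (lebesgue_on \<Omega>). integrable (lebesgue_on \<Omega>) (\<lambda>x. (norm (f x))\<^sup>2)}"

definition L2_inner ::
  "(real ^ 2) set \<Rightarrow> (real ^ 2 \<Rightarrow> 'b::euclidean_space) \<Rightarrow> (real ^ 2 \<Rightarrow> 'b) \<Rightarrow> real" where
  "L2_inner \<Omega> f g = (\<integral>x. f x \<bullet> g x \<partial>lebesgue_on \<Omega>)"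

definition L2_norm :: "(real ^ 2) set \<Rightarrow> (real ^ 2 \<Rightarrow> 'b::euclidean_space) \<Rightarrow> real" where
  "L2_norm \<Omega> f = sqrt (L2_inner \<Omega> f f)"

text \<open>For a closed subspace \<open>K\<close> of \<open>L\<^sup>2\<close>, the orthogonal projection is unique up to null sets.\<close>

definition L2_proj :: "(real ^ 2) set \<Rightarrow> (real ^ 2 \<Rightarrow> 'b::euclidean_space) set \<Rightarrow>
    (real ^ 2 \<Rightarrow> 'b) \<Rightarrow> (real ^ 2 \<Rightarrow> 'b)" where
  "L2_proj \<Omega> K f = (SOME g. g \<in> K \<and> (\<forall>k \<in> K. L2_inner \<Omega> (\<lambda>x. f x - g x) k = 0))"


section \<open>Compactly supported \<open>C\<^sup>1\<close> functions and total variation\<close>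

definition C01 :: "(real ^ 2) set \<Rightarrow> (real ^ 2 \<Rightarrow> 'b::euclidean_space) set" where
  "C01 \<Omega> = {f. compact (closure {x. f x \<noteq> 0}) \<and> closure {x. f x \<noteq> 0} \<subseteq> \<Omega> \<and>
     (\<exists>f' :: real ^ 2 \<Rightarrow> (real ^ 2) \<Rightarrow>\<^sub>L 'b.
        (\<forall>x \<in> \<Omega>. (f has_derivative blinfun_apply (f' x)) (at x)) \<and> continuous_on \<Omega> f')}"

definition grad :: "(real ^ 2 \<Rightarrow> real) \<Rightarrow> real ^ 2 \<Rightarrow> real ^ 2" where
  "grad \<phi> x = (\<chi> i. frechet_derivative \<phi> (at x) (axis i 1))"

definition dvg :: "(real ^ 2 \<Rightarrow> real ^ 2) \<Rightarrow> real ^ 2 \<Rightarrow> real" where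
  "dvg q x = (\<Sum>i\<in>UNIV. frechet_derivative q (at x) (axis i 1) $ i)"

definition mdvg :: "(real ^ 2 \<Rightarrow> real ^ 'c ^ 2) \<Rightarrow> real ^ 2 \<Rightarrow> real ^ 'c" where
  "mdvg p x = (\<chi> i. dvg (\<lambda>y. column i (p y)) x)"

definition column_ball :: "(real ^ 2) set \<Rightarrow> (real ^ 2 \<Rightarrow> real ^ 'c ^ 2) set \<Rightarrow> (real ^ 2 \<Rightarrow> real ^ 'c ^ 2) set" where
  "column_ball \<Omega> X = {p \<in> X. \<forall>i. AE x in lebesgue_on \<Omega>. norm (column i (p x)) \<le> 1}"

definition TV :: "(real ^ 2) set \<Rightarrow> (real ^ 2 \<Rightarrow> real ^ 'c) \<Rightarrow> ereal" where
  "TV \<Omega> v = (SUP p \<in> column_ball \<Omega> (C01 \<Omega>). ereal (\<integral>x. v x \<bullet> mdvg p x \<partial>lebesgue_on \<Omega>))"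

definition BV :: "(real ^ 2) set \<Rightarrow> (real ^ 2 \<Rightarrow> real ^ 'c) set" where
  "BV \<Omega> = {v \<in> L1 \<Omega>. TV \<Omega> v < \<infinity>}"


section \<open>Sobolev spaces \<open>H\<^sup>1\<close> and \<open>H\<^sub>0\<^sup>1\<close>\<close>

definition has_weak_grad ::
  "(real ^ 2) set \<Rightarrow> (real ^ 2 \<Rightarrow> real) \<Rightarrow> (real ^ 2 \<Rightarrow> real ^ 2) \<Rightarrow> bool" where
  "has_weak_grad \<Omega> \<phi> g \<longleftrightarrow> g \<in> L2 \<Omega> \<and>
     (\<forall>\<psi> \<in> C01 \<Omega>. (\<integral>x. \<phi> x *\<^sub>R grad \<psi> x \<partial>lebesgue_on \<Omega>) = - (\<integral>x. \<psi> x *\<^sub>R g x \<partial>lebesgue_on \<Omega>))"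

definition H1 :: "(real ^ 2) set \<Rightarrow> (real ^ 2 \<Rightarrow> real) set" where
  "H1 \<Omega> = {\<phi> \<in> L2 \<Omega>. \<exists>g. has_weak_grad \<Omega> \<phi> g}"

definition weak_grad :: "(real ^ 2) set \<Rightarrow> (real ^ 2 \<Rightarrow> real) \<Rightarrow> real ^ 2 \<Rightarrow> real ^ 2" where
  "weak_grad \<Omega> \<phi> = (SOME g. has_weak_grad \<Omega> \<phi> g)"

text \<open>The closure of \<open>C\<^sub>0\<^sup>1\<close> in the norm of \<open>H\<^sup>1\<close>.\<close>

definition H01 :: "(real ^ 2) set \<Rightarrow> (real ^ 2 \<Rightarrow> real) set" where
  "H01 \<Omega> = {\<phi> \<in> H1 \<Omega>. \<exists>\<psi> :: nat \<Rightarrow> real ^ 2 \<Rightarrow> real. (\<forall>n. \<psi> n \<in> C01 \<Omega>) \<and>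
     (\<lambda>n. L2_norm \<Omega> (\<lambda>x. \<psi> n x - \<phi> x)) \<longlonglongrightarrow> 0 \<and>
     (\<lambda>n. L2_norm \<Omega> (\<lambda>x. grad (\<psi> n) x - weak_grad \<Omega> \<phi> x)) \<longlonglongrightarrow> 0}"


section \<open>Distributional divergence and \<open>H\<^sub>0\<^bsup>div\<^esup>\<close>\<close>

text \<open>The divergence of an \<open>L\<^sup>2\<close> field as a functional, to be evaluated on \<open>H01 \<Omega>\<close>.\<close>

definition dist_div :: "(real ^ 2) set \<Rightarrow> (real ^ 2 \<Rightarrow> real ^ 2) \<Rightarrow> (real ^ 2 \<Rightarrow> real) \<Rightarrow> real" where
  "dist_div \<Omega> \<tau> \<phi> = L2_inner \<Omega> \<tau> (\<lambda>x. - weak_grad \<Omega> \<phi> x)"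

definition div_free :: "(real ^ 2) set \<Rightarrow> (real ^ 2 \<Rightarrow> real ^ 2) set" where
  "div_free \<Omega> = {\<tau> \<in> L2 \<Omega>. \<forall>\<phi> \<in> H01 \<Omega>. dist_div \<Omega> \<tau> \<phi> = 0}"

text \<open>The divergence belongs to \<open>L\<^sup>2\<close> if the functional is represented by an \<open>L\<^sup>2\<close> function.\<close>

definition has_L2_div :: "(real ^ 2) set \<Rightarrow> (real ^ 2 \<Rightarrow> real ^ 2) \<Rightarrow> (real ^ 2 \<Rightarrow> real) \<Rightarrow> bool" where
  "has_L2_div \<Omega> q d \<longleftrightarrow> d \<in> L2 \<Omega> \<and> (\<forall>\<phi> \<in> H01 \<Omega>. dist_div \<Omega> q \<phi> = L2_inner \<Omega> d \<phi>)"

definition L2_div :: "(real ^ 2) set \<Rightarrow> (real ^ 2 \<Rightarrow> real ^ 2) \<Rightarrow> real ^ 2 \<Rightarrow> real" where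
  "L2_div \<Omega> q = (SOME d. has_L2_div \<Omega> q d)"

definition L2_mdiv :: "(real ^ 2) set \<Rightarrow> (real ^ 2 \<Rightarrow> real ^ 'c ^ 2) \<Rightarrow> real ^ 2 \<Rightarrow> real ^ 'c" where
  "L2_mdiv \<Omega> p x = (\<chi> i. L2_div \<Omega> (\<lambda>y. column i (p y)) x)"

text \<open>The normal trace \<open>q \<cdot> e\<close> on the boundary, an element of \<open>H\<^bsup>-1/2\<^esup>\<close>, is defined by
  Green's formula: its pairing with the boundary values of \<open>\<phi>\<close> in \<open>H\<^sup>1\<close> is the following number.\<close>

definition normal_trace :: "(real ^ 2) set \<Rightarrow> (real ^ 2 \<Rightarrow> real ^ 2) \<Rightarrow> (real ^ 2 \<Rightarrow> real) \<Rightarrow> real" where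
  "normal_trace \<Omega> q \<phi> = L2_inner \<Omega> q (weak_grad \<Omega> \<phi>) + L2_inner \<Omega> (L2_div \<Omega> q) \<phi>"

definition H0div :: "(real ^ 2) set \<Rightarrow> (real ^ 2 \<Rightarrow> real ^ 'c ^ 2) set" where
  "H0div \<Omega> = {p \<in> L2 \<Omega>. \<forall>i. (\<exists>d. has_L2_div \<Omega> (\<lambda>x. column i (p x)) d) \<and>
     (\<forall>\<phi> \<in> H1 \<Omega>. normal_trace \<Omega> (\<lambda>x. column i (p x)) \<phi> = 0)}"

end

theory Submission imports Defs begin

text \<open>
  Let \<open>u\<close> be the projected divergence of the dual minimiser \<open>p\<close> and put \<open>\<sigma> = \<tau>0 - \<delta> u\<close>, which is again
  divergence free. The dual constraint set is convex, so minimality of \<open>p\<close> is the variational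
  inequality \<open>\<langle>\<sigma>, div q\<rangle> \<le> \<langle>\<sigma>, u\<rangle>\<close>; testing with compactly supported \<open>q\<close> gives \<open>TV \<sigma> \<le> \<langle>\<sigma>, u\<rangle>\<close>.
  Conversely \<open>TV \<tau> \<ge> \<langle>\<tau>, div p\<rangle> = \<langle>\<tau>, u\<rangle>\<close>, because \<open>div p\<close> is a weak limit of divergences of
  admissible compactly supported fields. Comparing the primal energies of \<open>\<tau>\<close> and \<open>\<sigma>\<close> now leaves
  \<open>\<parallel>\<tau> - \<sigma>\<parallel>\<^sup>2 \<le> 0\<close>.

  The weak approximation is where the Lipschitz boundary enters: each piece \<open>\<theta> p\<close> of a partition of
  unity is mollified with a kernel supported in a small ball off the origin that pushes the support
  into the domain. As the normal trace of \<open>p\<close> vanishes, the divergence of the mollified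
  piece is the mollified \<open>\<theta> div p + \<nabla>\<theta> \<bullet> p\<close>, without a boundary term.
\<close>

section \<open>The space \<open>L\<^sup>2\<close>: completeness and orthogonal projection\<close>

text \<open>Admissible fields must have compact support in the domain and obey the bound 1 exactly,
  while only a vanishing normal trace is available. Centred mollification of the zero extension
  would carry the support across the boundary. An inward shift prevents this, but the inward
  direction varies along the boundary, so every piece of the partition has its own kernel. The sum
  is then no longer a single average of \<open>q\<close>: uniform continuity of the weights gives
  only the bound 1 + e, and division by a factor tending to 1 restores 1. Weak convergence of the
  divergences suffices, since \<open>TV\<close> is a supremum of linear functionals and a single
  field is tested.

  \<open>L2_proj\<close>, \<open>L2_div\<close> and \<open>weak_grad\<close> choose representatives.
  They become usable through existence (completeness of L2) and uniqueness almost everywhere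
  (fundamental lemma). They need not be linear as functions, so linear relations are read off from
  pairings or hold almost everywhere.

  At the end the square is completed: after the two bounds on \<open>TV\<close>, the difference of
  the primal energies is the norm square of \<tau> - \<sigma> over 2 \<delta>.\<close>

lemma L2_measurable: "f \<in> L2 \<Omega> \<Longrightarrow> f \<in> borel_measurable (lebesgue_on \<Omega>)"
  by (simp add: L2_def)

lemma L2_square_integrable: "f \<in> L2 \<Omega> \<Longrightarrow> integrable (lebesgue_on \<Omega>) (\<lambda>x. (norm (f x))\<^sup>2)"
  by (simp add: L2_def)

lemma abs_inner_le_squares:
  fixes u v :: "'b::real_inner"
  shows "\<bar>u \<bullet> v\<bar> \<le> (norm u)\<^sup>2 + (norm v)\<^sup>2"
proof -
  have "\<bar>u \<bullet> v\<bar> \<le> norm u * norm v"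
    by (rule Cauchy_Schwarz_ineq2)
  also have "\<dots> \<le> (norm u)\<^sup>2 + (norm v)\<^sup>2"
    using sum_squares_bound[of "norm u" "norm v"] mult_nonneg_nonneg[OF norm_ge_zero[of u] norm_ge_zero[of v]]
    by linarith
  finally show ?thesis .
qed

lemma norm_add_square_le:
  fixes u v :: "'b::real_inner"
  shows "(norm (u + v))\<^sup>2 \<le> 2 * (norm u)\<^sup>2 + 2 * (norm v)\<^sup>2"
  using zero_le_power2[of "norm (u - v)"]
  by (simp add: power2_norm_eq_inner inner_simps inner_commute)

lemma L2_inner_integrable:
  fixes f g :: "real ^ 2 \<Rightarrow> 'b::euclidean_space"
  assumes "f \<in> L2 \<Omega>" "g \<in> L2 \<Omega>"
  shows "integrable (lebesgue_on \<Omega>) (\<lambda>x. f x \<bullet> g x)"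
proof (rule Bochner_Integration.integrable_bound)
  show "integrable (lebesgue_on \<Omega>) (\<lambda>x. (norm (f x))\<^sup>2 + (norm (g x))\<^sup>2)"
    using assms by (simp add: L2_square_integrable)
  show "(\<lambda>x. f x \<bullet> g x) \<in> borel_measurable (lebesgue_on \<Omega>)"
    using assms by (intro borel_measurable_inner L2_measurable)
qed (use abs_inner_le_squares in auto)

lemma L2_add:
  fixes f g :: "real ^ 2 \<Rightarrow> 'b::euclidean_space"
  assumes "f \<in> L2 \<Omega>" "g \<in> L2 \<Omega>"
  shows "(\<lambda>x. f x + g x) \<in> L2 \<Omega>"
proof -
  have m: "(\<lambda>x. f x + g x) \<in> borel_measurable (lebesgue_on \<Omega>)"
    using assms by (intro borel_measurable_add L2_measurable)
  have "integrable (lebesgue_on \<Omega>) (\<lambda>x. (norm (f x + g x))\<^sup>2)"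
  proof (rule Bochner_Integration.integrable_bound)
    show "integrable (lebesgue_on \<Omega>) (\<lambda>x. 2 * (norm (f x))\<^sup>2 + 2 * (norm (g x))\<^sup>2)"
      using assms by (simp add: L2_square_integrable)
    show "(\<lambda>x. (norm (f x + g x))\<^sup>2) \<in> borel_measurable (lebesgue_on \<Omega>)"
      using m by measurable
  qed (use norm_add_square_le in auto)
  with m show ?thesis by (simp add: L2_def)
qed

lemma L2_scaleR:
  fixes f :: "real ^ 2 \<Rightarrow> 'b::euclidean_space"
  assumes "f \<in> L2 \<Omega>"
  shows "(\<lambda>x. a *\<^sub>R f x) \<in> L2 \<Omega>"
  using assms by (auto simp: L2_def power_mult_distrib)

lemma L2_minus:
  fixes f :: "real ^ 2 \<Rightarrow> 'b::euclidean_space"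
  shows "f \<in> L2 \<Omega> \<Longrightarrow> (\<lambda>x. - f x) \<in> L2 \<Omega>"
  by (auto simp: L2_def)

lemma L2_diff:
  fixes f g :: "real ^ 2 \<Rightarrow> 'b::euclidean_space"
  shows "f \<in> L2 \<Omega> \<Longrightarrow> g \<in> L2 \<Omega> \<Longrightarrow> (\<lambda>x. f x - g x) \<in> L2 \<Omega>"
  using L2_add[OF _ L2_minus, of f \<Omega> g] by simp

lemma L2_sum:
  fixes f :: "'i \<Rightarrow> real ^ 2 \<Rightarrow> 'b::euclidean_space"
  assumes "\<And>i. i \<in> I \<Longrightarrow> f i \<in> L2 \<Omega>"
  shows "(\<lambda>x. \<Sum>i\<in>I. f i x) \<in> L2 \<Omega>"
  using assms
proof (induction I rule: infinite_finite_induct)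
  case (insert i I)
  then show ?case using L2_add[of "f i" \<Omega> "\<lambda>x. \<Sum>i\<in>I. f i x"] by simp
qed (auto simp: L2_def)

lemma L2_bounded_mult:
  fixes f :: "real ^ 2 \<Rightarrow> 'b::euclidean_space"
  assumes f: "f \<in> L2 \<Omega>" and g: "g \<in> borel_measurable (lebesgue_on \<Omega>)"
    and b: "\<And>x. x \<in> \<Omega> \<Longrightarrow> norm (g x) \<le> B * norm (f x)"
  shows "g \<in> L2 \<Omega>"
proof -
  have "integrable (lebesgue_on \<Omega>) (\<lambda>x. (norm (g x))\<^sup>2)"
  proof (rule Bochner_Integration.integrable_bound)
    show "integrable (lebesgue_on \<Omega>) (\<lambda>x. B\<^sup>2 * (norm (f x))\<^sup>2)"
      using f by (simp add: L2_square_integrable)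
    show "(\<lambda>x. (norm (g x))\<^sup>2) \<in> borel_measurable (lebesgue_on \<Omega>)"
      using g by measurable
    show "AE x in lebesgue_on \<Omega>. norm ((norm (g x))\<^sup>2) \<le> norm (B\<^sup>2 * (norm (f x))\<^sup>2)"
    proof (rule AE_I2)
      fix x assume "x \<in> space (lebesgue_on \<Omega>)"
      then have "x \<in> \<Omega>" by (simp add: space_restrict_space)
      from power_mono[OF b[OF this] norm_ge_zero, of 2]
      show "norm ((norm (g x))\<^sup>2) \<le> norm (B\<^sup>2 * (norm (f x))\<^sup>2)"
        by (simp add: power_mult_distrib)
    qed
  qed
  with g show ?thesis by (simp add: L2_def)
qed

lemma L2_bounded_linear:
  fixes f :: "real ^ 2 \<Rightarrow> 'b::euclidean_space" and T :: "'b \<Rightarrow> 'c::euclidean_space"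
  assumes T: "bounded_linear T" and f: "f \<in> L2 \<Omega>"
  shows "(\<lambda>x. T (f x)) \<in> L2 \<Omega>"
proof -
  obtain B where "\<And>x. norm (T x) \<le> norm x * B" using bounded_linear.bounded[OF T] by blast
  then show ?thesis
    using measurable_compose[OF L2_measurable[OF f] borel_measurable_continuous_onI[OF linear_continuous_on[OF T]]]
    by (intro L2_bounded_mult[OF f, where B = B]) (auto simp: mult.commute)
qed

lemmas L2_component = L2_bounded_linear[OF bounded_linear_vec_nth]
lemmas L2_scaleR_const = L2_bounded_linear[OF bounded_linear_scaleR_left]

lemma L2_inner_commute: "L2_inner \<Omega> f g = L2_inner \<Omega> g f"
  by (simp add: L2_inner_def inner_commute)

lemma L2_inner_add_left:
  assumes "f \<in> L2 \<Omega>" "g \<in> L2 \<Omega>" "h \<in> L2 \<Omega>"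
  shows "L2_inner \<Omega> (\<lambda>x. f x + g x) h = L2_inner \<Omega> f h + L2_inner \<Omega> g h"
  using assms by (simp add: L2_inner_def inner_add_left L2_inner_integrable)

lemma L2_inner_scaleR_left: "L2_inner \<Omega> (\<lambda>x. a *\<^sub>R f x) h = a * L2_inner \<Omega> f h"
  by (simp add: L2_inner_def)

lemma L2_inner_minus_left: "L2_inner \<Omega> (\<lambda>x. - f x) h = - L2_inner \<Omega> f h"
  by (simp add: L2_inner_def)

lemma L2_inner_diff_left:
  assumes "f \<in> L2 \<Omega>" "g \<in> L2 \<Omega>" "h \<in> L2 \<Omega>"
  shows "L2_inner \<Omega> (\<lambda>x. f x - g x) h = L2_inner \<Omega> f h - L2_inner \<Omega> g h"
  using assms by (simp add: L2_inner_def inner_diff_left L2_inner_integrable)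

lemma L2_inner_add_right:
  assumes "f \<in> L2 \<Omega>" "g \<in> L2 \<Omega>" "h \<in> L2 \<Omega>"
  shows "L2_inner \<Omega> h (\<lambda>x. f x + g x) = L2_inner \<Omega> h f + L2_inner \<Omega> h g"
  using L2_inner_add_left[OF assms] by (simp add: L2_inner_commute)

lemma L2_inner_scaleR_right: "L2_inner \<Omega> h (\<lambda>x. a *\<^sub>R f x) = a * L2_inner \<Omega> h f"
  by (simp add: L2_inner_def)

lemma L2_inner_minus_right: "L2_inner \<Omega> h (\<lambda>x. - f x) = - L2_inner \<Omega> h f"
  by (simp add: L2_inner_def)

lemma L2_inner_diff_right:
  assumes "f \<in> L2 \<Omega>" "g \<in> L2 \<Omega>" "h \<in> L2 \<Omega>"
  shows "L2_inner \<Omega> h (\<lambda>x. f x - g x) = L2_inner \<Omega> h f - L2_inner \<Omega> h g"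
  using L2_inner_diff_left[OF assms] by (simp add: L2_inner_commute)

lemma L2_inner_self: "L2_inner \<Omega> f f = (\<integral>x. (norm (f x))\<^sup>2 \<partial>lebesgue_on \<Omega>)"
  by (simp add: L2_inner_def power2_norm_eq_inner)

lemma L2_inner_self_nonneg: "L2_inner \<Omega> f f \<ge> 0"
  by (simp add: L2_inner_self)

lemma L2_norm_square: "(L2_norm \<Omega> f)\<^sup>2 = L2_inner \<Omega> f f"
  by (simp add: L2_norm_def L2_inner_self_nonneg)

lemma L2_inner_cong_AE:
  assumes "AE x in lebesgue_on \<Omega>. f x = f' x" "AE x in lebesgue_on \<Omega>. g x = g' x"
    and "f \<in> L2 \<Omega>" "g \<in> L2 \<Omega>" "f' \<in> L2 \<Omega>" "g' \<in> L2 \<Omega>"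
  shows "L2_inner \<Omega> f g = L2_inner \<Omega> f' g'"
  unfolding L2_inner_def
proof (rule integral_cong_AE)
  show "AE x in lebesgue_on \<Omega>. f x \<bullet> g x = f' x \<bullet> g' x"
    using assms(1,2) by eventually_elim simp
qed (use assms in \<open>auto simp: L2_def\<close>)

lemma L2_inner_self_eq_0:
  assumes "f \<in> L2 \<Omega>" "L2_inner \<Omega> f f \<le> 0"
  shows "AE x in lebesgue_on \<Omega>. f x = 0"
proof -
  have "(\<integral>x. (norm (f x))\<^sup>2 \<partial>lebesgue_on \<Omega>) = 0"
    using assms(2) L2_inner_self_nonneg[of \<Omega> f] unfolding L2_inner_self by linarith
  then have "AE x in lebesgue_on \<Omega>. (norm (f x))\<^sup>2 = 0"
    using integral_nonneg_eq_0_iff_AE[OF L2_square_integrable[OF assms(1)]] by simp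
  then show ?thesis by simp
qed

lemma L2_Young:
  assumes "f \<in> L2 \<Omega>" "g \<in> L2 \<Omega>"
  shows "2 * \<bar>L2_inner \<Omega> f g\<bar> \<le> L2_inner \<Omega> f f + L2_inner \<Omega> g g"
proof -
  have "0 \<le> L2_inner \<Omega> (\<lambda>x. f x - g x) (\<lambda>x. f x - g x)"
    "0 \<le> L2_inner \<Omega> (\<lambda>x. f x + g x) (\<lambda>x. f x + g x)"
    by (simp_all add: L2_inner_self_nonneg)
  then show ?thesis using assms
    by (simp add: L2_inner_diff_left L2_inner_diff_right L2_inner_add_left L2_inner_add_right
        L2_diff L2_add L2_inner_commute[of \<Omega> g f])
qed

lemma L2_Cauchy_Schwarz:
  assumes f: "f \<in> L2 \<Omega>" and g: "g \<in> L2 \<Omega>"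
  shows "(L2_inner \<Omega> f g)\<^sup>2 \<le> L2_inner \<Omega> f f * L2_inner \<Omega> g g"
proof -
  have *: "0 \<le> L2_inner \<Omega> f f - 2 * s * L2_inner \<Omega> f g + s\<^sup>2 * L2_inner \<Omega> g g" for s
  proof -
    have "0 \<le> L2_inner \<Omega> (\<lambda>x. f x - s *\<^sub>R g x) (\<lambda>x. f x - s *\<^sub>R g x)"
      by (rule L2_inner_self_nonneg)
    also have "\<dots> = L2_inner \<Omega> f f - 2 * s * L2_inner \<Omega> f g + s\<^sup>2 * L2_inner \<Omega> g g"
      using f g
      by (simp add: L2_inner_diff_left L2_inner_diff_right L2_diff L2_scaleR L2_inner_scaleR_left
          L2_inner_scaleR_right L2_inner_commute[of \<Omega> g f] power2_eq_square algebra_simps)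
    finally show ?thesis .
  qed
  show ?thesis
  proof (cases "L2_inner \<Omega> g g = 0")
    case True
    have "L2_inner \<Omega> f g = 0"
    proof (rule ccontr)
      \<comment> \<open>With \<open>g\<close> null the inequality \<open>*\<close> is affine in s.
        The s used here makes its right side equal to -1.\<close>
      assume n: "L2_inner \<Omega> f g \<noteq> 0"
      have "0 \<le> L2_inner \<Omega> f f - 2 * ((L2_inner \<Omega> f f + 1) / (2 * L2_inner \<Omega> f g)) * L2_inner \<Omega> f g"
        using *[of "(L2_inner \<Omega> f f + 1) / (2 * L2_inner \<Omega> f g)"] True by simp
      with n show False by simp
    qed
    with True show ?thesis by simp
  next
    case False
    with L2_inner_self_nonneg[of \<Omega> g] have p: "L2_inner \<Omega> g g > 0" by linarith
    have "0 \<le> L2_inner \<Omega> f f - (L2_inner \<Omega> f g)\<^sup>2 / L2_inner \<Omega> g g"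
      using *[of "L2_inner \<Omega> f g / L2_inner \<Omega> g g"] p
      by (simp add: power2_eq_square field_simps)
    with p show ?thesis by (simp add: field_simps)
  qed
qed

text \<open>Geometric decay lets the partial sums be dominated pointwise by the root of
  the integrable function \<open>S = \<Sum>k. 4 ^ k * (norm (f (k+1) - f k))\<^sup>2\<close>.\<close>

lemma L2_complete_geometric:
  fixes f :: "nat \<Rightarrow> real ^ 2 \<Rightarrow> 'b::euclidean_space"
  assumes f: "\<And>n. f n \<in> L2 \<Omega>"
    and geo: "\<And>n. L2_inner \<Omega> (\<lambda>x. f (Suc n) x - f n x) (\<lambda>x. f (Suc n) x - f n x) \<le> C * (1/8)^n"
  shows "\<exists>g \<in> L2 \<Omega>. (\<lambda>n. L2_inner \<Omega> (\<lambda>x. f n x - g x) (\<lambda>x. f n x - g x)) \<longlonglongrightarrow> 0"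
proof -
  let ?M = "lebesgue_on \<Omega>"
  have fm[measurable]: "f n \<in> borel_measurable ?M" for n by (rule L2_measurable[OF f])
  define D where "D k x = norm (f (Suc k) x - f k x)" for k x
  have Dm[measurable]: "D k \<in> borel_measurable ?M" for k unfolding D_def by measurable
  have Di: "integrable ?M (\<lambda>x. (D k x)\<^sup>2)" for k
    unfolding D_def by (intro L2_square_integrable L2_diff f)
  have DC: "(\<integral>x. (D k x)\<^sup>2 \<partial>?M) \<le> C * (1/8)^k" for k
    using geo[of k] by (simp add: D_def L2_inner_self)
  have C0: "C \<ge> 0"
    using DC[of 0] order_trans[OF integral_nonneg_AE[of "\<lambda>x. (D 0 x)\<^sup>2" ?M]] by simp
  define S where "S x = (\<Sum>k. 4^k * (D k x)\<^sup>2)" for x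
  have i4: "integrable ?M (\<lambda>x. 4^k * (D k x)\<^sup>2)" for k using Di by simp
  \<comment> \<open>The decay 1/8 beats the weight 4: the k-th term is at most C times (1/2)^k. The
    weight is what makes the increments geometrically small pointwise below.\<close>
  have sumI: "summable (\<lambda>k. \<integral>x. norm (4^k * (D k x)\<^sup>2) \<partial>?M)"
  proof (rule summable_comparison_test')
    show "summable (\<lambda>k. C * (1/2::real)^k)" by (intro summable_mult summable_geometric) simp
    fix k :: nat
    have "4^k * (\<integral>x. (D k x)\<^sup>2 \<partial>?M) \<le> 4^k * (C * (1/8)^k)"
      by (intro mult_left_mono DC) simp
    also have "\<dots> = C * (1/2)^k"
      using power_mult_distrib[of "4::real" "1/8" k] by simp
    finally show "norm (\<integral>x. norm (4^k * (D k x)\<^sup>2) \<partial>?M) \<le> C * (1/2::real)^k" by simp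
  qed
  \<comment> \<open>Monotone convergence in \<open>ennreal\<close> needs no prior integrability;
    finiteness of the integral of the series then yields pointwise summability almost
    everywhere.\<close>
  have "(\<Sum>k. ennreal (\<integral>x. norm (4^k * (D k x)\<^sup>2) \<partial>?M)) < \<infinity>"
    using sumI by (simp add: suminf_ennreal2 less_top)
  then have "(\<integral>\<^sup>+x. (\<Sum>k. ennreal (4^k * (D k x)\<^sup>2)) \<partial>?M) < \<infinity>"
    using i4 by (subst nn_integral_suminf) (auto simp: nn_integral_eq_integral)
  then have "AE x in ?M. (\<Sum>k. ennreal (4^k * (D k x)\<^sup>2)) \<noteq> \<infinity>"
    by (intro nn_integral_noteq_infinite) auto
  then have AEs: "AE x in ?M. summable (\<lambda>k. 4^k * (D k x)\<^sup>2)"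
    by eventually_elim (rule summable_suminf_not_top, auto)
  have Sint: "integrable ?M S"
    unfolding S_def using i4 _ sumI by (rule integrable_suminf) (use AEs in simp)
  define g where "g x = lim (\<lambda>n. f n x)" for x
  have key: "(\<lambda>n. f n x) \<longlonglongrightarrow> g x \<and> (\<forall>n. (norm (f n x - g x))\<^sup>2 \<le> 4 * (1/4)^n * S x)"
    if s: "summable (\<lambda>k. 4^k * (D k x)\<^sup>2)" for x
  proof -
    have S0: "S x \<ge> 0" unfolding S_def by (intro suminf_nonneg s) simp
    \<comment> \<open>A single term is at most the whole sum \<open>S x\<close>, so the increments
      decay like 2^-k with a factor depending on x only. This gives pointwise convergence together
      with the rate 4 * (1/4)^n.\<close>
    have Dk: "D k x \<le> (1/2)^k * sqrt (S x)" for k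
    proof -
      have "4^k * (D k x)\<^sup>2 \<le> S x"
        unfolding S_def using sum_le_suminf[OF s, of "{k}"] by simp
      then have "(2^k * D k x)\<^sup>2 \<le> S x"
        using power_mult_distrib[of "2::real" 2 k] by (simp add: power_mult_distrib power2_eq_square mult_ac)
      then have "2^k * D k x \<le> sqrt (S x)" by (rule real_le_rsqrt)
      then have "(1/2)^k * (2^k * D k x) \<le> (1/2)^k * sqrt (S x)" by (intro mult_left_mono) auto
      moreover have "(1/2)^k * (2^k * D k x) = D k x" by (simp add: power_one_over)
      ultimately show ?thesis by simp
    qed
    have sg: "(\<lambda>k. (1/2)^(k+n) * sqrt (S x)) sums (2 * (1/2)^n * sqrt (S x))" for n
      using sums_mult2[OF geometric_sums[of "1/2::real"], of "(1/2)^n * sqrt (S x)"]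
      by (simp add: power_add mult.assoc)
    have sD: "summable (\<lambda>k. norm (f (Suc (k+n)) x - f (k+n) x))" for n
      by (rule summable_comparison_test'[OF sums_summable[OF sg[of n]], of 0])
        (use Dk in \<open>auto simp: D_def\<close>)
    have "summable (\<lambda>k. f (Suc k) x - f k x)"
      using summable_norm_cancel[OF sD[of 0]] by simp
    then have "convergent (\<lambda>n. f n x - f 0 x)"
      using sum_lessThan_telescope[of "\<lambda>n. f n x"] by (simp add: summable_iff_convergent)
    then have "convergent (\<lambda>n. f n x - f 0 x + f 0 x)"
      by (rule convergent_add[OF _ convergent_const])
    then have "convergent (\<lambda>n. f n x)" by simp
    then have lim: "(\<lambda>n. f n x) \<longlonglongrightarrow> g x" by (simp add: g_def convergent_LIMSEQ_iff)
    have "(norm (f n x - g x))\<^sup>2 \<le> 4 * (1/4)^n * S x" for n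
    proof -
      have "(\<lambda>k. f (Suc (k+n)) x - f (k+n) x) sums (g x - f n x)"
        using telescope_sums[of "\<lambda>k. f (k+n) x" "g x"] LIMSEQ_ignore_initial_segment[OF lim, of n]
        by simp
      then have "norm (g x - f n x) \<le> (\<Sum>k. norm (f (Suc (k+n)) x - f (k+n) x))"
        using summable_norm[OF sD[of n]] by (simp add: sums_iff)
      also have "\<dots> \<le> 2 * (1/2)^n * sqrt (S x)"
        using suminf_le[OF _ sD[of n] sums_summable[OF sg[of n]]] Dk sg[of n]
        by (simp add: sums_iff D_def)
      finally have "(norm (g x - f n x))\<^sup>2 \<le> (2 * (1/2)^n * sqrt (S x))\<^sup>2"
        by (intro power_mono) auto
      also have "\<dots> = 4 * (1/4)^n * S x"
        using S0 power_mult_distrib[of "1/2::real" "1/2" n] by (simp add: power_mult_distrib power2_eq_square)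
      finally show ?thesis by (simp add: norm_minus_commute)
    qed
    with lim show ?thesis by blast
  qed
  \<comment> \<open>\<open>lim\<close> is measurable as a total function, including the null set on
    which the sequence may diverge.\<close>
  have gm[measurable]: "g \<in> borel_measurable ?M"
    unfolding g_def by measurable
  have dom: "AE x in ?M. (norm (f n x - g x))\<^sup>2 \<le> 4 * (1/4)^n * S x" for n
    using AEs by eventually_elim (use key in blast)
  have dL2: "(\<lambda>x. f n x - g x) \<in> L2 \<Omega>" for n
  proof -
    have "integrable ?M (\<lambda>x. (norm (f n x - g x))\<^sup>2)"
    proof (rule Bochner_Integration.integrable_bound)
      show "integrable ?M (\<lambda>x. 4 * (1/4)^n * S x)" using Sint by simp
      show "AE x in ?M. norm ((norm (f n x - g x))\<^sup>2) \<le> norm (4 * (1/4)^n * S x)"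
        using dom[of n] by eventually_elim simp
    qed measurable
    then show ?thesis by (simp add: L2_def)
  qed
  have "g \<in> L2 \<Omega>"
    using L2_diff[OF f[of 0] dL2[of 0]] by simp
  moreover have "(\<lambda>n. L2_inner \<Omega> (\<lambda>x. f n x - g x) (\<lambda>x. f n x - g x)) \<longlonglongrightarrow> 0"
  proof (rule tendsto_sandwich[OF _ _ tendsto_const])
    show "\<forall>\<^sub>F n in sequentially. L2_inner \<Omega> (\<lambda>x. f n x - g x) (\<lambda>x. f n x - g x) \<le> (1/4)^n * (4 * integral\<^sup>L ?M S)"
    proof (rule always_eventually, rule allI)
      fix n
      have "(\<integral>x. (norm (f n x - g x))\<^sup>2 \<partial>?M) \<le> (\<integral>x. 4 * (1/4)^n * S x \<partial>?M)"
        by (rule integral_mono_AE) (use dom dL2 Sint in \<open>auto intro: L2_square_integrable\<close>)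
      then show "L2_inner \<Omega> (\<lambda>x. f n x - g x) (\<lambda>x. f n x - g x) \<le> (1/4)^n * (4 * integral\<^sup>L ?M S)"
        by (simp add: L2_inner_self mult_ac)
    qed
    show "(\<lambda>n. (1/4)^n * (4 * integral\<^sup>L ?M S)) \<longlonglongrightarrow> 0"
      using tendsto_mult_left_zero[OF LIMSEQ_power_zero[of "1/4::real"]] by simp
  qed (simp add: L2_inner_self_nonneg)
  ultimately show ?thesis by blast
qed

lemma L2_zero: "(\<lambda>x. 0) \<in> L2 \<Omega>"
  by (simp add: L2_def)

lemma L2_inner_square_diff:
  assumes "f \<in> L2 \<Omega>" "g \<in> L2 \<Omega>"
  shows "L2_inner \<Omega> (\<lambda>x. f x - g x) (\<lambda>x. f x - g x) = L2_inner \<Omega> f f - 2 * L2_inner \<Omega> f g + L2_inner \<Omega> g g"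
  using assms by (simp add: L2_inner_diff_left L2_inner_diff_right L2_diff L2_inner_commute[of \<Omega> g f])

lemma L2_inner_square_add:
  assumes "f \<in> L2 \<Omega>" "g \<in> L2 \<Omega>"
  shows "L2_inner \<Omega> (\<lambda>x. f x + g x) (\<lambda>x. f x + g x) = L2_inner \<Omega> f f + 2 * L2_inner \<Omega> f g + L2_inner \<Omega> g g"
  using assms by (simp add: L2_inner_add_left L2_inner_add_right L2_add L2_inner_commute[of \<Omega> g f])

lemma L2_inner_tendsto:
  assumes "\<And>n. f n \<in> L2 \<Omega>" "g \<in> L2 \<Omega>" "h \<in> L2 \<Omega>"
    and lim: "(\<lambda>n. L2_inner \<Omega> (\<lambda>x. f n x - g x) (\<lambda>x. f n x - g x)) \<longlonglongrightarrow> 0"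
  shows "(\<lambda>n. L2_inner \<Omega> (f n) h) \<longlonglongrightarrow> L2_inner \<Omega> g h"
proof -
  have "(\<lambda>n. L2_inner \<Omega> (\<lambda>x. f n x - g x) h) \<longlonglongrightarrow> 0"
  proof (rule Lim_null_comparison)
    have "(\<lambda>n. sqrt (L2_inner \<Omega> (\<lambda>x. f n x - g x) (\<lambda>x. f n x - g x) * L2_inner \<Omega> h h)) \<longlonglongrightarrow> sqrt (0 * L2_inner \<Omega> h h)"
      by (intro tendsto_intros lim)
    then show "(\<lambda>n. sqrt (L2_inner \<Omega> (\<lambda>x. f n x - g x) (\<lambda>x. f n x - g x) * L2_inner \<Omega> h h)) \<longlonglongrightarrow> 0"
      by simp
    show "\<forall>\<^sub>F n in sequentially. norm (L2_inner \<Omega> (\<lambda>x. f n x - g x) h) \<le>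
        sqrt (L2_inner \<Omega> (\<lambda>x. f n x - g x) (\<lambda>x. f n x - g x) * L2_inner \<Omega> h h)"
    proof (rule always_eventually, rule allI)
      fix n
      show "norm (L2_inner \<Omega> (\<lambda>x. f n x - g x) h) \<le>
        sqrt (L2_inner \<Omega> (\<lambda>x. f n x - g x) (\<lambda>x. f n x - g x) * L2_inner \<Omega> h h)"
        using L2_Cauchy_Schwarz[OF L2_diff[OF assms(1)[of n] assms(2)] assms(3)]
        by (simp add: real_le_rsqrt)
    qed
  qed
  then have "(\<lambda>n. L2_inner \<Omega> (f n) h - L2_inner \<Omega> g h) \<longlonglongrightarrow> 0"
    using assms by (simp add: L2_inner_diff_left)
  then show ?thesis by (rule LIM_zero_cancel)
qed

text \<open>The nearest point is the limit of a minimising sequence, which is Cauchy by the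
  parallelogram law. As an annihilator, \<open>K\<close> is a subspace, and it is closed because the
  inner product is continuous; both are derived rather than assumed.\<close>

lemma L2_projection_exists:
  fixes f :: "real ^ 2 \<Rightarrow> 'b::euclidean_space"
  assumes f: "f \<in> L2 \<Omega>" and W: "W \<subseteq> L2 \<Omega>"
    and K: "K = {k \<in> L2 \<Omega>. \<forall>w \<in> W. L2_inner \<Omega> k w = 0}"
  shows "\<exists>g \<in> K. \<forall>k \<in> K. L2_inner \<Omega> (\<lambda>x. f x - g x) k = 0"
proof -
  have KL: "k \<in> L2 \<Omega>" if "k \<in> K" for k using that K by blast
  have Kadd: "(\<lambda>x. k x + s *\<^sub>R l x) \<in> K" if "k \<in> K" "l \<in> K" for k l and s :: real
    using that W unfolding K
    by (auto simp: L2_add L2_scaleR subset_iff L2_inner_add_left L2_inner_scaleR_left)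
  have K0: "(\<lambda>x. 0) \<in> K" unfolding K by (simp add: L2_zero L2_inner_def)
  define d where "d k = L2_inner \<Omega> (\<lambda>x. f x - k x) (\<lambda>x. f x - k x)" for k
  define m where "m = Inf (d ` K)"
  have bdd: "bdd_below (d ` K)"
    by (rule bdd_belowI[of _ 0]) (auto simp: d_def L2_inner_self_nonneg)
  have m: "m \<le> d k" if "k \<in> K" for k
    unfolding m_def using bdd that by (simp add: cInf_lower)
  have "\<exists>k \<in> K. d k < m + (1/8)^n" for n :: nat
    using cInf_lessD[of "d ` K" "m + (1/8)^n"] K0 by (auto simp: m_def)
  \<comment> \<open>The excess (1/8)^n is chosen to match the rate demanded by
    \<open>L2_complete_geometric\<close>.\<close>
  then obtain k where k: "\<And>n. k n \<in> K" and dk: "\<And>n::nat. d (k n) < m + (1/8)^n"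
    by metis
  have kL: "k n \<in> L2 \<Omega>" for n using KL k by blast
  \<comment> \<open>Parallelogram identity: |a - b|^2 = 2|a|^2 + 2|b|^2 - |a + b|^2, and the
    midpoint of two iterates lies in \<open>K\<close>, whence |a + b|^2 >= 4m. \<open>?mid\<close>
    is written so that \<open>Kadd\<close> applies twice.\<close>
  have par: "L2_inner \<Omega> (\<lambda>x. k (Suc n) x - k n x) (\<lambda>x. k (Suc n) x - k n x) \<le> 4 * (1/8)^n" for n
  proof -
    let ?a = "\<lambda>x. f x - k n x" and ?b = "\<lambda>x. f x - k (Suc n) x"
    let ?mid = "\<lambda>x. k n x + (1/2) *\<^sub>R (\<lambda>x. k (Suc n) x + (-1) *\<^sub>R k n x) x"
    have ab: "?a \<in> L2 \<Omega>" "?b \<in> L2 \<Omega>" by (intro L2_diff f kL)+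
    have "?mid \<in> K" by (rule Kadd[OF k Kadd[OF k k]])
    then have m1: "m \<le> d ?mid" by (rule m)
    have mid: "(\<lambda>x. f x - ?mid x) = (\<lambda>x. (1/2) *\<^sub>R (?a x + ?b x))"
      by (rule ext, rule euclidean_eqI) (simp add: inner_simps field_simps)
    have "d ?mid = (1/4) * L2_inner \<Omega> (\<lambda>x. ?a x + ?b x) (\<lambda>x. ?a x + ?b x)"
      unfolding d_def mid L2_inner_scaleR_left L2_inner_scaleR_right[where f="\<lambda>x. ?a x + ?b x"] by simp
    with m1 have 1: "4 * m \<le> L2_inner \<Omega> (\<lambda>x. ?a x + ?b x) (\<lambda>x. ?a x + ?b x)" by simp
    have 2: "(\<lambda>x. k (Suc n) x - k n x) = (\<lambda>x. ?a x - ?b x)" by auto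
    have "L2_inner \<Omega> (\<lambda>x. k (Suc n) x - k n x) (\<lambda>x. k (Suc n) x - k n x) \<le> 2 * d (k n) + 2 * d (k (Suc n)) - 4 * m"
      unfolding 2 using 1 L2_inner_square_diff[OF ab] L2_inner_square_add[OF ab] by (simp add: d_def)
    also have "\<dots> \<le> 2 * (1/8)^n + 2 * (1/8)^Suc n"
      using dk[of n] dk[of "Suc n"] by simp
    also have "\<dots> \<le> 4 * (1/8)^n" by simp
    finally show ?thesis .
  qed
  obtain g where g: "g \<in> L2 \<Omega>"
    and lim: "(\<lambda>n. L2_inner \<Omega> (\<lambda>x. k n x - g x) (\<lambda>x. k n x - g x)) \<longlonglongrightarrow> 0"
    using L2_complete_geometric[of k, OF kL par] by blast
  have gK: "g \<in> K"
    unfolding K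
  proof (intro CollectI conjI ballI)
    fix w assume "w \<in> W"
    then have "(\<lambda>n. L2_inner \<Omega> (k n) w) \<longlonglongrightarrow> L2_inner \<Omega> g w"
      using L2_inner_tendsto[OF kL g _ lim] W by blast
    moreover have "L2_inner \<Omega> (k n) w = 0" for n using k[of n] \<open>w \<in> W\<close> K by blast
    ultimately show "L2_inner \<Omega> g w = 0" by (simp add: LIMSEQ_const_iff)
  qed (rule g)
  have dg: "d g \<le> m"
  proof (rule LIMSEQ_le)
    have fg: "(\<lambda>x. f x - g x) \<in> L2 \<Omega>" by (intro L2_diff f g)
    have kg: "(\<lambda>x. k n x - g x) \<in> L2 \<Omega>" for n by (intro L2_diff kL g)
    have "L2_inner \<Omega> (\<lambda>x. k n x - g x) (\<lambda>x. f x - g x) = L2_inner \<Omega> (k n) (\<lambda>x. f x - g x) - L2_inner \<Omega> g (\<lambda>x. f x - g x)" for n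
      by (rule L2_inner_diff_left[OF kL g fg])
    then have "(\<lambda>n. L2_inner \<Omega> (\<lambda>x. k n x - g x) (\<lambda>x. f x - g x)) \<longlonglongrightarrow> 0"
      using L2_inner_tendsto[OF kL g fg lim] by (simp add: LIM_zero)
    then have "(\<lambda>n. d g - 2 * L2_inner \<Omega> (\<lambda>x. k n x - g x) (\<lambda>x. f x - g x) + L2_inner \<Omega> (\<lambda>x. k n x - g x) (\<lambda>x. k n x - g x)) \<longlonglongrightarrow> d g - 2 * 0 + 0"
      by (intro tendsto_intros lim)
    moreover have "d (k n) = d g - 2 * L2_inner \<Omega> (\<lambda>x. k n x - g x) (\<lambda>x. f x - g x) + L2_inner \<Omega> (\<lambda>x. k n x - g x) (\<lambda>x. k n x - g x)" for n
      using L2_inner_square_diff[OF fg kg[of n]]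
      by (simp add: d_def L2_inner_commute[of \<Omega> "\<lambda>x. f x - g x" "\<lambda>x. k n x - g x"])
    ultimately show "(\<lambda>n. d (k n)) \<longlonglongrightarrow> d g" by simp
    show "(\<lambda>n. m + (1/8)^n) \<longlonglongrightarrow> m"
      using tendsto_add[OF tendsto_const LIMSEQ_power_zero[of "1/8::real"], of m] by simp
  qed (use less_imp_le[OF dk] in auto)
  have "L2_inner \<Omega> (\<lambda>x. f x - g x) l = 0" if l: "l \<in> K" for l
  proof (rule ccontr)
    have fg: "(\<lambda>x. f x - g x) \<in> L2 \<Omega>" by (intro L2_diff f g)
    let ?c = "L2_inner \<Omega> (\<lambda>x. f x - g x) l" and ?L = "L2_inner \<Omega> l l"
    assume c: "?c \<noteq> 0"
    have *: "2 * s * ?c \<le> s\<^sup>2 * ?L" for s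
    proof -
      have "d g \<le> d (\<lambda>x. g x + s *\<^sub>R l x)"
        using dg m[OF Kadd[OF gK l]] by (rule order_trans)
      also have "\<dots> = L2_inner \<Omega> (\<lambda>x. (f x - g x) - s *\<^sub>R l x) (\<lambda>x. (f x - g x) - s *\<^sub>R l x)"
        by (simp add: d_def algebra_simps)
      also have "\<dots> = d g - 2 * s * ?c + s\<^sup>2 * ?L"
        using L2_inner_square_diff[OF fg L2_scaleR[OF KL[OF l], of s]]
        by (simp add: d_def L2_inner_scaleR_left L2_inner_scaleR_right power2_eq_square)
      finally show ?thesis by simp
    qed
    have L: "?L \<ge> 0" by (rule L2_inner_self_nonneg)
    \<comment> \<open>The summand 1 avoids division by zero for null \<open>l\<close>. With s = q
      the inequality \<open>*\<close> reads 2 q^2 (?L + 1) <= q^2 ?L, which is impossible for q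
      \<noteq> 0.\<close>
    define q where "q = ?c / (?L + 1)"
    have cq: "?c = q * (?L + 1)" using L by (simp add: q_def)
    then have "q \<noteq> 0" using c by auto
    then have "q\<^sup>2 * (?L + 2) > 0" using L by (intro mult_pos_pos) auto
    moreover have "2 * q * (q * (?L + 1)) \<le> q\<^sup>2 * ?L" using *[of q] unfolding cq .
    ultimately show False by (simp add: power2_eq_square algebra_simps)
  qed
  with gK show ?thesis by blast
qed

section \<open>Compactly supported \<open>C\<^sup>1\<close> functions\<close>

text \<open>The values c = 1 and c = -1 cover translations and the reflections \<open>x - y\<close>
  of convolutions; the Jacobian is 1 in either case.\<close>

lemma integral_lborel_reflect_shift:
  fixes f :: "'a::euclidean_space \<Rightarrow> 'b::euclidean_space"
  assumes [measurable]: "f \<in> borel_measurable borel" and c: "\<bar>c\<bar> = 1"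
  shows "(\<integral>x. f (t + c *\<^sub>R x) \<partial>lborel) = (\<integral>x. f x \<partial>lborel)"
proof -
  have "(lborel :: 'a measure) = distr lborel borel (\<lambda>x. t + c *\<^sub>R x)"
    using c lborel_affine[of c t] by (auto simp: density_1)
  then have "(\<integral>x. f x \<partial>lborel) = (\<integral>x. f x \<partial>distr lborel borel (\<lambda>x. t + c *\<^sub>R x))"
    by simp
  also have "\<dots> = (\<integral>x. f (t + c *\<^sub>R x) \<partial>lborel)"
    by (rule integral_distr) auto
  finally show ?thesis ..
qed

lemma integrable_continuous_compact_support:
  fixes g :: "'a::euclidean_space \<Rightarrow> 'b::euclidean_space"
  assumes "continuous_on UNIV g" "compact S" "\<And>x. x \<notin> S \<Longrightarrow> g x = 0"
  shows "integrable lborel g"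
proof -
  have "integrable lborel (\<lambda>x. indicator S x *\<^sub>R g x)"
    using assms by (intro borel_integrable_compact) (auto intro: continuous_on_subset)
  moreover have "(\<lambda>x. indicator S x *\<^sub>R g x) = g"
    using assms(3) by (auto simp: indicator_def)
  ultimately show ?thesis by simp
qed

lemma bounded_range_compact_support:
  fixes g :: "'a::euclidean_space \<Rightarrow> 'b::real_normed_vector"
  assumes "continuous_on UNIV g" "compact S" "\<And>x. x \<notin> S \<Longrightarrow> g x = 0"
  obtains B where "B \<ge> 0" "\<And>x. norm (g x) \<le> B"
proof -
  have "bounded (g ` S)"
    using assms by (intro compact_imp_bounded compact_continuous_image) (auto intro: continuous_on_subset)
  then obtain B where "B > 0" "\<And>x. x \<in> S \<Longrightarrow> norm (g x) \<le> B"
    unfolding bounded_pos by auto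
  then show thesis using assms(3) by (intro that[of B]) (auto, metis norm_zero less_imp_le)
qed

text \<open>Bridge from the completed, restricted measure of the L2 spaces to \<open>lborel\<close>,
  where translation invariance is available. Vanishing off \<Omega> makes the restriction
  invisible.\<close>

lemma integral_lebesgue_on_eq_lborel:
  fixes g :: "'a::euclidean_space \<Rightarrow> 'b::euclidean_space"
  assumes "\<Omega> \<in> sets lebesgue" "g \<in> borel_measurable borel" "\<And>x. x \<notin> \<Omega> \<Longrightarrow> g x = 0"
  shows "integral\<^sup>L (lebesgue_on \<Omega>) g = integral\<^sup>L lborel g"
proof -
  have "integral\<^sup>L (lebesgue_on \<Omega>) g = (\<integral>x. indicator \<Omega> x *\<^sub>R g x \<partial>lebesgue)"
    using assms(1) by (intro integral_restrict_space) auto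
  also have "(\<lambda>x. indicator \<Omega> x *\<^sub>R g x) = g"
    using assms(3) by (auto simp: indicator_def)
  also have "integral\<^sup>L lebesgue g = integral\<^sup>L lborel g"
    using assms(2) by (intro integral_completion) auto
  finally show ?thesis .
qed

text \<open>Translation invariance makes the integral of each difference quotient zero, and
  dominated convergence passes to the derivative. Classical integration by parts below rests on
  this.\<close>

lemma integral_directional_derivative_eq_0:
  fixes f :: "'a::euclidean_space \<Rightarrow> real" and f' :: "'a \<Rightarrow> 'a \<Rightarrow>\<^sub>L real"
  assumes d: "\<And>x. (f has_derivative blinfun_apply (f' x)) (at x)"
    and c: "continuous_on UNIV f'" and S: "compact S" and 0: "\<And>x. x \<notin> S \<Longrightarrow> f x = 0" "\<And>x. x \<notin> S \<Longrightarrow> f' x = 0"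
  shows "(\<integral>x. blinfun_apply (f' x) e \<partial>lborel) = 0"
proof -
  obtain B where B: "B \<ge> 0" "\<And>x. norm (f' x) \<le> B"
    using bounded_range_compact_support[OF c S 0(2)] by blast
  have cf: "continuous_on UNIV f"
    using has_derivative_continuous[OF d] by (simp add: continuous_at_imp_continuous_on)
  have lip: "\<bar>f (x + h *\<^sub>R e) - f x\<bar> \<le> B * norm e * \<bar>h\<bar>" for x h
  proof -
    have "norm (f (x + h *\<^sub>R e) - f x) \<le> B * norm (x + h *\<^sub>R e - x)"
      by (rule differentiable_bound[of UNIV f "\<lambda>x. blinfun_apply (f' x)"])
        (use d B in \<open>auto simp: norm_blinfun.rep_eq[symmetric] intro: has_derivative_at_withinI\<close>)
    then show ?thesis by (simp add: mult_ac)
  qed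
  obtain R where R: "\<And>x. x \<in> S \<Longrightarrow> norm x \<le> R"
    using S compact_imp_bounded[of S] by (auto simp: bounded_iff)
  \<comment> \<open>Steps of length at most 1 keep all shifted supports in the ball of radius
    \<open>R + norm e\<close>, on which the constant Lipschitz bound is an integrable
    majorant.\<close>
  define h where "h n = inverse (real (Suc n))" for n
  have h: "h n > 0" "h n \<le> 1" for n by (auto simp: h_def inverse_le_1_iff)
  have h0: "h \<longlonglongrightarrow> 0" unfolding h_def by (rule LIMSEQ_inverse_real_of_nat)
  define q where "q n x = (f (x + h n *\<^sub>R e) - f x) / h n" for n x
  have fi: "integrable lborel f"
    by (rule integrable_continuous_compact_support[OF cf S 0(1)])
  have "(\<lambda>n. \<integral>x. q n x \<partial>lborel) \<longlonglongrightarrow> (\<integral>x. blinfun_apply (f' x) e \<partial>lborel)"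
  proof (rule integral_dominated_convergence)
    have "continuous_on UNIV (\<lambda>x. blinfun_apply (f' x) e)"
      by (intro continuous_intros c)
    then show "(\<lambda>x. blinfun_apply (f' x) e) \<in> borel_measurable lborel"
      by (simp add: borel_measurable_continuous_onI)
    show "q n \<in> borel_measurable lborel" for n
    proof -
      have "continuous_on UNIV (q n)" unfolding q_def
        using h(1)[of n] by (intro continuous_intros continuous_on_compose2[OF cf]) auto
      then show ?thesis by (simp add: borel_measurable_continuous_onI)
    qed
    show "integrable lborel (\<lambda>x. indicator (cball 0 (R + norm e)) x *\<^sub>R (B * norm e))"
      by (rule borel_integrable_compact) auto
    show "AE x in lborel. (\<lambda>n. q n x) \<longlonglongrightarrow> blinfun_apply (f' x) e"
    proof (rule AE_I2)
      fix x
      have "((\<lambda>s. x + s *\<^sub>R e) has_derivative (\<lambda>s. s *\<^sub>R e)) (at (0::real))"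
        by (auto intro!: derivative_eq_intros)
      then have "((\<lambda>s. f (x + s *\<^sub>R e)) has_derivative (\<lambda>s. blinfun_apply (f' x) (s *\<^sub>R e))) (at 0)"
        using has_derivative_compose[of "\<lambda>s. x + s *\<^sub>R e" "\<lambda>s. s *\<^sub>R e" 0 UNIV f "blinfun_apply (f' x)"] d[of x] by simp
      then have "((\<lambda>s. f (x + s *\<^sub>R e)) has_field_derivative (blinfun_apply (f' x) e)) (at 0)"
        by (simp add: has_field_derivative_def blinfun.scaleR_right mult_commute_abs)
      then have "((\<lambda>s. (f (x + s *\<^sub>R e) - f x) / s) \<longlongrightarrow> blinfun_apply (f' x) e) (at 0)"
        by (simp add: DERIV_def)
      moreover have "filterlim h (at 0) sequentially"
        using h0 h(1) by (auto simp: filterlim_at intro!: always_eventually) (metis less_irrefl)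
      ultimately show "(\<lambda>n. q n x) \<longlonglongrightarrow> blinfun_apply (f' x) e"
        unfolding q_def by (rule filterlim_compose)
    qed
    show "AE x in lborel. norm (q n x) \<le> indicator (cball 0 (R + norm e)) x *\<^sub>R (B * norm e)" for n
    proof (rule AE_I2)
      fix x
      show "norm (q n x) \<le> indicator (cball 0 (R + norm e)) x *\<^sub>R (B * norm e)"
      proof (cases "x \<in> cball 0 (R + norm e)")
        case True
        then show ?thesis using lip[of x "h n"] h(1)[of n] by (simp add: q_def field_simps)
      next
        case False
        have "norm x \<le> norm (x + h n *\<^sub>R e) + norm e"
        proof -
          have "norm x \<le> norm (x + h n *\<^sub>R e) + norm (h n *\<^sub>R e)"
            using norm_triangle_ineq4[of "x + h n *\<^sub>R e" "h n *\<^sub>R e"] by simp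
          moreover have "norm (h n *\<^sub>R e) \<le> norm e"
            using h[of n] by (simp add: mult_left_le_one_le)
          ultimately show ?thesis by linarith
        qed
        with False have "x \<notin> S" "x + h n *\<^sub>R e \<notin> S"
          using R[of x] R[of "x + h n *\<^sub>R e"] norm_ge_zero[of e] by auto
        then show ?thesis using False by (simp add: q_def 0)
      qed
    qed
  qed
  moreover have "(\<integral>x. q n x \<partial>lborel) = 0" for n
  proof -
    have s: "integrable lborel (\<lambda>x. f (x + h n *\<^sub>R e))"
    proof (rule integrable_continuous_compact_support)
      show "continuous_on UNIV (\<lambda>x. f (x + h n *\<^sub>R e))"
        by (intro continuous_intros continuous_on_compose2[OF cf]) auto
      show "compact ((\<lambda>x. x - h n *\<^sub>R e) ` S)"
        by (intro compact_continuous_image S continuous_intros)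
      show "f (x + h n *\<^sub>R e) = 0" if "x \<notin> (\<lambda>x. x - h n *\<^sub>R e) ` S" for x
        using that 0(1) by (metis add_diff_cancel_right' imageI)
    qed
    have "(\<integral>x. f (x + h n *\<^sub>R e) \<partial>lborel) = (\<integral>x. f x \<partial>lborel)"
      using integral_lborel_reflect_shift[of f 1 "h n *\<^sub>R e"] cf
      by (simp add: borel_measurable_continuous_onI add.commute)
    then show ?thesis unfolding q_def using s fi by simp
  qed
  ultimately show ?thesis by (simp add: LIMSEQ_const_iff)
qed

lemma C01I:
  fixes f :: "real ^ 2 \<Rightarrow> 'b::euclidean_space"
  assumes "compact S" "S \<subseteq> \<Omega>" "\<And>x. x \<notin> S \<Longrightarrow> f x = 0"
    and "\<And>x. x \<in> \<Omega> \<Longrightarrow> (f has_derivative blinfun_apply (f' x)) (at x)" "continuous_on \<Omega> f'"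
  shows "f \<in> C01 \<Omega>"
proof -
  have "closure {x. f x \<noteq> 0} \<subseteq> S"
    by (rule closure_minimal) (use assms in \<open>auto intro: compact_imp_closed\<close>)
  moreover have "compact (closure {x. f x \<noteq> 0})"
    unfolding compact_closure
    by (rule bounded_subset[OF compact_imp_bounded[OF assms(1)]]) (use assms(3) in auto)
  ultimately show ?thesis
    using assms(2,4,5) unfolding C01_def by blast
qed

text \<open>\<open>C01\<close> speaks of derivatives on \<Omega> only. Since the support is a
  compact subset of the open set, the derivative extended by zero is continuous on the whole plane,
  and the function can be treated as globally C1.\<close>

lemma C01E:
  fixes f :: "real ^ 2 \<Rightarrow> 'b::euclidean_space"
  assumes f: "f \<in> C01 \<Omega>" and \<Omega>: "open \<Omega>"
  obtains f' S where "\<And>x. (f has_derivative blinfun_apply (f' x)) (at x)" "continuous_on UNIV f'"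
    "compact S" "S \<subseteq> \<Omega>" "\<And>x. x \<notin> S \<Longrightarrow> f x = 0" "\<And>x. x \<notin> S \<Longrightarrow> f' x = 0"
proof -
  define S where "S = closure {x. f x \<noteq> 0}"
  obtain f0 where S: "compact S" "S \<subseteq> \<Omega>"
    and d: "\<And>x. x \<in> \<Omega> \<Longrightarrow> (f has_derivative blinfun_apply (f0 x)) (at x)" and c: "continuous_on \<Omega> f0"
    using f unfolding C01_def S_def by blast
  have f0: "f x = 0" if "x \<notin> S" for x using that closure_subset[of "{x. f x \<noteq> 0}"] unfolding S_def by auto
  have off: "(f has_derivative blinfun_apply 0) (at x)" if "x \<notin> S" for x
  proof -
    have "((\<lambda>x. 0) has_derivative (\<lambda>x. 0)) (at x)" by simp
    then have "(f has_derivative (\<lambda>x. 0)) (at x)"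
    proof (rule has_derivative_transform_within_open[where s = "- S"])
      show "x \<in> - S" using that by blast
      show "0 = f y" if "y \<in> - S" for y using f0[of y] that by simp
      show "open (- S)" unfolding S_def by (rule open_Compl[OF closed_closure])
    qed
    then show ?thesis by (simp add: zero_blinfun.rep_eq)
  qed
  \<comment> \<open>On \<Omega> outside S the derivative is both \<open>f0\<close> and 0, which
    agree by uniqueness. So \<open>f'\<close> is \<open>f0\<close> on \<Omega> and 0 off S, and
    these two open sets cover the plane.\<close>
  define f' where "f' x = (if x \<in> S then f0 x else 0)" for x
  have eq: "f' x = f0 x" if "x \<in> \<Omega>" for x
    unfolding f'_def using has_derivative_unique[OF d[OF that] off[of x]]
    by (auto simp: blinfun_apply_inject)
  have "continuous_on (\<Omega> \<union> - S) f'"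
  proof (rule continuous_on_open_Un)
    show "continuous_on \<Omega> f'" using c by (rule continuous_on_eq) (simp add: eq)
    show "continuous_on (- S) f'"
      by (rule continuous_on_eq[OF continuous_on_const[of _ 0]]) (simp add: f'_def)
  qed (use \<Omega> in \<open>auto simp: S_def\<close>)
  moreover have "\<Omega> \<union> - S = UNIV" using S by auto
  ultimately have "continuous_on UNIV f'" by simp
  moreover have "(f has_derivative blinfun_apply (f' x)) (at x)" for x
    using d[of x] off[of x] S(2) by (auto simp: f'_def)
  ultimately show thesis
    using that[of f' S, OF _ _ S f0] by (simp add: f'_def)
qed

lemma C01_continuous:
  fixes f :: "real ^ 2 \<Rightarrow> 'b::euclidean_space"
  assumes "f \<in> C01 \<Omega>" "open \<Omega>"
  shows "continuous_on UNIV f"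
proof -
  obtain f' S where d: "\<And>x. (f has_derivative blinfun_apply (f' x)) (at x)" and "continuous_on UNIV f'"
    "compact S" "S \<subseteq> \<Omega>" "\<And>x. x \<notin> S \<Longrightarrow> f x = 0" "\<And>x. x \<notin> S \<Longrightarrow> f' x = 0"
    by (rule C01E[OF assms]) (rule that)
  have "isCont f x" for x
    by (rule has_derivative_continuous[OF d])
  then show ?thesis by (simp add: continuous_at_imp_continuous_on)
qed

lemma grad_eq:
  assumes "(f has_derivative (\<lambda>h. g \<bullet> h)) (at x)"
  shows "grad f x = g"
  unfolding grad_def frechet_derivative_at[OF assms, symmetric]
  by (simp add: vec_eq_iff flip: cart_eq_inner_axis)

lemma dvg_eq:
  assumes "(q has_derivative q') (at x)"
  shows "dvg q x = (\<Sum>i\<in>UNIV. q' (axis i 1) $ i)"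
  unfolding dvg_def frechet_derivative_at[OF assms, symmetric] ..

lemma C01_real_gradE:
  fixes f :: "real ^ 2 \<Rightarrow> real"
  assumes f: "f \<in> C01 \<Omega>" and \<Omega>: "open \<Omega>"
  obtains S where "\<And>x. (f has_derivative (\<lambda>h. grad f x \<bullet> h)) (at x)" "continuous_on UNIV (grad f)"
    "compact S" "S \<subseteq> \<Omega>" "\<And>x. x \<notin> S \<Longrightarrow> f x = 0" "\<And>x. x \<notin> S \<Longrightarrow> grad f x = 0" "integral\<^sup>L lborel (grad f) = 0"
proof -
  obtain f' S where d: "\<And>x. (f has_derivative blinfun_apply (f' x)) (at x)" and c: "continuous_on UNIV f'"
    and S: "compact S" "S \<subseteq> \<Omega>" and 0: "\<And>x. x \<notin> S \<Longrightarrow> f x = 0" "\<And>x. x \<notin> S \<Longrightarrow> f' x = 0"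
    by (rule C01E[OF assms]) (rule that)
  have g: "grad f x = (\<chi> i. blinfun_apply (f' x) (axis i 1))" for x
    unfolding grad_def frechet_derivative_at[OF d[of x], symmetric] ..
  have gh: "grad f x \<bullet> h = blinfun_apply (f' x) h" for x h
  proof -
    have "h = (\<Sum>i\<in>UNIV. (h $ i) *\<^sub>R axis i 1)"
      using basis_expansion[of h] by (simp add: scalar_mult_eq_scaleR)
    then have "blinfun_apply (f' x) h = blinfun_apply (f' x) (\<Sum>i\<in>UNIV. (h $ i) *\<^sub>R axis i 1)"
      by (rule arg_cong)
    also have "\<dots> = (\<Sum>i\<in>UNIV. (h $ i) *\<^sub>R blinfun_apply (f' x) (axis i 1))"
      by (simp add: blinfun.sum_right blinfun.scaleR_right)
    finally have "blinfun_apply (f' x) h = (\<Sum>i\<in>UNIV. (h $ i) *\<^sub>R blinfun_apply (f' x) (axis i 1))" .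
    then show ?thesis by (simp add: g inner_vec_def mult.commute)
  qed
  have cg: "continuous_on UNIV (grad f)"
    unfolding g[abs_def] by (intro continuous_intros c)
  have g0: "grad f x = 0" if "x \<notin> S" for x
    using 0(2)[OF that] by (simp add: g vec_eq_iff)
  have gi: "integrable lborel (grad f)"
    by (rule integrable_continuous_compact_support[OF cg S(1) g0])
  have "integral\<^sup>L lborel (grad f) = 0"
  proof -
    \<comment> \<open>Taking the integral itself as the direction of differentiation gives I
      \<bullet> I = 0.\<close>
    define I where "I = integral\<^sup>L lborel (grad f)"
    have "(\<integral>x. grad f x \<bullet> I \<partial>lborel) = integral\<^sup>L lborel (grad f) \<bullet> I"
      by (rule integral_inner_left) (rule gi)
    moreover have "(\<integral>x. grad f x \<bullet> I \<partial>lborel) = 0"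
      unfolding gh by (rule integral_directional_derivative_eq_0[OF d c S(1) 0])
    ultimately have "I \<bullet> I = 0" by (simp only: I_def)
    then show ?thesis by (simp add: I_def)
  qed
  moreover have "(f has_derivative (\<lambda>h. grad f x \<bullet> h)) (at x)" for x
    unfolding gh by (rule d)
  ultimately show thesis using that[OF _ cg S 0(1) g0] by blast
qed

text \<open>\<phi> is only C1 inside \<Omega>, with no condition at the boundary; the compact
  support of \<psi> alone makes the product a test function. This allows integration by parts
  against functions that do not vanish on the boundary.\<close>

lemma C01_product:
  fixes \<phi> \<psi> :: "real ^ 2 \<Rightarrow> real"
  assumes \<psi>: "\<psi> \<in> C01 \<Omega>" and \<Omega>: "open \<Omega>"
    and d: "\<And>x. x \<in> \<Omega> \<Longrightarrow> (\<phi> has_derivative (\<lambda>h. g x \<bullet> h)) (at x)" and c: "continuous_on \<Omega> g"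
  shows "(\<lambda>x. \<phi> x * \<psi> x) \<in> C01 \<Omega>"
    and "\<And>x. x \<in> \<Omega> \<Longrightarrow> grad (\<lambda>x. \<phi> x * \<psi> x) x = \<phi> x *\<^sub>R grad \<psi> x + \<psi> x *\<^sub>R g x"
proof -
  obtain S where d\<psi>: "\<And>x. (\<psi> has_derivative (\<lambda>h. grad \<psi> x \<bullet> h)) (at x)" and c\<psi>: "continuous_on UNIV (grad \<psi>)"
    and S: "compact S" "S \<subseteq> \<Omega>" "\<And>x. x \<notin> S \<Longrightarrow> \<psi> x = 0"
    and "\<And>x. x \<notin> S \<Longrightarrow> grad \<psi> x = 0" "integral\<^sup>L lborel (grad \<psi>) = 0"
    by (rule C01_real_gradE[OF \<psi> \<Omega>]) (rule that)
  have c\<phi>: "continuous_on \<Omega> \<phi>"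
    using has_derivative_continuous[OF d] by (simp add: continuous_at_imp_continuous_on)
  have dp: "((\<lambda>x. \<phi> x * \<psi> x) has_derivative (\<lambda>h. (\<phi> x *\<^sub>R grad \<psi> x + \<psi> x *\<^sub>R g x) \<bullet> h)) (at x)" if "x \<in> \<Omega>" for x
    using has_derivative_mult[OF d[OF that] d\<psi>[of x]]
    by (simp add: inner_add_left algebra_simps)
  then show "grad (\<lambda>x. \<phi> x * \<psi> x) x = \<phi> x *\<^sub>R grad \<psi> x + \<psi> x *\<^sub>R g x" if "x \<in> \<Omega>" for x
    using that by (intro grad_eq) auto
  have dp': "((\<lambda>x. \<phi> x * \<psi> x) has_derivative blinfun_apply (blinfun_inner_left (\<phi> x *\<^sub>R grad \<psi> x + \<psi> x *\<^sub>R g x))) (at x)"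
    if "x \<in> \<Omega>" for x
  proof (rule has_derivative_eq_rhs[OF dp[OF that]])
    show "(\<lambda>h. (\<phi> x *\<^sub>R grad \<psi> x + \<psi> x *\<^sub>R g x) \<bullet> h) = blinfun_apply (blinfun_inner_left (\<phi> x *\<^sub>R grad \<psi> x + \<psi> x *\<^sub>R g x))"
      by (rule ext) (subst blinfun_inner_left.rep_eq, rule inner_commute)
  qed
  have "continuous_on \<Omega> (\<lambda>x. \<phi> x *\<^sub>R grad \<psi> x + \<psi> x *\<^sub>R g x)"
  proof -
    have 1: "continuous_on \<Omega> \<psi>"
      by (rule continuous_on_subset[OF C01_continuous[OF \<psi> \<Omega>] subset_UNIV])
    have 2: "continuous_on \<Omega> (grad \<psi>)"
      by (rule continuous_on_subset[OF c\<psi> subset_UNIV])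
    show ?thesis
      by (rule continuous_on_add[OF continuous_on_scaleR[OF c\<phi> 2] continuous_on_scaleR[OF 1 c]])
  qed
  then have "continuous_on \<Omega> (\<lambda>x. blinfun_inner_left (\<phi> x *\<^sub>R grad \<psi> x + \<psi> x *\<^sub>R g x))"
    by (rule bounded_linear.continuous_on[OF bounded_linear_blinfun_inner_left])
  moreover have "\<phi> x * \<psi> x = 0" if "x \<notin> S" for x
    using S(3)[OF that] by simp
  ultimately show "(\<lambda>x. \<phi> x * \<psi> x) \<in> C01 \<Omega>"
    using dp' by (intro C01I[OF S(1,2)])
qed

section \<open>Approximation by mollification\<close>

lemma finite_measure_lebesgue_on_bounded:
  fixes \<Omega> :: "(real ^ 2) set"
  assumes "open \<Omega>" "bounded \<Omega>"
  shows "finite_measure (lebesgue_on \<Omega>)"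
  by (intro finite_measure_lebesgue_on lmeasurable_open assms)

lemma borel_measurable_imp_lebesgue_on:
  "f \<in> borel_measurable borel \<Longrightarrow> f \<in> borel_measurable (lebesgue_on \<Omega>)"
  by (intro measurable_restrict_space1 measurable_completion) simp

lemma L2_integrable:
  fixes f :: "real ^ 2 \<Rightarrow> 'b::euclidean_space"
  assumes "open \<Omega>" "bounded \<Omega>" "f \<in> L2 \<Omega>"
  shows "integrable (lebesgue_on \<Omega>) f"
proof -
  interpret finite_measure "lebesgue_on \<Omega>"
    by (rule finite_measure_lebesgue_on_bounded[OF assms(1,2)])
  show ?thesis
  proof (rule Bochner_Integration.integrable_bound)
    show "integrable (lebesgue_on \<Omega>) (\<lambda>x. 1 + (norm (f x))\<^sup>2)"
      using L2_square_integrable[OF assms(3)] by simp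
    show "f \<in> borel_measurable (lebesgue_on \<Omega>)" by (rule L2_measurable[OF assms(3)])
    have "t \<le> 1 + t\<^sup>2" for t :: real
      using zero_le_power2[of "t - 1/2"] by (simp add: power2_eq_square algebra_simps)
    then show "AE x in lebesgue_on \<Omega>. norm (f x) \<le> norm (1 + (norm (f x))\<^sup>2)"
      by (auto simp: add_nonneg_nonneg)
  qed
qed

lemma L2_bounded:
  fixes f :: "real ^ 2 \<Rightarrow> 'b::euclidean_space"
  assumes "open \<Omega>" "bounded \<Omega>" "f \<in> borel_measurable (lebesgue_on \<Omega>)" and B: "\<And>x. x \<in> \<Omega> \<Longrightarrow> norm (f x) \<le> B"
  shows "f \<in> L2 \<Omega>"
proof -
  interpret finite_measure "lebesgue_on \<Omega>"
    by (rule finite_measure_lebesgue_on_bounded[OF assms(1,2)])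
  have "integrable (lebesgue_on \<Omega>) (\<lambda>x. (norm (f x))\<^sup>2)"
  proof (rule integrable_const_bound)
    show "AE x in lebesgue_on \<Omega>. norm ((norm (f x))\<^sup>2) \<le> B\<^sup>2"
      using power_mono[OF B norm_ge_zero] by (intro AE_I2) (simp add: space_restrict_space)
    show "(\<lambda>x. (norm (f x))\<^sup>2) \<in> borel_measurable (lebesgue_on \<Omega>)"
      using assms(3) by measurable
  qed
  with assms(3) show ?thesis by (simp add: L2_def)
qed

section \<open>Density of bounded continuous functions in L2\<close>

definition clamp_real :: "real \<Rightarrow> real \<Rightarrow> real" where
  "clamp_real m t = max (- m) (min m t)"

lemma clamp_real_bound: "m \<ge> 0 \<Longrightarrow> \<bar>clamp_real m t\<bar> \<le> m"
  by (auto simp: clamp_real_def)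

lemma clamp_real_diff: "m \<ge> 0 \<Longrightarrow> \<bar>t - clamp_real m t\<bar> \<le> \<bar>t\<bar>"
  by (auto simp: clamp_real_def)

lemma clamp_real_eq: "\<bar>t\<bar> \<le> m \<Longrightarrow> clamp_real m t = t"
  by (auto simp: clamp_real_def)

lemma continuous_clamp_real: "continuous_on UNIV (clamp_real m)"
  unfolding clamp_real_def[abs_def] by (intro continuous_intros)

lemma L2_clamp_tendsto:
  fixes g :: "real ^ 2 \<Rightarrow> real"
  assumes g: "g \<in> L2 \<Omega>"
  shows "(\<lambda>m. \<integral>x. (g x - clamp_real (real m) (g x))\<^sup>2 \<partial>lebesgue_on \<Omega>) \<longlonglongrightarrow> 0"
proof -
  have [measurable]: "g \<in> borel_measurable (lebesgue_on \<Omega>)" by (rule L2_measurable[OF g])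
  have [measurable]: "clamp_real m \<in> borel_measurable borel" for m
    by (intro borel_measurable_continuous_onI continuous_clamp_real)
  have "(\<lambda>m. \<integral>x. (g x - clamp_real (real m) (g x))\<^sup>2 \<partial>lebesgue_on \<Omega>) \<longlonglongrightarrow> (\<integral>x. 0 \<partial>lebesgue_on \<Omega>)"
  proof (rule integral_dominated_convergence)
    show "integrable (lebesgue_on \<Omega>) (\<lambda>x. (g x)\<^sup>2)"
      using L2_square_integrable[OF g] by simp
    show "AE x in lebesgue_on \<Omega>. (\<lambda>m. (g x - clamp_real (real m) (g x))\<^sup>2) \<longlonglongrightarrow> 0"
    proof (rule AE_I2)
      fix x
      have "\<forall>\<^sub>F m in sequentially. (g x - clamp_real (real m) (g x))\<^sup>2 = 0"
        using eventually_ge_at_top[of "nat \<lceil>\<bar>g x\<bar>\<rceil>"]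
      proof eventually_elim
        case (elim m)
        then have "\<bar>g x\<bar> \<le> real m" by linarith
        then show ?case by (simp add: clamp_real_eq)
      qed
      then show "(\<lambda>m. (g x - clamp_real (real m) (g x))\<^sup>2) \<longlonglongrightarrow> 0"
        by (rule tendsto_eventually)
    qed
    show "AE x in lebesgue_on \<Omega>. norm ((g x - clamp_real (real m) (g x))\<^sup>2) \<le> (g x)\<^sup>2" for m
      using clamp_real_diff[of "real m"] by (simp add: abs_le_square_iff[symmetric])
  qed auto
  then show ?thesis by simp
qed

text \<open>Clamping at a high level costs little in L2. A clamped function is approximated almost
  everywhere by clamped continuous functions, through \<open>measurable_on\<close>, and twice the
  clamp level is a majorant on a space of finite measure. Each error is below \<epsilon> / 4 because
  the square of a sum costs a factor 2.\<close>

lemma L2_approx_continuous: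
  fixes g :: "real ^ 2 \<Rightarrow> real"
  assumes \<Omega>: "open \<Omega>" "bounded \<Omega>" and g: "g \<in> L2 \<Omega>" and e: "\<epsilon> > 0"
  obtains h B where "continuous_on UNIV h" "\<And>x. \<bar>h x\<bar> \<le> B" "(\<integral>x. (g x - h x)\<^sup>2 \<partial>lebesgue_on \<Omega>) < \<epsilon>"
proof -
  let ?M = "lebesgue_on \<Omega>"
  interpret finite_measure ?M by (rule finite_measure_lebesgue_on_bounded[OF \<Omega>])
  have gm[measurable]: "g \<in> borel_measurable ?M" by (rule L2_measurable[OF g])
  have cm[measurable]: "clamp_real m \<in> borel_measurable borel" for m
    by (intro borel_measurable_continuous_onI continuous_clamp_real)
  have "\<forall>\<^sub>F m in sequentially. (\<integral>x. (g x - clamp_real (real m) (g x))\<^sup>2 \<partial>?M) < \<epsilon> / 4"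
    using order_tendstoD(2)[OF L2_clamp_tendsto[OF g], of "\<epsilon> / 4"] e by simp
  then obtain m :: nat where m: "(\<integral>x. (g x - clamp_real (real m) (g x))\<^sup>2 \<partial>?M) < \<epsilon> / 4"
    using eventually_happens'[OF sequentially_bot] by blast
  let ?c = "clamp_real (real m)"
  have "g measurable_on \<Omega>"
    using \<Omega>(1) gm by (subst measurable_on_iff_borel_measurable) auto
  then obtain N G where N: "negligible N" and G: "\<And>k. continuous_on UNIV (G k)"
    and lim: "\<And>x. x \<notin> N \<Longrightarrow> (\<lambda>k. G k x) \<longlonglongrightarrow> (if x \<in> \<Omega> then g x else 0)"
    unfolding measurable_on_def by blast
  have cG: "continuous_on UNIV (\<lambda>x. ?c (G k x))" for k
    by (intro continuous_on_compose2[OF continuous_clamp_real G]) auto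
  have Gm[measurable]: "(\<lambda>x. ?c (G k x)) \<in> borel_measurable ?M" for k
    by (intro borel_measurable_imp_lebesgue_on borel_measurable_continuous_onI cG)
  have "AE x in lebesgue. x \<notin> N"
    using N by (simp add: AE_iff_null_sets negligible_iff_null_sets AE_not_in)
  then have AEN: "AE x in ?M. x \<notin> N"
    using \<Omega>(1) by (subst AE_restrict_space_iff) auto
  have "(\<lambda>k. \<integral>x. (?c (g x) - ?c (G k x))\<^sup>2 \<partial>?M) \<longlonglongrightarrow> (\<integral>x. 0 \<partial>?M)"
  proof (rule integral_dominated_convergence)
    show "integrable ?M (\<lambda>x. (2 * real m)\<^sup>2)" by simp
    show "AE x in ?M. (\<lambda>k. (?c (g x) - ?c (G k x))\<^sup>2) \<longlonglongrightarrow> 0"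
      using AEN AE_space
    proof eventually_elim
      fix x assume "x \<notin> N" "x \<in> space ?M"
      then have "(\<lambda>k. G k x) \<longlonglongrightarrow> g x" using lim[of x] by (simp add: space_restrict_space)
      moreover have "isCont ?c (g x)"
        using continuous_clamp_real[of "real m"] by (simp add: continuous_on_eq_continuous_at)
      ultimately have "(\<lambda>k. ?c (G k x)) \<longlonglongrightarrow> ?c (g x)" by (rule isCont_tendsto_compose[rotated])
      then have "(\<lambda>k. (?c (g x) - ?c (G k x))\<^sup>2) \<longlonglongrightarrow> (?c (g x) - ?c (g x))\<^sup>2"
        by (intro tendsto_intros)
      then show "(\<lambda>k. (?c (g x) - ?c (G k x))\<^sup>2) \<longlonglongrightarrow> 0" by simp
    qed
    show "AE x in ?M. norm ((?c (g x) - ?c (G k x))\<^sup>2) \<le> (2 * real m)\<^sup>2" for k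
    proof (rule AE_I2)
      fix x
      have "\<bar>?c (g x) - ?c (G k x)\<bar> \<le> 2 * real m"
        using clamp_real_bound[of "real m" "g x"] clamp_real_bound[of "real m" "G k x"] by linarith
      from power_mono[OF this abs_ge_zero, of 2]
      show "norm ((?c (g x) - ?c (G k x))\<^sup>2) \<le> (2 * real m)\<^sup>2" by simp
    qed
  qed measurable
  then have "\<forall>\<^sub>F k in sequentially. (\<integral>x. (?c (g x) - ?c (G k x))\<^sup>2 \<partial>?M) < \<epsilon> / 4"
    using e by (intro order_tendstoD(2)[where y = 0]) simp_all
  then obtain k where k: "(\<integral>x. (?c (g x) - ?c (G k x))\<^sup>2 \<partial>?M) < \<epsilon> / 4"
    using eventually_happens'[OF sequentially_bot] by blast
  have cL2: "(\<lambda>x. ?c (g x)) \<in> L2 \<Omega>" "(\<lambda>x. ?c (G k x)) \<in> L2 \<Omega>"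
    by (auto intro!: L2_bounded[OF \<Omega>, of _ "real m"] clamp_real_bound)
  have i1: "integrable ?M (\<lambda>x. (g x - ?c (g x))\<^sup>2)" "integrable ?M (\<lambda>x. (?c (g x) - ?c (G k x))\<^sup>2)"
    "integrable ?M (\<lambda>x. (g x - ?c (G k x))\<^sup>2)"
    using L2_square_integrable[OF L2_diff[OF g cL2(1)]] L2_square_integrable[OF L2_diff[OF cL2]]
      L2_square_integrable[OF L2_diff[OF g cL2(2)]] by simp_all
  have "(\<integral>x. (g x - ?c (G k x))\<^sup>2 \<partial>?M) \<le> (\<integral>x. 2 * (g x - ?c (g x))\<^sup>2 + 2 * (?c (g x) - ?c (G k x))\<^sup>2 \<partial>?M)"
  proof (rule integral_mono)
    fix x
    show "(g x - ?c (G k x))\<^sup>2 \<le> 2 * (g x - ?c (g x))\<^sup>2 + 2 * (?c (g x) - ?c (G k x))\<^sup>2"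
      using norm_add_square_le[of "g x - ?c (g x)" "?c (g x) - ?c (G k x)"] by simp
  qed (use i1 in auto)
  also have "\<dots> = 2 * (\<integral>x. (g x - ?c (g x))\<^sup>2 \<partial>?M) + 2 * (\<integral>x. (?c (g x) - ?c (G k x))\<^sup>2 \<partial>?M)"
    using i1 by simp
  also have "\<dots> < \<epsilon>" using m k by linarith
  finally show thesis
    using that[of "\<lambda>x. ?c (G k x)" "real m"] cG clamp_real_bound[of "real m"] by simp
qed

text \<open>Neither symmetry nor smoothness is required: centred and shifted mollifiers are to share
  the same estimates, which use only mass 1, positivity, continuity and the radius R.\<close>

definition kernel :: "real \<Rightarrow> (real ^ 2 \<Rightarrow> real) \<Rightarrow> bool" where
  "kernel R k \<longleftrightarrow> continuous_on UNIV k \<and> (\<forall>z. 0 \<le> k z) \<and> (\<forall>z. R < norm z \<longrightarrow> k z = 0) \<and>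
     integral\<^sup>L lborel k = 1"

lemma kernel_shift_integral:
  assumes k: "kernel R k" and c: "\<bar>c\<bar> = 1"
  shows "integrable lborel (\<lambda>y. k (t + c *\<^sub>R y))" "(\<integral>y. k (t + c *\<^sub>R y) \<partial>lborel) = 1"
proof -
  have ck: "continuous_on UNIV k" using k by (simp add: kernel_def)
  show "integrable lborel (\<lambda>y. k (t + c *\<^sub>R y))"
  proof (rule integrable_continuous_compact_support)
    show "continuous_on UNIV (\<lambda>y. k (t + c *\<^sub>R y))"
      by (rule continuous_on_compose2[OF ck]) (auto intro!: continuous_intros)
    show "compact (cball (0::real^2) (R + norm t))" by simp
    fix y :: "real ^ 2"
    assume "y \<notin> cball 0 (R + norm t)"
    then have "R + norm t < norm (c *\<^sub>R y)" using c by simp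
    also have "\<dots> \<le> norm (t + c *\<^sub>R y) + norm t"
      using norm_triangle_ineq4[of "t + c *\<^sub>R y" t] by simp
    finally show "k (t + c *\<^sub>R y) = 0" using k by (simp add: kernel_def)
  qed
  show "(\<integral>y. k (t + c *\<^sub>R y) \<partial>lborel) = 1"
    using integral_lborel_reflect_shift[of k c t] k c ck
    by (simp add: kernel_def borel_measurable_continuous_onI)
qed

lemma kernel_borel: "kernel R k \<Longrightarrow> k \<in> borel_measurable borel"
  by (simp add: kernel_def borel_measurable_continuous_onI)

text \<open>Only an inequality, because mass may fall outside \<Omega> when the translated kernel
  meets the boundary. The sign c serves the two marginals of \<open>k (x - y)\<close>: -1 for
  integration over y, 1 for integration over x.\<close>

lemma kernel_nn_integral_le:
  assumes k: "kernel R k" and c: "\<bar>c\<bar> = 1" and \<Omega>: "\<Omega> \<in> sets lebesgue"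
  shows "(\<integral>\<^sup>+y. ennreal (k (t + c *\<^sub>R y)) \<partial>lebesgue_on \<Omega>) \<le> 1"
proof -
  have k0: "0 \<le> k z" for z using k by (simp add: kernel_def)
  have "(\<integral>\<^sup>+y. ennreal (k (t + c *\<^sub>R y)) \<partial>lebesgue_on \<Omega>) = (\<integral>\<^sup>+y. ennreal (k (t + c *\<^sub>R y)) * indicator \<Omega> y \<partial>lebesgue)"
    using \<Omega> by (intro nn_integral_restrict_space) simp
  also have "\<dots> \<le> (\<integral>\<^sup>+y. ennreal (k (t + c *\<^sub>R y)) \<partial>lebesgue)"
    by (intro nn_integral_mono) (simp add: indicator_def)
  also have "\<dots> = (\<integral>\<^sup>+y. ennreal (k (t + c *\<^sub>R y)) \<partial>lborel)"
    by (rule nn_integral_completion)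
  also have "\<dots> = ennreal (\<integral>y. k (t + c *\<^sub>R y) \<partial>lborel)"
    by (intro nn_integral_eq_integral kernel_shift_integral[OF k c]) (simp add: k0)
  also have "\<dots> = 1" using kernel_shift_integral(2)[OF k c] by simp
  finally show ?thesis .
qed

lemma kernel_bounded:
  assumes "kernel R k"
  obtains B where "B \<ge> 0" "\<And>z. \<bar>k z\<bar> \<le> B"
proof -
  have "continuous_on UNIV k" and "k x = 0" if "x \<notin> cball 0 R" for x
    using assms that by (simp_all add: kernel_def)
  then obtain B where "B \<ge> 0" "\<And>x. norm (k x) \<le> B"
    using bounded_range_compact_support[OF _ compact_cball, of k 0 R] assms
    unfolding kernel_def by blast
  then show thesis using that by simp
qed

lemma integrable_bounded_mult:
  fixes g :: "'x \<Rightarrow> 'b::euclidean_space" and a :: "'x \<Rightarrow> real"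
  assumes "integrable M g" "a \<in> borel_measurable M" "\<And>x. x \<in> space M \<Longrightarrow> \<bar>a x\<bar> \<le> B"
  shows "integrable M (\<lambda>x. a x *\<^sub>R g x)"
proof (rule Bochner_Integration.integrable_bound)
  show "integrable M (\<lambda>x. B *\<^sub>R g x)" using assms(1) by simp
  show "(\<lambda>x. a x *\<^sub>R g x) \<in> borel_measurable M"
    by (intro borel_measurable_scaleR assms(2) borel_measurable_integrable[OF assms(1)])
  show "AE x in M. norm (a x *\<^sub>R g x) \<le> norm (B *\<^sub>R g x)"
    using assms(3) by (intro AE_I2) (fastforce intro: mult_right_mono)
qed

lemma kernel_conv_integrable:
  fixes g :: "real ^ 2 \<Rightarrow> 'b::euclidean_space"
  assumes k: "kernel R k" and g: "integrable (lebesgue_on \<Omega>) g"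
  shows "integrable (lebesgue_on \<Omega>) (\<lambda>y. k (x - y) *\<^sub>R g y)"
proof -
  obtain B where B: "B \<ge> 0" "\<And>z. \<bar>k z\<bar> \<le> B" using kernel_bounded[OF k] by blast
  have [measurable]: "k \<in> borel_measurable borel" by (rule kernel_borel[OF k])
  have "(\<lambda>y. k (x - y)) \<in> borel_measurable borel" by measurable
  then show ?thesis
    using B by (intro integrable_bounded_mult[OF g, where B = B] borel_measurable_imp_lebesgue_on) auto
qed

text \<open>The convolution averages the values of F within distance R of x, with total weight at
  most 1. The bound is needed only near x, which is how a weight frozen at x can enter
  later.\<close>

lemma kernel_conv_bound:
  fixes F :: "real ^ 2 \<Rightarrow> 'b::euclidean_space"
  assumes k: "kernel R k" and \<Omega>: "\<Omega> \<in> sets lebesgue" and F: "integrable (lebesgue_on \<Omega>) F"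
    and b: "AE y in lebesgue_on \<Omega>. norm (x - y) \<le> R \<longrightarrow> norm (F y) \<le> b" and b0: "b \<ge> 0"
  shows "norm (\<integral>y. k (x - y) *\<^sub>R F y \<partial>lebesgue_on \<Omega>) \<le> b"
proof -
  let ?M = "lebesgue_on \<Omega>"
  have k0: "0 \<le> k z" for z using k by (simp add: kernel_def)
  have [measurable]: "k \<in> borel_measurable borel" by (rule kernel_borel[OF k])
  have m: "(\<lambda>y. ennreal (k (x - y))) \<in> borel_measurable ?M"
    by (rule borel_measurable_imp_lebesgue_on) measurable
  have "ennreal (norm (\<integral>y. k (x - y) *\<^sub>R F y \<partial>?M)) \<le> (\<integral>\<^sup>+y. norm (k (x - y) *\<^sub>R F y) \<partial>?M)"
    by (rule integral_norm_bound_ennreal[OF kernel_conv_integrable[OF k F]])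
  also have "\<dots> \<le> (\<integral>\<^sup>+y. ennreal b * ennreal (k (x - y)) \<partial>?M)"
  proof (rule nn_integral_mono_AE)
    show "AE y in ?M. ennreal (norm (k (x - y) *\<^sub>R F y)) \<le> ennreal b * ennreal (k (x - y))"
      using b
    proof eventually_elim
      fix y assume y: "norm (x - y) \<le> R \<longrightarrow> norm (F y) \<le> b"
      have "k (x - y) * norm (F y) \<le> k (x - y) * b"
      proof (cases "norm (x - y) \<le> R")
        case False
        then have "k (x - y) = 0" using k by (simp add: kernel_def)
        then show ?thesis by simp
      qed (use y k0 in \<open>simp add: mult_left_mono\<close>)
      then show "ennreal (norm (k (x - y) *\<^sub>R F y)) \<le> ennreal b * ennreal (k (x - y))"
        using k0[of "x - y"] b0 by (simp add: ennreal_mult[symmetric] mult.commute[of b])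
    qed
  qed
  also have "\<dots> = ennreal b * (\<integral>\<^sup>+y. ennreal (k (x - y)) \<partial>?M)" by (rule nn_integral_cmult[OF m])
  also have "\<dots> \<le> ennreal b * 1"
    using kernel_nn_integral_le[OF k _ \<Omega>, of "-1" x] by (intro mult_left_mono) simp_all
  finally show ?thesis using b0 by simp
qed

lemma kernel_conv_measurable:
  fixes g :: "real ^ 2 \<Rightarrow> real"
  assumes k: "kernel R k" and \<Omega>: "open \<Omega>" "bounded \<Omega>" and g: "g \<in> borel_measurable (lebesgue_on \<Omega>)"
  shows "(\<lambda>x. \<integral>y. k (x - y) * g y \<partial>lebesgue_on \<Omega>) \<in> borel_measurable (lebesgue_on \<Omega>)"
proof -
  interpret finite_measure "lebesgue_on \<Omega>" by (rule finite_measure_lebesgue_on_bounded[OF \<Omega>])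
  note [measurable] = g kernel_borel[OF k] borel_measurable_imp_lebesgue_on[of "\<lambda>x. x" \<Omega>, simplified]
  show ?thesis by measurable
qed

text \<open>Schur's test: both marginals of \<open>k (x - y)\<close> have mass at most 1. Young's
  inequality with weight a, splitting |v g| into a v^2 and g^2 / a, replaces Cauchy-Schwarz; the
  free parameter later makes a small g yield a small form. The estimate runs in
  \<open>ennreal\<close>, so Tonelli applies before integrability, itself a conclusion, is
  known.\<close>

lemma kernel_form_bound:
  fixes v g :: "real ^ 2 \<Rightarrow> real"
  assumes k: "kernel R k" and \<Omega>: "open \<Omega>" "bounded \<Omega>" and v: "v \<in> L2 \<Omega>" and g: "g \<in> L2 \<Omega>" and a: "a > 0"
  shows "integrable (lebesgue_on \<Omega>) (\<lambda>x. v x * (\<integral>y. k (x - y) * g y \<partial>lebesgue_on \<Omega>))"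
    and "\<bar>\<integral>x. v x * (\<integral>y. k (x - y) * g y \<partial>lebesgue_on \<Omega>) \<partial>lebesgue_on \<Omega>\<bar>
      \<le> a * L2_inner \<Omega> v v + L2_inner \<Omega> g g / a"
proof -
  let ?M = "lebesgue_on \<Omega>"
  let ?T = "\<lambda>x. \<integral>y. k (x - y) * g y \<partial>?M"
  have \<Omega>m: "\<Omega> \<in> sets lebesgue" using \<Omega>(1) by simp
  interpret finite_measure ?M by (rule finite_measure_lebesgue_on_bounded[OF \<Omega>])
  interpret P: pair_sigma_finite ?M ?M ..
  have k0: "0 \<le> k z" for z using k by (simp add: kernel_def)
  note [measurable] = L2_measurable[OF g] L2_measurable[OF v] kernel_borel[OF k]
    borel_measurable_imp_lebesgue_on[of "\<lambda>x. x" \<Omega>, simplified]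
  have Tm[measurable]: "?T \<in> borel_measurable ?M"
    by (rule kernel_conv_measurable[OF k \<Omega> L2_measurable[OF g]])
  have gi: "integrable ?M g" by (rule L2_integrable[OF \<Omega> g])
  have ineq: "\<bar>v x * k (x - y) * g y\<bar> \<le> (a * (v x)\<^sup>2) * k (x - y) + ((g y)\<^sup>2 / a) * k (x - y)" for x y
  proof -
    have "0 \<le> (a * \<bar>v x\<bar> - \<bar>g y\<bar>)\<^sup>2 / a" using a by simp
    also have "\<dots> = a * (v x)\<^sup>2 - 2 * (\<bar>v x\<bar> * \<bar>g y\<bar>) + (g y)\<^sup>2 / a"
      using a by (simp add: power2_eq_square field_simps flip: abs_mult)
    finally have "\<bar>v x\<bar> * \<bar>g y\<bar> \<le> a * (v x)\<^sup>2 + (g y)\<^sup>2 / a"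
      using mult_nonneg_nonneg[of "\<bar>v x\<bar>" "\<bar>g y\<bar>"] by linarith
    from mult_right_mono[OF this k0[of "x - y"]]
    show ?thesis using k0[of "x - y"] by (simp add: abs_mult algebra_simps)
  qed
  have "(\<integral>\<^sup>+x. ennreal (norm (v x * ?T x)) \<partial>?M) \<le> (\<integral>\<^sup>+x. (\<integral>\<^sup>+y. ennreal \<bar>v x * k (x - y) * g y\<bar> \<partial>?M) \<partial>?M)"
  proof (rule nn_integral_mono)
    fix x
    have "ennreal (norm (v x * ?T x)) = ennreal (norm (\<integral>y. v x * (k (x - y) * g y) \<partial>?M))"
      by simp
    also have "\<dots> \<le> (\<integral>\<^sup>+y. norm (v x * (k (x - y) * g y)) \<partial>?M)"
      using kernel_conv_integrable[OF k gi, of x] by (intro integral_norm_bound_ennreal) simp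
    finally show "ennreal (norm (v x * ?T x)) \<le> (\<integral>\<^sup>+y. ennreal \<bar>v x * k (x - y) * g y\<bar> \<partial>?M)"
      by (simp add: mult.assoc)
  qed
  also have "\<dots> \<le> (\<integral>\<^sup>+x. (\<integral>\<^sup>+y. ennreal (a * (v x)\<^sup>2) * ennreal (k (x - y)) + ennreal ((g y)\<^sup>2 / a) * ennreal (k (x - y)) \<partial>?M) \<partial>?M)"
    using a k0 ineq
    by (intro nn_integral_mono) (simp add: ennreal_mult[symmetric] ennreal_plus[symmetric] del: ennreal_plus)
  also have "\<dots> = (\<integral>\<^sup>+x. (\<integral>\<^sup>+y. ennreal (a * (v x)\<^sup>2) * ennreal (k (x - y)) \<partial>?M) \<partial>?M) + (\<integral>\<^sup>+x. (\<integral>\<^sup>+y. ennreal ((g y)\<^sup>2 / a) * ennreal (k (x - y)) \<partial>?M) \<partial>?M)"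
    by (subst nn_integral_add[symmetric]) (auto intro!: nn_integral_cong nn_integral_add)
  also have "(\<integral>\<^sup>+x. (\<integral>\<^sup>+y. ennreal (a * (v x)\<^sup>2) * ennreal (k (x - y)) \<partial>?M) \<partial>?M) \<le> (\<integral>\<^sup>+x. ennreal (a * (v x)\<^sup>2) \<partial>?M)"
  proof (rule nn_integral_mono)
    fix x
    have "(\<integral>\<^sup>+y. ennreal (a * (v x)\<^sup>2) * ennreal (k (x - y)) \<partial>?M) = ennreal (a * (v x)\<^sup>2) * (\<integral>\<^sup>+y. ennreal (k (x - y)) \<partial>?M)"
      by (rule nn_integral_cmult) measurable
    also have "\<dots> \<le> ennreal (a * (v x)\<^sup>2) * 1"
      using kernel_nn_integral_le[OF k _ \<Omega>m, of "-1" x] by (intro mult_left_mono) simp_all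
    finally show "(\<integral>\<^sup>+y. ennreal (a * (v x)\<^sup>2) * ennreal (k (x - y)) \<partial>?M) \<le> ennreal (a * (v x)\<^sup>2)" by simp
  qed
  also have "(\<integral>\<^sup>+x. (\<integral>\<^sup>+y. ennreal ((g y)\<^sup>2 / a) * ennreal (k (x - y)) \<partial>?M) \<partial>?M) = (\<integral>\<^sup>+y. (\<integral>\<^sup>+x. ennreal ((g y)\<^sup>2 / a) * ennreal (k (x - y)) \<partial>?M) \<partial>?M)"
    by (rule P.Fubini'[symmetric]) measurable
  also have "\<dots> \<le> (\<integral>\<^sup>+y. ennreal ((g y)\<^sup>2 / a) \<partial>?M)"
  proof (rule nn_integral_mono)
    fix y
    have "(\<integral>\<^sup>+x. ennreal ((g y)\<^sup>2 / a) * ennreal (k (x - y)) \<partial>?M) = ennreal ((g y)\<^sup>2 / a) * (\<integral>\<^sup>+x. ennreal (k (x - y)) \<partial>?M)"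
      by (rule nn_integral_cmult) measurable
    also have "\<dots> \<le> ennreal ((g y)\<^sup>2 / a) * 1"
      using kernel_nn_integral_le[OF k _ \<Omega>m, of 1 "- y"] by (intro mult_left_mono) simp_all
    finally show "(\<integral>\<^sup>+x. ennreal ((g y)\<^sup>2 / a) * ennreal (k (x - y)) \<partial>?M) \<le> ennreal ((g y)\<^sup>2 / a)" by simp
  qed
  also have "(\<integral>\<^sup>+x. ennreal (a * (v x)\<^sup>2) \<partial>?M) = ennreal (a * L2_inner \<Omega> v v)"
    using L2_square_integrable[OF v] a
    by (subst nn_integral_eq_integral) (auto simp: L2_inner_self)
  also have "(\<integral>\<^sup>+y. ennreal ((g y)\<^sup>2 / a) \<partial>?M) = ennreal (L2_inner \<Omega> g g / a)"
    using L2_square_integrable[OF g] a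
    by (subst nn_integral_eq_integral) (auto simp: L2_inner_self)
  also have "ennreal (a * L2_inner \<Omega> v v) + ennreal (L2_inner \<Omega> g g / a) = ennreal (a * L2_inner \<Omega> v v + L2_inner \<Omega> g g / a)"
    using a by (simp add: L2_inner_self_nonneg)
  finally have main: "(\<integral>\<^sup>+x. ennreal (norm (v x * ?T x)) \<partial>?M) \<le> ennreal (a * L2_inner \<Omega> v v + L2_inner \<Omega> g g / a)"
    by (simp add: add_mono)
  show int: "integrable ?M (\<lambda>x. v x * ?T x)"
    by (rule integrableI_bounded) (use main in \<open>auto intro: le_less_trans\<close>)
  have "ennreal (norm (\<integral>x. v x * ?T x \<partial>?M)) \<le> ennreal (a * L2_inner \<Omega> v v + L2_inner \<Omega> g g / a)"
    using integral_norm_bound_ennreal[OF int] main by (rule order_trans)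
  moreover have "0 \<le> a * L2_inner \<Omega> v v + L2_inner \<Omega> g g / a"
    using a by (simp add: L2_inner_self_nonneg)
  ultimately show "\<bar>\<integral>x. v x * ?T x \<partial>?M\<bar> \<le> a * L2_inner \<Omega> v v + L2_inner \<Omega> g g / a"
    by simp
qed

lemma kernel_conv_pointwise:
  fixes h :: "real ^ 2 \<Rightarrow> real"
  assumes k: "\<And>n. kernel (R n) (k n)" and R: "R \<longlonglongrightarrow> 0" and \<Omega>: "open \<Omega>"
    and x: "x \<in> \<Omega>" and h: "continuous_on UNIV h" and hi: "integrable (lebesgue_on \<Omega>) h"
  shows "(\<lambda>n. \<integral>y. k n (x - y) * h y \<partial>lebesgue_on \<Omega>) \<longlonglongrightarrow> h x"
proof (rule LIMSEQ_I)
  fix e :: real assume e: "e > 0"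
  let ?M = "lebesgue_on \<Omega>"
  have \<Omega>m: "\<Omega> \<in> sets lebesgue" using \<Omega> by simp
  obtain d1 where d1: "d1 > 0" "ball x d1 \<subseteq> \<Omega>" using \<Omega> x open_contains_ball by blast
  have "isCont h x" using h by (simp add: continuous_on_eq_continuous_at)
  then obtain d2 where d2: "d2 > 0" "\<And>y. dist y x < d2 \<Longrightarrow> dist (h y) (h x) < e / 2"
    using e unfolding continuous_at_eps_delta by (metis half_gt_zero)
  have "\<forall>\<^sub>F n in sequentially. R n < min d1 d2"
    using order_tendstoD(2)[OF R, of "min d1 d2"] d1 d2 by simp
  then obtain N where N: "\<And>n. n \<ge> N \<Longrightarrow> R n < min d1 d2"
    unfolding eventually_sequentially by blast
  show "\<exists>N. \<forall>n\<ge>N. norm ((\<integral>y. k n (x - y) * h y \<partial>?M) - h x) < e"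
  proof (intro exI allI impI)
    fix n assume n: "N \<le> n"
    have k0: "0 \<le> k n z" for z using k[of n] by (simp add: kernel_def)
    have sup: "k n (x - y) = 0" if "dist y x \<ge> min d1 d2" for y
    proof -
      have "R n < norm (x - y)"
        using N[OF n] that by (simp add: dist_norm norm_minus_commute del: min_less_iff_conj)
      then show ?thesis using k[of n] by (simp add: kernel_def)
    qed
    have km: "(\<lambda>y. k n (x - y)) \<in> borel_measurable borel"
      using kernel_borel[OF k[of n]] by measurable
    \<comment> \<open>Exact mass 1, not just at most 1: once R n is below \<open>d1\<close>, the
      kernel translated to the interior point x lives inside \<Omega>.\<close>
    have one: "(\<integral>y. k n (x - y) \<partial>?M) = 1"
    proof -
      have "(\<integral>y. k n (x - y) \<partial>?M) = (\<integral>y. k n (x - y) \<partial>lborel)"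
      proof (rule integral_lebesgue_on_eq_lborel[OF \<Omega>m km])
        fix y assume "y \<notin> \<Omega>"
        then have "y \<notin> ball x d1" using d1 by blast
        then show "k n (x - y) = 0" by (intro sup) (simp add: dist_commute)
      qed
      also have "\<dots> = 1" using kernel_shift_integral(2)[OF k[of n], of "-1" x] by simp
      finally show ?thesis .
    qed
    \<comment> \<open>A non-integrable function has Bochner integral 0 by convention, so the value 1
      certifies integrability.\<close>
    have ki: "integrable ?M (\<lambda>y. k n (x - y))"
      using one not_integrable_integral_eq by fastforce
    have khi: "integrable ?M (\<lambda>y. k n (x - y) * h y)"
      using kernel_conv_integrable[OF k[of n] hi, of x] by simp
    have "(\<integral>y. k n (x - y) * h y \<partial>?M) - h x = (\<integral>y. k n (x - y) * h y \<partial>?M) - (\<integral>y. k n (x - y) * h x \<partial>?M)"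
      using one by simp
    also have "\<dots> = (\<integral>y. k n (x - y) * h y - k n (x - y) * h x \<partial>?M)"
      using khi ki by (intro Bochner_Integration.integral_diff[symmetric]) auto
    finally have eq: "(\<integral>y. k n (x - y) * h y \<partial>?M) - h x = (\<integral>y. k n (x - y) * h y - k n (x - y) * h x \<partial>?M)" .
    have "norm (\<integral>y. k n (x - y) * h y - k n (x - y) * h x \<partial>?M) \<le> (\<integral>y. norm (k n (x - y) * h y - k n (x - y) * h x) \<partial>?M)"
      by (rule integral_norm_bound)
    also have "\<dots> \<le> (\<integral>y. k n (x - y) * (e / 2) \<partial>?M)"
    proof (rule integral_mono)
      fix y
      show "norm (k n (x - y) * h y - k n (x - y) * h x) \<le> k n (x - y) * (e / 2)"
      proof (cases "dist y x < min d1 d2")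
        case True
        then have "\<bar>h y - h x\<bar> \<le> e / 2" using d2(2)[of y] by (simp add: dist_real_def)
        then have "k n (x - y) * \<bar>h y - h x\<bar> \<le> k n (x - y) * (e / 2)"
          using k0 by (rule mult_left_mono)
        moreover have "norm (k n (x - y) * h y - k n (x - y) * h x) = k n (x - y) * \<bar>h y - h x\<bar>"
          using k0[of "x - y"] by (simp add: abs_mult flip: right_diff_distrib)
        ultimately show ?thesis by simp
      next
        case False
        then have "k n (x - y) = 0" by (intro sup) linarith
        then show ?thesis by simp
      qed
    qed (use khi ki in auto)
    also have "\<dots> = e / 2" using one by simp
    finally show "norm ((\<integral>y. k n (x - y) * h y \<partial>?M) - h x) < e" using e unfolding eq by simp
  qed
qed

text \<open>Bounded continuous h are handled by dominated convergence, and
  \<open>kernel_form_bound\<close> transfers the limit to g by density. Pairing with a fixed v is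
  all that is needed, so no norm convergence of the convolutions is proved.\<close>

lemma kernel_form_tendsto:
  fixes v g :: "real ^ 2 \<Rightarrow> real"
  assumes k: "\<And>n. kernel (R n) (k n)" and R: "R \<longlonglongrightarrow> 0" and \<Omega>: "open \<Omega>" "bounded \<Omega>"
    and v: "v \<in> L2 \<Omega>" and g: "g \<in> L2 \<Omega>"
  shows "(\<lambda>n. \<integral>x. v x * (\<integral>y. k n (x - y) * g y \<partial>lebesgue_on \<Omega>) \<partial>lebesgue_on \<Omega>) \<longlonglongrightarrow> L2_inner \<Omega> v g"
proof (rule LIMSEQ_I)
  fix r :: real assume r: "r > 0"
  let ?M = "lebesgue_on \<Omega>"
  let ?T = "\<lambda>n f x. \<integral>y. k n (x - y) * f y \<partial>?M"
  have \<Omega>m: "\<Omega> \<in> sets lebesgue" using \<Omega>(1) by simp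
  define V where "V = L2_inner \<Omega> v v"
  have V0: "V \<ge> 0" unfolding V_def by (rule L2_inner_self_nonneg)
  \<comment> \<open>Chosen backwards: if the approximation error D is below a^2, then a V + D / a <
    a (V + 1) = r / 3. The summand 1 covers V = 0.\<close>
  define a where "a = (r / 3) / (V + 1)"
  have a: "a > 0" using r V0 by (simp add: a_def)
  obtain h B where h: "continuous_on UNIV h" "\<And>x. \<bar>h x\<bar> \<le> B" "(\<integral>x. (g x - h x)\<^sup>2 \<partial>?M) < a\<^sup>2"
    using L2_approx_continuous[OF \<Omega> g, of "a\<^sup>2"] a by auto
  have B0: "B \<ge> 0" using h(2)[of 0] by linarith
  have hm: "h \<in> borel_measurable ?M"
    by (intro borel_measurable_imp_lebesgue_on borel_measurable_continuous_onI h)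
  have hL: "h \<in> L2 \<Omega>" by (rule L2_bounded[OF \<Omega> hm, of B]) (use h(2) in simp)
  have hi: "integrable ?M h" by (rule L2_integrable[OF \<Omega> hL])
  have gi: "integrable ?M g" by (rule L2_integrable[OF \<Omega> g])
  have dL: "(\<lambda>x. g x - h x) \<in> L2 \<Omega>" by (rule L2_diff[OF g hL])
  define D where "D = L2_inner \<Omega> (\<lambda>x. g x - h x) (\<lambda>x. g x - h x)"
  have D: "D < a\<^sup>2" using h(3) by (simp add: D_def L2_inner_self)
  have small: "a * V + D / a < r / 3"
  proof -
    have "D / a < a" using D a by (simp add: divide_less_eq power2_eq_square)
    then have "a * V + D / a < a * (V + 1)" by (simp add: algebra_simps)
    also have "\<dots> = r / 3" using V0 unfolding a_def by (intro nonzero_eq_divide_eq[THEN iffD1]) auto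
    finally show ?thesis .
  qed
  have "(\<lambda>n. \<integral>x. v x * ?T n h x \<partial>?M) \<longlonglongrightarrow> (\<integral>x. v x * h x \<partial>?M)"
  proof (rule integral_dominated_convergence)
    show "(\<lambda>x. v x * h x) \<in> borel_measurable ?M"
      by (intro borel_measurable_times L2_measurable[OF v] hm)
    show "(\<lambda>x. v x * ?T n h x) \<in> borel_measurable ?M" for n
      by (intro borel_measurable_times L2_measurable[OF v] kernel_conv_measurable[OF k \<Omega> hm])
    show "integrable ?M (\<lambda>x. B * \<bar>v x\<bar>)"
      using L2_integrable[OF \<Omega> v] by simp
    show "AE x in ?M. (\<lambda>n. v x * ?T n h x) \<longlonglongrightarrow> v x * h x"
      by (intro AE_I2 tendsto_intros kernel_conv_pointwise[OF k R \<Omega>(1) _ h(1) hi])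
        (simp add: space_restrict_space)
    show "AE x in ?M. norm (v x * ?T n h x) \<le> B * \<bar>v x\<bar>" for n
      using kernel_conv_bound[OF k[of n] \<Omega>m hi _ B0] h(2)
      by (intro AE_I2) (simp add: abs_mult mult.commute[of B] mult_left_mono)
  qed
  from LIMSEQ_D[OF this, of "r / 3"] r
  obtain N where N: "\<And>n. n \<ge> N \<Longrightarrow> norm ((\<integral>x. v x * ?T n h x \<partial>?M) - (\<integral>x. v x * h x \<partial>?M)) < r / 3"
    by auto
  show "\<exists>N. \<forall>n\<ge>N. norm ((\<integral>x. v x * ?T n g x \<partial>?M) - L2_inner \<Omega> v g) < r"
  proof (intro exI allI impI)
    fix n assume n: "N \<le> n"
    have T: "?T n (\<lambda>x. g x - h x) x = ?T n g x - ?T n h x" for x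
      using kernel_conv_integrable[OF k[of n] gi, of x] kernel_conv_integrable[OF k[of n] hi, of x]
      by (simp add: right_diff_distrib)
    have 1: "\<bar>(\<integral>x. v x * ?T n g x \<partial>?M) - (\<integral>x. v x * ?T n h x \<partial>?M)\<bar> < r / 3"
    proof -
      have "(\<integral>x. v x * ?T n (\<lambda>x. g x - h x) x \<partial>?M) = (\<integral>x. v x * ?T n g x - v x * ?T n h x \<partial>?M)"
        unfolding T by (intro Bochner_Integration.integral_cong refl right_diff_distrib)
      also have "\<dots> = (\<integral>x. v x * ?T n g x \<partial>?M) - (\<integral>x. v x * ?T n h x \<partial>?M)"
        by (rule Bochner_Integration.integral_diff)
          (rule kernel_form_bound(1)[OF k \<Omega> v g a], rule kernel_form_bound(1)[OF k \<Omega> v hL a])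
      finally show ?thesis
        using kernel_form_bound(2)[OF k[of n] \<Omega> v dL a] small unfolding V_def D_def by linarith
    qed
    have 2: "\<bar>(\<integral>x. v x * h x \<partial>?M) - L2_inner \<Omega> v g\<bar> < r / 3"
    proof -
      have "L2_inner \<Omega> v g - L2_inner \<Omega> v h = L2_inner \<Omega> v (\<lambda>x. g x - h x)"
        by (rule L2_inner_diff_right[OF g hL v, symmetric])
      \<comment> \<open>Young's inequality for sqrt a times v and (g - h) / sqrt a reproduces the
        bound a V + D / a, so \<open>small\<close> serves both errors.\<close>
      moreover have "2 * \<bar>L2_inner \<Omega> v (\<lambda>x. g x - h x)\<bar> \<le> a * V + D / a"
      proof -
        define s where "s = sqrt a"
        have s: "s > 0" "s\<^sup>2 = a" using a by (simp_all add: s_def)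
        have "2 * \<bar>L2_inner \<Omega> (\<lambda>x. s *\<^sub>R v x) (\<lambda>x. (1 / s) *\<^sub>R (g x - h x))\<bar>
          \<le> L2_inner \<Omega> (\<lambda>x. s *\<^sub>R v x) (\<lambda>x. s *\<^sub>R v x) + L2_inner \<Omega> (\<lambda>x. (1 / s) *\<^sub>R (g x - h x)) (\<lambda>x. (1 / s) *\<^sub>R (g x - h x))"
          by (intro L2_Young L2_scaleR v dL)
        then show ?thesis
          using s unfolding L2_inner_scaleR_left L2_inner_scaleR_right V_def D_def
          by (simp add: power2_eq_square flip: s(2))
      qed
      moreover have "L2_inner \<Omega> v h = (\<integral>x. v x * h x \<partial>?M)" by (simp add: L2_inner_def)
      ultimately show ?thesis using small by linarith
    qed
    show "norm ((\<integral>x. v x * ?T n g x \<partial>?M) - L2_inner \<Omega> v g) < r"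
      using 1 2 N[OF n] unfolding real_norm_def by linarith
  qed
qed

section \<open>A compactly supported C1 kernel with Lipschitz gradient\<close>

lemma has_derivative_quadratic:
  assumes D: "bounded_linear D" and r: "\<And>y. norm (f y - f x - D (y - x)) \<le> C * (norm (y - x))\<^sup>2"
  shows "(f has_derivative D) (at x)"
proof (rule has_derivativeI_sandwich[of 1])
  show "norm (f y - f x - D (y - x)) / norm (y - x) \<le> C * norm (y - x)" if "y \<noteq> x" for y
    using r[of y] that by (simp add: divide_le_eq power2_eq_square mult.assoc)
  have "((\<lambda>y. C * norm (y - x)) \<longlongrightarrow> C * norm (x - x)) (at x)"
    by (intro tendsto_intros)
  then show "((\<lambda>y. C * norm (y - x)) \<longlongrightarrow> 0) (at x)" by simp
qed (use D in auto)

text \<open>The mean value inequality for k minus its linear part at x, on the ball through y. The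
  remainder is uniform in the base point and so survives integration against F, which is how
  convolutions will be differentiated without exchanging limits.\<close>

lemma quadratic_remainder:
  fixes k :: "'a::euclidean_space \<Rightarrow> real"
  assumes d: "\<And>z. (k has_derivative (\<lambda>h. G z \<bullet> h)) (at z)"
    and L: "\<And>z w. norm (G z - G w) \<le> L * norm (z - w)" "L \<ge> 0"
  shows "\<bar>k y - k x - G x \<bullet> (y - x)\<bar> \<le> L * (norm (y - x))\<^sup>2"
proof -
  let ?f = "\<lambda>z. k z - G x \<bullet> z"
  let ?S = "cball x (norm (y - x))"
  have "norm (?f y - ?f x) \<le> (L * norm (y - x)) * norm (y - x)"
  proof (rule differentiable_bound[of ?S ?f "\<lambda>z h. (G z - G x) \<bullet> h"])
    fix z assume z: "z \<in> ?S"
    show "(?f has_derivative (\<lambda>h. (G z - G x) \<bullet> h)) (at z within ?S)"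
      using has_derivative_diff[OF d[of z] bounded_linear_imp_has_derivative[OF bounded_linear_inner_right[of "G x"]]]
      by (simp add: inner_diff_left has_derivative_at_withinI)
    have "norm (G z - G x) \<le> L * norm (z - x)" by (rule L(1))
    also have "\<dots> \<le> L * norm (y - x)"
      using z L(2) by (intro mult_left_mono) (simp_all add: dist_norm norm_minus_commute)
    finally have b: "norm (G z - G x) \<le> L * norm (y - x)" .
    show "onorm (\<lambda>h. (G z - G x) \<bullet> h) \<le> L * norm (y - x)"
    proof (rule onorm_bound)
      fix h
      have "norm ((G z - G x) \<bullet> h) \<le> norm (G z - G x) * norm h"
        using Cauchy_Schwarz_ineq2 by simp
      also have "\<dots> \<le> L * norm (y - x) * norm h"
        using b by (intro mult_right_mono) auto
      finally show "norm ((G z - G x) \<bullet> h) \<le> L * norm (y - x) * norm h" .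
    qed (use L(2) in simp)
  qed (auto simp: dist_norm norm_minus_commute)
  then show ?thesis by (simp add: inner_diff_right power2_eq_square algebra_simps)
qed

text \<open>The square of the positive part has derivative \<open>2 * max 0 u\<close>, which is
  Lipschitz with constant 2; hence the remainder is at most the square of the step although there is
  no second derivative at 0.\<close>

lemma square_max_remainder:
  fixes u t :: real
  shows "\<bar>(max 0 (u + t))\<^sup>2 - (max 0 u)\<^sup>2 - 2 * max 0 u * t\<bar> \<le> t\<^sup>2"
proof -
  consider "u \<ge> 0" "u + t \<ge> 0" | "u \<ge> 0" "u + t < 0" | "u < 0" "u + t \<ge> 0" | "u < 0" "u + t < 0"
    by linarith
  then show ?thesis
  proof cases
    case 1
    then show ?thesis by (simp add: max_def power2_eq_square algebra_simps)
  next
    case 2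
    have "0 \<le> u * (- (u + t) - t)" using 2 by (intro mult_nonneg_nonneg) auto
    moreover have "0 \<le> (u + t)\<^sup>2" by simp
    ultimately show ?thesis using 2 by (simp add: max_def power2_eq_square algebra_simps)
  next
    case 3
    then have "(u + t)\<^sup>2 \<le> t\<^sup>2" by (intro power_mono) auto
    then show ?thesis using 3 by (simp add: max_def)
  next
    case 4
    then show ?thesis by (simp add: max_def)
  qed
qed

lemma square_max_derivative: "((\<lambda>u::real. (max 0 u)\<^sup>2) has_derivative (\<lambda>h. 2 * max 0 u * h)) (at u)"
proof (rule has_derivative_quadratic[where C = 1])
  show "bounded_linear (\<lambda>h::real. 2 * max 0 u * h)" by (rule bounded_linear_mult_right)
  show "norm ((max 0 y)\<^sup>2 - (max 0 u)\<^sup>2 - 2 * max 0 u * (y - u)) \<le> 1 * (norm (y - u))\<^sup>2" for y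
    using square_max_remainder[of u "y - u"] by simp
qed

text \<open>Test fields need only be C1, so a truncated polynomial replaces the usual exponential
  bump. The outer square makes the gradient continuous, and even Lipschitz, across the unit
  circle.\<close>

definition bump :: "real ^ 2 \<Rightarrow> real" where
  "bump z = (max 0 (1 - z \<bullet> z))\<^sup>2"

definition bump_grad :: "real ^ 2 \<Rightarrow> real ^ 2" where
  "bump_grad z = (- 4) *\<^sub>R (max 0 (1 - z \<bullet> z) *\<^sub>R z)"

lemma bump_has_derivative: "(bump has_derivative (\<lambda>h. bump_grad z \<bullet> h)) (at z)"
proof -
  have "((\<lambda>z::real^2. 1 - z \<bullet> z) has_derivative (\<lambda>h. - 2 * (z \<bullet> h))) (at z)"
    by (auto intro!: derivative_eq_intros simp: inner_commute)
  from has_derivative_compose[OF this square_max_derivative]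
  show ?thesis unfolding bump_def[abs_def] bump_grad_def
    by (simp add: algebra_simps)
qed

lemma bump_nonneg: "bump z \<ge> 0"
  by (simp add: bump_def)

lemma bump_pos: "norm z < 1 \<Longrightarrow> bump z > 0"
  using power_strict_mono[of "norm z" 1 2]
  by (simp add: bump_def power2_norm_eq_inner)

lemma bump_outside:
  assumes "norm z \<ge> 1"
  shows "bump z = 0" "bump_grad z = 0"
proof -
  have "1 \<le> z \<bullet> z" using power_mono[OF assms, of 2] by (simp add: power2_norm_eq_inner)
  then show "bump z = 0" "bump_grad z = 0" by (simp_all add: bump_def bump_grad_def max_def)
qed

lemma bump_grad_bound: "norm (bump_grad z) \<le> 4"
proof (cases "norm z \<ge> 1")
  case True
  then show ?thesis using bump_outside[OF True] by simp
next
  case False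
  have "\<bar>max 0 (1 - z \<bullet> z)\<bar> * norm z \<le> 1 * 1"
    using False by (intro mult_mono) auto
  then show ?thesis by (simp add: bump_grad_def)
qed

text \<open>12 = 4 * 3. Inside the disc the product rule for \<open>m z *\<^sub>R z\<close> costs 1
  for the factor z and 2 for m; if one point lies outside, the decay of m towards the circle keeps
  the constant within 3 as well.\<close>

lemma bump_grad_Lipschitz: "norm (bump_grad z - bump_grad w) \<le> 12 * norm (z - w)"
proof -
  define m where "m z = max 0 (1 - z \<bullet> z)" for z :: "real ^ 2"
  have m0: "m z = 0" if "norm z \<ge> 1" for z
    using power_mono[OF that, of 2] by (simp add: m_def power2_norm_eq_inner max_def)
  have mle: "0 \<le> m z" "m z \<le> 1" for z by (auto simp: m_def)
  \<comment> \<open>1 - |a| is at most the distance from a to any b outside the disc, and 1 + |a| <=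
    2.\<close>
  have mout: "m a \<le> 2 * norm (a - b)" if "norm b \<ge> 1" for a b
  proof (cases "norm a \<ge> 1")
    case True then show ?thesis using m0[OF True] by simp
  next
    case False
    have "m a = (1 - norm a) * (1 + norm a)"
      using False power_mono[of "norm a" 1 2]
      by (simp add: m_def max_def algebra_simps power2_eq_square flip: power2_norm_eq_inner)
    also have "\<dots> \<le> norm (a - b) * 2"
      using False that norm_triangle_ineq2[of b a] by (intro mult_mono) (auto simp: norm_minus_commute)
    finally show ?thesis by simp
  qed
  have out: "norm (m a *\<^sub>R a - m b *\<^sub>R b) \<le> 3 * norm (a - b)" if b: "norm b \<ge> 1" for a b
  proof (cases "norm a \<ge> 1")
    case True then show ?thesis using m0[OF True] m0[OF b] by simp
  next
    case False
    have "m a * norm a \<le> m a * 1" using False mle[of a] by (intro mult_left_mono) auto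
    also have "\<dots> \<le> 3 * norm (a - b)" using mout[OF b, of a] norm_ge_zero[of "a - b"] by linarith
    finally show ?thesis using m0[OF b] mle[of a] by simp
  qed
  have main: "norm (m z *\<^sub>R z - m w *\<^sub>R w) \<le> 3 * norm (z - w)"
  proof -
    consider "norm w \<ge> 1" | "norm z \<ge> 1" | "norm z < 1" "norm w < 1" by linarith
    then show ?thesis
    proof cases
      case 1 then show ?thesis by (rule out)
    next
      case 2 from out[OF 2, of w] show ?thesis by (simp add: norm_minus_commute)
    next
      case 3
      have mz: "m z = 1 - z \<bullet> z" "m w = 1 - w \<bullet> w"
        using 3 power_mono[of "norm z" 1 2] power_mono[of "norm w" 1 2]
        by (auto simp: m_def power2_norm_eq_inner)
      have "m z - m w = (w - z) \<bullet> (w + z)"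
        unfolding mz by (simp add: inner_simps inner_commute)
      then have "\<bar>m z - m w\<bar> \<le> norm (w - z) * norm (w + z)"
        by (simp add: Cauchy_Schwarz_ineq2)
      also have "\<dots> \<le> norm (w - z) * 2"
        using 3 norm_triangle_ineq[of w z] by (intro mult_left_mono) auto
      finally have d: "\<bar>m z - m w\<bar> \<le> 2 * norm (z - w)" by (simp add: norm_minus_commute)
      have "m z *\<^sub>R z - m w *\<^sub>R w = m z *\<^sub>R (z - w) + (m z - m w) *\<^sub>R w"
        by (simp add: algebra_simps)
      then have "norm (m z *\<^sub>R z - m w *\<^sub>R w) \<le> norm (m z *\<^sub>R (z - w)) + norm ((m z - m w) *\<^sub>R w)"
        by (simp only: norm_triangle_ineq)
      also have "\<dots> \<le> 1 * norm (z - w) + 2 * norm (z - w) * 1"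
        unfolding norm_scaleR using 3 d mle[of z] by (intro add_mono mult_mono) auto
      finally show ?thesis by simp
    qed
  qed
  have "bump_grad z - bump_grad w = (- 4) *\<^sub>R (m z *\<^sub>R z - m w *\<^sub>R w)"
    by (simp add: bump_grad_def m_def scaleR_diff_right)
  then have "norm (bump_grad z - bump_grad w) = 4 * norm (m z *\<^sub>R z - m w *\<^sub>R w)" by simp
  with main show ?thesis by simp
qed

text \<open>A centre c off the origin produces the inward shift; \<open>norm c + \<rho>\<close> is
  the radius about the origin that turns the shifted kernel into an instance of
  \<open>kernel\<close>. G is the gradient, carried along with a Lipschitz constant and a bound for
  differentiation under the integral.\<close>

definition smooth_kernel :: "real ^ 2 \<Rightarrow> real \<Rightarrow> (real ^ 2 \<Rightarrow> real) \<Rightarrow> (real ^ 2 \<Rightarrow> real ^ 2) \<Rightarrow> bool" where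
  "smooth_kernel c \<rho> k G \<longleftrightarrow> kernel (norm c + \<rho>) k \<and> (\<forall>z. k z \<noteq> 0 \<longrightarrow> z \<in> cball c \<rho>) \<and>
     (\<forall>z. (k has_derivative (\<lambda>h. G z \<bullet> h)) (at z)) \<and>
     (\<exists>L B. L \<ge> 0 \<and> (\<forall>z w. norm (G z - G w) \<le> L * norm (z - w)) \<and> (\<forall>z. norm (G z) \<le> B))"

lemma smooth_kernel_continuous_grad:
  assumes "smooth_kernel c \<rho> k G"
  shows "continuous_on UNIV G"
proof -
  obtain L where "L \<ge> 0" "\<And>z w. norm (G z - G w) \<le> L * norm (z - w)"
    using assms unfolding smooth_kernel_def by blast
  then have "L-lipschitz_on UNIV G" by (intro lipschitz_onI) (auto simp: dist_norm)
  then show ?thesis by (rule lipschitz_on_continuous_on)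
qed

lemma smooth_kernel_exists:
  assumes \<rho>: "\<rho> > 0"
  shows "\<exists>k G. smooth_kernel c \<rho> k G"
proof -
  define s where "s z = (1 / \<rho>) *\<^sub>R (z - c)" for z :: "real ^ 2"
  define f where "f z = bump (s z)" for z
  have sd: "(s has_derivative (\<lambda>h. (1 / \<rho>) *\<^sub>R h)) (at z)" for z
    unfolding s_def[abs_def] by (auto intro!: derivative_eq_intros)
  have fd: "(f has_derivative (\<lambda>h. ((1 / \<rho>) *\<^sub>R bump_grad (s z)) \<bullet> h)) (at z)" for z
    using has_derivative_compose[OF sd bump_has_derivative] unfolding f_def[abs_def] by simp
  have cf: "continuous_on UNIV f"
    using has_derivative_continuous[OF fd] by (simp add: continuous_at_imp_continuous_on)
  have ns: "norm (s z) = norm (z - c) / \<rho>" for z using \<rho> by (simp add: s_def)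
  have out: "f z = 0" if "z \<notin> cball c \<rho>" for z
    using that \<rho> bump_outside(1)[of "s z"] by (simp add: f_def ns dist_norm norm_minus_commute)
  have fi: "integrable lborel f"
    by (rule integrable_continuous_compact_support[OF cf compact_cball out])
  define N where "N = integral\<^sup>L lborel f"
  \<comment> \<open>Mass zero would make the open set where f does not vanish a null set, but it
    contains c.\<close>
  have "N \<noteq> 0"
  proof
    assume "N = 0"
    then have "AE z in lborel. f z = 0"
      using integral_nonneg_eq_0_iff_AE[OF fi] by (simp add: N_def f_def bump_nonneg)
    moreover have op: "open {z. f z \<noteq> 0}" by (rule open_Collect_neq[OF cf continuous_on_const])
    then have sets: "{z. f z \<noteq> 0} \<in> sets lborel" by simp
    ultimately have "emeasure lborel {z. f z \<noteq> 0} = 0"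
      by (subst (asm) AE_iff_measurable[OF sets]) auto
    then have "negligible {z. f z \<noteq> 0}"
      using sets by (simp add: negligible_iff_emeasure0 sets_completionI_sets)
    moreover have "f c \<noteq> 0"
      using bump_pos[of 0] by (simp add: f_def s_def)
    ultimately show False
      using open_not_negligible[OF op] by auto
  qed
  moreover have "N \<ge> 0" unfolding N_def by (rule integral_nonneg_AE) (simp add: f_def bump_nonneg)
  ultimately have N: "N > 0" by simp
  define k where "k z = f z / N" for z
  define G where "G z = (1 / (N * \<rho>)) *\<^sub>R bump_grad (s z)" for z
  have "kernel (norm c + \<rho>) k"
    unfolding kernel_def
  proof (intro conjI allI impI)
    show "continuous_on UNIV k" unfolding k_def[abs_def] using N by (intro continuous_intros cf) auto
    show "0 \<le> k z" for z using N by (simp add: k_def f_def bump_nonneg)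
    show "k z = 0" if "norm c + \<rho> < norm z" for z
    proof -
      have "z \<notin> cball c \<rho>"
        using that norm_triangle_ineq2[of z c] by (simp add: dist_norm norm_minus_commute)
      then show ?thesis by (simp add: k_def out)
    qed
    show "integral\<^sup>L lborel k = 1" using N unfolding k_def[abs_def] by (simp add: N_def)
  qed
  moreover have "z \<in> cball c \<rho>" if "k z \<noteq> 0" for z
    using that out[of z] by (auto simp: k_def)
  moreover have "(k has_derivative (\<lambda>h. G z \<bullet> h)) (at z)" for z
  proof -
    have "((\<lambda>z. f z * (1 / N)) has_derivative (\<lambda>h. ((1 / \<rho>) *\<^sub>R bump_grad (s z)) \<bullet> h * (1 / N))) (at z)"
      by (rule has_derivative_mult_left[OF fd])
    then show ?thesis by (simp add: k_def[abs_def] G_def mult.commute)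
  qed
  \<comment> \<open>One factor 1 / \<rho> comes from the chain rule in G, the other from the
    rescaled argument of \<open>bump_grad\<close>.\<close>
  moreover have "norm (G z - G w) \<le> (12 / (N * \<rho> * \<rho>)) * norm (z - w)" for z w
  proof -
    have "G z - G w = (1 / (N * \<rho>)) *\<^sub>R (bump_grad (s z) - bump_grad (s w))"
      by (simp add: G_def scaleR_diff_right)
    then have "norm (G z - G w) = (1 / (N * \<rho>)) * norm (bump_grad (s z) - bump_grad (s w))"
      using N \<rho> by simp
    also have "\<dots> \<le> (1 / (N * \<rho>)) * (12 * norm (s z - s w))"
      using N \<rho> by (intro mult_left_mono bump_grad_Lipschitz) auto
    also have "s z - s w = (1 / \<rho>) *\<^sub>R (z - w)" by (simp add: s_def flip: scaleR_diff_right)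
    finally show ?thesis using \<rho> by (simp add: mult.assoc)
  qed
  moreover have "norm (G z) \<le> (1 / (N * \<rho>)) * 4" for z
  proof -
    have "norm (G z) = (1 / (N * \<rho>)) * norm (bump_grad (s z))" using N \<rho> by (simp add: G_def)
    also have "\<dots> \<le> (1 / (N * \<rho>)) * 4" using N \<rho> by (intro mult_left_mono bump_grad_bound) auto
    finally show ?thesis .
  qed
  moreover have "12 / (N * \<rho> * \<rho>) \<ge> 0" using N \<rho> by simp
  ultimately have "smooth_kernel c \<rho> k G"
    unfolding smooth_kernel_def by blast
  then show ?thesis by blast
qed

text \<open>The quadratic remainder of k, integrated against |F|, is a quadratic remainder of the
  convolution, so the derivative falls on the kernel without a limit under the integral. F is merely
  integrable and x ranges over the whole plane.\<close>

lemma smooth_kernel_conv_C1: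
  fixes F :: "real ^ 2 \<Rightarrow> 'b::euclidean_space"
  assumes k: "smooth_kernel c \<rho> k G" and F: "integrable (lebesgue_on \<Omega>) F"
  shows "\<And>x h. integrable (lebesgue_on \<Omega>) (\<lambda>y. (G (x - y) \<bullet> h) *\<^sub>R F y)"
    and "\<exists>f'. (\<forall>x. ((\<lambda>x. \<integral>y. k (x - y) *\<^sub>R F y \<partial>lebesgue_on \<Omega>) has_derivative blinfun_apply (f' x)) (at x)) \<and>
      continuous_on UNIV f' \<and>
      (\<forall>x h. blinfun_apply (f' x) h = (\<integral>y. (G (x - y) \<bullet> h) *\<^sub>R F y \<partial>lebesgue_on \<Omega>))"
proof -
  let ?M = "lebesgue_on \<Omega>"
  obtain L B where kd: "\<And>z. (k has_derivative (\<lambda>h. G z \<bullet> h)) (at z)" and kk: "kernel (norm c + \<rho>) k"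
    and L: "L \<ge> 0" "\<And>z w. norm (G z - G w) \<le> L * norm (z - w)" and B: "\<And>z. norm (G z) \<le> B"
    using k unfolding smooth_kernel_def by blast
  have B0: "B \<ge> 0" using B[of 0] norm_ge_zero order_trans by blast
  note cG = smooth_kernel_continuous_grad[OF k]
  have Gm[measurable]: "G \<in> borel_measurable borel" by (rule borel_measurable_continuous_onI[OF cG])
  show Gi: "integrable ?M (\<lambda>y. (G (x - y) \<bullet> h) *\<^sub>R F y)" for x h
  proof (rule integrable_bounded_mult[OF F])
    have "(\<lambda>y. G (x - y) \<bullet> h) \<in> borel_measurable borel" by measurable
    then show "(\<lambda>y. G (x - y) \<bullet> h) \<in> borel_measurable ?M" by (rule borel_measurable_imp_lebesgue_on)
    show "\<bar>G (x - y) \<bullet> h\<bar> \<le> B * norm h" for y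
      using Cauchy_Schwarz_ineq2[of "G (x - y)" h] mult_right_mono[OF B[of "x - y"] norm_ge_zero[of h]]
      by linarith
  qed
  have ki: "integrable ?M (\<lambda>y. k (x - y) *\<^sub>R F y)" for x
    by (rule kernel_conv_integrable[OF kk F])
  have Fn: "integrable ?M (\<lambda>y. norm (F y))" using F by (rule integrable_norm)
  define I where "I = (\<integral>y. norm (F y) \<partial>?M)"
  define D where "D x h = (\<integral>y. (G (x - y) \<bullet> h) *\<^sub>R F y \<partial>?M)" for x h
  \<comment> \<open>Every estimate below is this one for some weight a: the boundedness of
    \<open>D x\<close>, the remainder, and the Lipschitz dependence of \<open>D x\<close> on
    x.\<close>
  have bound: "norm (\<integral>y. a y *\<^sub>R F y \<partial>?M) \<le> A * I"
    if "\<And>y. \<bar>a y\<bar> \<le> A" "integrable ?M (\<lambda>y. a y *\<^sub>R F y)" for a A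
  proof -
    have "norm (\<integral>y. a y *\<^sub>R F y \<partial>?M) \<le> (\<integral>y. norm (a y *\<^sub>R F y) \<partial>?M)" by (rule integral_norm_bound)
    also have "\<dots> \<le> (\<integral>y. A * norm (F y) \<partial>?M)"
      using that Fn by (intro integral_mono integrable_norm) (auto intro: mult_right_mono)
    finally show ?thesis by (simp add: I_def)
  qed
  have Dlin: "bounded_linear (D x)" for x
  proof (rule bounded_linear_intro[where K = "B * I"])
    show "D x (h + h') = D x h + D x h'" for h h'
      unfolding D_def inner_add_right scaleR_add_left by (rule Bochner_Integration.integral_add[OF Gi Gi])
    show "D x (r *\<^sub>R h) = r *\<^sub>R D x h" for r h
      unfolding D_def by (simp flip: scaleR_scaleR)
    show "norm (D x h) \<le> norm h * (B * I)" for h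
    proof -
      have "norm (D x h) \<le> (B * norm h) * I"
        unfolding D_def
      proof (rule bound[OF _ Gi])
        show "\<bar>G (x - y) \<bullet> h\<bar> \<le> B * norm h" for y
          using Cauchy_Schwarz_ineq2[of "G (x - y)" h] mult_right_mono[OF B[of "x - y"] norm_ge_zero[of h]]
          by linarith
      qed
      then show ?thesis by (simp add: mult_ac)
    qed
  qed
  define f' where "f' x = Blinfun (D x)" for x
  have f': "blinfun_apply (f' x) = D x" for x
    unfolding f'_def by (rule bounded_linear_Blinfun_apply[OF Dlin])
  have "((\<lambda>x. \<integral>y. k (x - y) *\<^sub>R F y \<partial>?M) has_derivative D x) (at x)" for x
  proof (rule has_derivative_quadratic[OF Dlin, where C = "L * I"])
    fix z
    have "(\<integral>y. k (z - y) *\<^sub>R F y \<partial>?M) - (\<integral>y. k (x - y) *\<^sub>R F y \<partial>?M) - D x (z - x)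
      = (\<integral>y. k (z - y) *\<^sub>R F y - k (x - y) *\<^sub>R F y - (G (x - y) \<bullet> (z - x)) *\<^sub>R F y \<partial>?M)"
      unfolding D_def by (simp add: ki Gi)
    also have "\<dots> = (\<integral>y. (k (z - y) - k (x - y) - G (x - y) \<bullet> (z - x)) *\<^sub>R F y \<partial>?M)"
      by (simp only: scaleR_diff_left)
    finally have eq: "(\<integral>y. k (z - y) *\<^sub>R F y \<partial>?M) - (\<integral>y. k (x - y) *\<^sub>R F y \<partial>?M) - D x (z - x)
      = (\<integral>y. (k (z - y) - k (x - y) - G (x - y) \<bullet> (z - x)) *\<^sub>R F y \<partial>?M)" .
    have "norm (\<integral>y. (k (z - y) - k (x - y) - G (x - y) \<bullet> (z - x)) *\<^sub>R F y \<partial>?M) \<le> (L * (norm (z - x))\<^sup>2) * I"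
    proof (rule bound)
      show "\<bar>k (z - y) - k (x - y) - G (x - y) \<bullet> (z - x)\<bar> \<le> L * (norm (z - x))\<^sup>2" for y
        using quadratic_remainder[OF kd L(2,1), of "z - y" "x - y"] by simp
      show "integrable ?M (\<lambda>y. (k (z - y) - k (x - y) - G (x - y) \<bullet> (z - x)) *\<^sub>R F y)"
        unfolding scaleR_diff_left by (intro Bochner_Integration.integrable_diff ki Gi)
    qed
    then show "norm ((\<integral>y. k (z - y) *\<^sub>R F y \<partial>?M) - (\<integral>y. k (x - y) *\<^sub>R F y \<partial>?M) - D x (z - x)) \<le> L * I * (norm (z - x))\<^sup>2"
      unfolding eq by (simp add: mult_ac)
  qed
  moreover have "continuous_on UNIV f'"
  proof (rule lipschitz_on_continuous_on, rule lipschitz_onI)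
    show "0 \<le> L * I" using L(1) by (simp add: I_def)
    fix x z
    show "dist (f' x) (f' z) \<le> L * I * dist x z"
      unfolding dist_norm
    proof (rule norm_blinfun_bound)
      show "0 \<le> L * I * norm (x - z)" using L(1) by (simp add: I_def)
      fix h
      have "D x h - D z h = (\<integral>y. (G (x - y) \<bullet> h) *\<^sub>R F y - (G (z - y) \<bullet> h) *\<^sub>R F y \<partial>?M)"
        unfolding D_def by (rule Bochner_Integration.integral_diff[OF Gi Gi, symmetric])
      also have "\<dots> = (\<integral>y. ((G (x - y) - G (z - y)) \<bullet> h) *\<^sub>R F y \<partial>?M)"
        by (simp only: scaleR_diff_left inner_diff_left)
      also have "norm \<dots> \<le> (L * norm (x - z) * norm h) * I"
      proof (rule bound)
        show "\<bar>(G (x - y) - G (z - y)) \<bullet> h\<bar> \<le> L * norm (x - z) * norm h" for y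
          using Cauchy_Schwarz_ineq2[of "G (x - y) - G (z - y)" h]
            mult_right_mono[OF L(2)[of "x - y" "z - y"] norm_ge_zero[of h]] by simp
        show "integrable ?M (\<lambda>y. ((G (x - y) - G (z - y)) \<bullet> h) *\<^sub>R F y)"
          unfolding scaleR_diff_left inner_diff_left by (intro Bochner_Integration.integrable_diff Gi)
      qed
      finally show "norm (blinfun_apply (f' x - f' z) h) \<le> L * I * norm (x - z) * norm h"
        by (simp add: f' blinfun.diff_left mult_ac)
    qed
  qed
  ultimately show "\<exists>f'. (\<forall>x. ((\<lambda>x. \<integral>y. k (x - y) *\<^sub>R F y \<partial>?M) has_derivative blinfun_apply (f' x)) (at x)) \<and>
      continuous_on UNIV f' \<and>
      (\<forall>x h. blinfun_apply (f' x) h = (\<integral>y. (G (x - y) \<bullet> h) *\<^sub>R F y \<partial>?M))"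
    by (intro exI[of _ f']) (simp add: f' D_def)
qed

section \<open>Weak gradients and divergences\<close>

text \<open>Lets a mollified value at x be read as the pairing with a test function in y. Its
  support lies in the reflected ball of points \<open>x - w\<close>, hence the condition
  \<open>sub\<close>.\<close>

lemma kernel_test_C01:
  assumes k: "smooth_kernel c \<rho> k G" and sub: "\<And>w. w \<in> cball c \<rho> \<Longrightarrow> x - w \<in> \<Omega>"
  shows "(\<lambda>y. k (x - y)) \<in> C01 \<Omega>"
proof -
  have kd: "\<And>z. (k has_derivative (\<lambda>h. G z \<bullet> h)) (at z)"
    and ks: "\<And>z. k z \<noteq> 0 \<Longrightarrow> z \<in> cball c \<rho>"
    using k unfolding smooth_kernel_def by blast+
  note cG = smooth_kernel_continuous_grad[OF k]
  show ?thesis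
  proof (rule C01I)
    show "compact ((\<lambda>w. x - w) ` cball c \<rho>)"
      by (intro compact_continuous_image continuous_intros compact_cball)
    show "(\<lambda>w. x - w) ` cball c \<rho> \<subseteq> \<Omega>" using sub by blast
    show "k (x - y) = 0" if "y \<notin> (\<lambda>w. x - w) ` cball c \<rho>" for y
    proof (rule ccontr)
      assume "k (x - y) \<noteq> 0"
      then have "x - y \<in> cball c \<rho>" by (rule ks)
      then have "x - (x - y) \<in> (\<lambda>w. x - w) ` cball c \<rho>" by (rule imageI)
      with that show False by simp
    qed
    show "((\<lambda>y. k (x - y)) has_derivative blinfun_apply (blinfun_inner_left (- G (x - y)))) (at y)" for y
    proof -
      have "((\<lambda>y. x - y) has_derivative (\<lambda>h. - h)) (at y)" by (auto intro!: derivative_eq_intros)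
      from has_derivative_compose[OF this kd]
      show ?thesis by (simp add: inner_commute)
    qed
    show "continuous_on \<Omega> (\<lambda>y. blinfun_inner_left (- G (x - y)))"
      by (intro bounded_linear.continuous_on[OF bounded_linear_blinfun_inner_left] continuous_on_minus
          continuous_on_compose2[OF cG]) (auto intro!: continuous_intros)
  qed
qed

text \<open>On a compact S and for small radii, the mollified g at x in S is g paired with a test
  function, hence 0. Paired with v, the cut-off of g to S, the mollified g tends to the norm square
  of v, which is therefore 0.\<close>

lemma C01_fundamental_lemma:
  fixes g :: "real ^ 2 \<Rightarrow> real"
  assumes \<Omega>: "open \<Omega>" "bounded \<Omega>" and g: "g \<in> L2 \<Omega>"
    and 0: "\<And>\<psi>. \<psi> \<in> C01 \<Omega> \<Longrightarrow> (\<integral>x. \<psi> x * g x \<partial>lebesgue_on \<Omega>) = 0"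
  shows "AE x in lebesgue_on \<Omega>. g x = 0"
proof -
  let ?M = "lebesgue_on \<Omega>"
  define r where "r n = inverse (real (Suc n))" for n
  have r: "r n > 0" for n by (simp add: r_def)
  have r0: "r \<longlonglongrightarrow> 0" unfolding r_def by (rule LIMSEQ_inverse_real_of_nat)
  have "\<exists>k G. smooth_kernel 0 (r n) k G" for n by (rule smooth_kernel_exists[OF r])
  then obtain k G where k: "\<And>n. smooth_kernel 0 (r n) (k n) (G n)" by metis
  have kk: "kernel (r n) (k n)" for n using k[of n] by (simp add: smooth_kernel_def)
  have loc: "AE x in ?M. x \<in> S \<longrightarrow> g x = 0" if S: "compact S" "S \<subseteq> \<Omega>" for S
  proof -
    obtain d where d: "d > 0" "(\<Union>x\<in>S. cball x d) \<subseteq> \<Omega>"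
      by (rule compact_subset_open_imp_cball_epsilon_subset[OF S(1) \<Omega>(1) S(2)])
    define v where "v x = indicator S x * g x" for x
    have "S \<in> sets lebesgue" using S(1) by (simp add: lmeasurable_compact fmeasurableD)
    then have im: "(indicator S :: real ^ 2 \<Rightarrow> real) \<in> borel_measurable ?M"
      by (intro measurable_restrict_space1) simp
    have v: "v \<in> L2 \<Omega>"
    proof (rule L2_bounded_mult[OF g, where B = 1])
      show "v \<in> borel_measurable ?M"
        unfolding v_def[abs_def] by (intro borel_measurable_times im L2_measurable[OF g])
    qed (simp add: v_def indicator_def)
    have "\<forall>\<^sub>F n in sequentially. r n < d" using order_tendstoD(2)[OF r0 d(1)] .
    then have "\<forall>\<^sub>F n in sequentially. (\<integral>x. v x * (\<integral>y. k n (x - y) * g y \<partial>?M) \<partial>?M) = 0"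
    proof eventually_elim
      fix n assume n: "r n < d"
      have "v x * (\<integral>y. k n (x - y) * g y \<partial>?M) = 0" for x
      proof (cases "x \<in> S")
        case True
        have "x - w \<in> \<Omega>" if "w \<in> cball 0 (r n)" for w
        proof -
          have "x - w \<in> cball x d" using that n by (simp add: dist_norm)
          then show ?thesis using d(2) True by blast
        qed
        then show ?thesis using 0[OF kernel_test_C01[OF k]] by simp
      qed (simp add: v_def)
      then have "(\<lambda>x. v x * (\<integral>y. k n (x - y) * g y \<partial>?M)) = (\<lambda>x. 0)" by (rule ext)
      then show "(\<integral>x. v x * (\<integral>y. k n (x - y) * g y \<partial>?M) \<partial>?M) = 0"
        by (simp only: integral_zero)
    qed
    then have "(\<lambda>n. \<integral>x. v x * (\<integral>y. k n (x - y) * g y \<partial>?M) \<partial>?M) \<longlonglongrightarrow> 0"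
      by (rule tendsto_eventually)
    then have "L2_inner \<Omega> v g = 0"
      using kernel_form_tendsto[OF kk r0 \<Omega> v g] by (rule LIMSEQ_unique[rotated])
    moreover have "L2_inner \<Omega> v v = L2_inner \<Omega> v g"
      unfolding L2_inner_def by (intro Bochner_Integration.integral_cong) (auto simp: v_def indicator_def)
    ultimately have "AE x in ?M. v x = 0" by (intro L2_inner_self_eq_0[OF v]) simp
    then show ?thesis by eventually_elim (simp add: v_def indicator_def split: if_splits)
  qed
  \<comment> \<open>A countable exhaustion, so that the exceptional null sets can be united.\<close>
  obtain C :: "nat \<Rightarrow> (real ^ 2) set" where C: "\<And>n. compact (C n)" "\<And>n. C n \<subseteq> \<Omega>"
      "\<And>n. C n \<subseteq> interior (C (Suc n))" "\<Union>(range C) = \<Omega>"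
      "\<And>K. \<lbrakk>compact K; K \<subseteq> \<Omega>\<rbrakk> \<Longrightarrow> \<exists>N. \<forall>n\<ge>N. K \<subseteq> C n"
    by (rule open_Union_compact_subsets[OF \<Omega>(1)]) (rule that)
  have "AE x in ?M. \<forall>n. x \<in> C n \<longrightarrow> g x = 0"
    unfolding AE_all_countable by (intro allI loc C(1,2))
  then show ?thesis
    using AE_space
  proof eventually_elim
    case (elim x)
    then have "x \<in> \<Union>(range C)" using C(4) by (simp add: space_restrict_space)
    then obtain n where "x \<in> C n" by auto
    then show ?case using elim(1) by blast
  qed
qed

lemma C01_bounded:
  fixes f :: "real ^ 2 \<Rightarrow> 'b::euclidean_space"
  assumes f: "f \<in> C01 \<Omega>" and \<Omega>: "open \<Omega>"
  obtains B where "B \<ge> 0" "\<And>x. norm (f x) \<le> B"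
proof -
  obtain f' S where "\<And>x. (f has_derivative blinfun_apply (f' x)) (at x)" "continuous_on UNIV f'"
    and S: "compact S" and "S \<subseteq> \<Omega>" and S0: "\<And>x. x \<notin> S \<Longrightarrow> f x = 0" and "\<And>x. x \<notin> S \<Longrightarrow> f' x = 0"
    by (rule C01E[OF f \<Omega>]) (rule that)
  show thesis
    by (rule bounded_range_compact_support[OF C01_continuous[OF f \<Omega>] S]) (rule S0, assumption, rule that)
qed

lemma C01_fundamental_lemma_vec:
  fixes g :: "real ^ 2 \<Rightarrow> 'b::euclidean_space"
  assumes \<Omega>: "open \<Omega>" "bounded \<Omega>" and g: "g \<in> L2 \<Omega>"
    and 0: "\<And>\<psi>. \<psi> \<in> C01 \<Omega> \<Longrightarrow> (\<integral>x. \<psi> x *\<^sub>R g x \<partial>lebesgue_on \<Omega>) = 0"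
  shows "AE x in lebesgue_on \<Omega>. g x = 0"
proof -
  have "AE x in lebesgue_on \<Omega>. g x \<bullet> b = 0" if "b \<in> Basis" for b
  proof (rule C01_fundamental_lemma[OF \<Omega>])
    show "(\<lambda>x. g x \<bullet> b) \<in> L2 \<Omega>"
      by (rule L2_bounded_linear[OF bounded_linear_inner_left g])
    fix \<psi> :: "real ^ 2 \<Rightarrow> real" assume \<psi>: "\<psi> \<in> C01 \<Omega>"
    obtain B where "B \<ge> 0" and B: "\<And>x. norm (\<psi> x) \<le> B"
      by (rule C01_bounded[OF \<psi> \<Omega>(1)]) (rule that)
    have "integrable (lebesgue_on \<Omega>) (\<lambda>x. \<psi> x *\<^sub>R g x)"
      by (rule integrable_bounded_mult[OF L2_integrable[OF \<Omega> g], where B = B])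
        (use B in \<open>auto intro!: borel_measurable_imp_lebesgue_on borel_measurable_continuous_onI C01_continuous[OF \<psi> \<Omega>(1)]\<close>)
    then have "(\<integral>x. (\<psi> x *\<^sub>R g x) \<bullet> b \<partial>lebesgue_on \<Omega>) = (\<integral>x. \<psi> x *\<^sub>R g x \<partial>lebesgue_on \<Omega>) \<bullet> b"
      by (intro integral_inner_left) simp
    then show "(\<integral>x. \<psi> x * (g x \<bullet> b) \<partial>lebesgue_on \<Omega>) = 0"
      using 0[OF \<psi>] by simp
  qed
  then have "AE x in lebesgue_on \<Omega>. \<forall>b\<in>Basis. g x \<bullet> b = 0"
    by (intro AE_finite_allI) auto
  then show ?thesis by eventually_elim (auto intro: euclidean_eqI)
qed

lemma C01_grad_bounded:
  assumes f: "f \<in> C01 \<Omega>" and \<Omega>: "open \<Omega>"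
  obtains B where "B \<ge> 0" "\<And>x. norm (grad f x) \<le> B"
proof -
  obtain S where "\<And>x. (f has_derivative (\<lambda>h. grad f x \<bullet> h)) (at x)" and cg: "continuous_on UNIV (grad f)"
    and S: "compact S" and "S \<subseteq> \<Omega>" and "\<And>x. x \<notin> S \<Longrightarrow> f x = 0"
    and S0: "\<And>x. x \<notin> S \<Longrightarrow> grad f x = 0" and "integral\<^sup>L lborel (grad f) = 0"
    by (rule C01_real_gradE[OF f \<Omega>]) (rule that)
  show thesis
    by (rule bounded_range_compact_support[OF cg S]) (rule S0, assumption, rule that)
qed

lemma C01_grad_continuous:
  assumes f: "f \<in> C01 \<Omega>" and \<Omega>: "open \<Omega>"
  shows "continuous_on UNIV (grad f)" "\<And>x. (f has_derivative (\<lambda>h. grad f x \<bullet> h)) (at x)"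
    "(\<integral>x. grad f x \<partial>lebesgue_on \<Omega>) = 0"
proof -
  obtain S where d: "\<And>x. (f has_derivative (\<lambda>h. grad f x \<bullet> h)) (at x)" and cg: "continuous_on UNIV (grad f)"
    and "compact S" and S: "S \<subseteq> \<Omega>" and "\<And>x. x \<notin> S \<Longrightarrow> f x = 0"
    and S0: "\<And>x. x \<notin> S \<Longrightarrow> grad f x = 0" and I: "integral\<^sup>L lborel (grad f) = 0"
    by (rule C01_real_gradE[OF f \<Omega>]) (rule that)
  show "continuous_on UNIV (grad f)" "\<And>x. (f has_derivative (\<lambda>h. grad f x \<bullet> h)) (at x)" by fact+
  have "(\<integral>x. grad f x \<partial>lebesgue_on \<Omega>) = integral\<^sup>L lborel (grad f)"
  proof (rule integral_lebesgue_on_eq_lborel)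
    show "\<Omega> \<in> sets lebesgue" using \<Omega> by simp
    show "grad f \<in> borel_measurable borel" by (rule borel_measurable_continuous_onI[OF cg])
    show "grad f x = 0" if "x \<notin> \<Omega>" for x using S S0 that by blast
  qed
  with I show "(\<integral>x. grad f x \<partial>lebesgue_on \<Omega>) = 0" by simp
qed

lemma C01_L2:
  fixes f :: "real ^ 2 \<Rightarrow> 'b::euclidean_space"
  assumes f: "f \<in> C01 \<Omega>" and \<Omega>: "open \<Omega>" "bounded \<Omega>"
  shows "f \<in> L2 \<Omega>"
proof -
  obtain B where "B \<ge> 0" and B: "\<And>x. norm (f x) \<le> B"
    by (rule C01_bounded[OF f \<Omega>(1)]) (rule that)
  show ?thesis
    by (rule L2_bounded[OF \<Omega> _ B]) (intro borel_measurable_imp_lebesgue_on borel_measurable_continuous_onI C01_continuous[OF f \<Omega>(1)])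
qed

lemma C01_grad_L2:
  assumes f: "f \<in> C01 \<Omega>" and \<Omega>: "open \<Omega>" "bounded \<Omega>"
  shows "grad f \<in> L2 \<Omega>"
proof -
  obtain B where "B \<ge> 0" and B: "\<And>x. norm (grad f x) \<le> B"
    by (rule C01_grad_bounded[OF f \<Omega>(1)]) (rule that)
  show ?thesis
    by (rule L2_bounded[OF \<Omega> _ B]) (intro borel_measurable_imp_lebesgue_on borel_measurable_continuous_onI C01_grad_continuous[OF f \<Omega>(1)])
qed

text \<open>The product of \<phi> with a test function has compact support, so its gradient has mean
  zero. No boundary values are imposed: such \<phi> lie in \<open>H1\<close> but in general not in
  \<open>H01\<close>, and the mollification argument needs exactly these.\<close>

lemma has_weak_grad_classical:
  assumes \<Omega>: "open \<Omega>" "bounded \<Omega>"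
    and d: "\<And>x. x \<in> \<Omega> \<Longrightarrow> (\<phi> has_derivative (\<lambda>h. g x \<bullet> h)) (at x)" and c: "continuous_on \<Omega> g"
    and b\<phi>: "\<And>x. x \<in> \<Omega> \<Longrightarrow> \<bar>\<phi> x\<bar> \<le> B" and bg: "\<And>x. x \<in> \<Omega> \<Longrightarrow> norm (g x) \<le> C"
  shows "\<phi> \<in> L2 \<Omega>" "has_weak_grad \<Omega> \<phi> g"
proof -
  have \<Omega>m: "\<Omega> \<in> sets lebesgue" using \<Omega>(1) by simp
  have c\<phi>: "continuous_on \<Omega> \<phi>"
    using has_derivative_continuous[OF d] by (simp add: continuous_at_imp_continuous_on)
  show \<phi>: "\<phi> \<in> L2 \<Omega>"
    by (rule L2_bounded[OF \<Omega> continuous_imp_measurable_on_sets_lebesgue[OF c\<phi> \<Omega>m], of B]) (simp add: b\<phi>)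
  have g: "g \<in> L2 \<Omega>"
    by (rule L2_bounded[OF \<Omega> continuous_imp_measurable_on_sets_lebesgue[OF c \<Omega>m] bg])
  show "has_weak_grad \<Omega> \<phi> g"
    unfolding has_weak_grad_def
  proof (intro conjI ballI g)
    fix \<psi> :: "real ^ 2 \<Rightarrow> real" assume \<psi>: "\<psi> \<in> C01 \<Omega>"
    note p = C01_product[OF \<psi> \<Omega>(1) d c]
    obtain B\<psi> where "B\<psi> \<ge> 0" and B\<psi>: "\<And>x. norm (\<psi> x) \<le> B\<psi>"
      by (rule C01_bounded[OF \<psi> \<Omega>(1)]) (rule that)
    have "(\<integral>x. \<phi> x *\<^sub>R grad \<psi> x + \<psi> x *\<^sub>R g x \<partial>lebesgue_on \<Omega>) = (\<integral>x. grad (\<lambda>x. \<phi> x * \<psi> x) x \<partial>lebesgue_on \<Omega>)"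
      by (intro Bochner_Integration.integral_cong) (simp_all add: p(2) space_restrict_space)
    also have "\<dots> = 0" by (rule C01_grad_continuous(3)[OF p(1) \<Omega>(1)])
    finally have "(\<integral>x. \<phi> x *\<^sub>R grad \<psi> x + \<psi> x *\<^sub>R g x \<partial>lebesgue_on \<Omega>) = 0" .
    moreover have "integrable (lebesgue_on \<Omega>) (\<lambda>x. \<phi> x *\<^sub>R grad \<psi> x)"
    proof (rule integrable_bounded_mult)
      show "integrable (lebesgue_on \<Omega>) (grad \<psi>)" by (rule L2_integrable[OF \<Omega> C01_grad_L2[OF \<psi> \<Omega>]])
    qed (use b\<phi> L2_measurable[OF \<phi>] in \<open>auto simp: space_restrict_space\<close>)
    moreover have "integrable (lebesgue_on \<Omega>) (\<lambda>x. \<psi> x *\<^sub>R g x)"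
    proof (rule integrable_bounded_mult)
      show "integrable (lebesgue_on \<Omega>) g" by (rule L2_integrable[OF \<Omega> g])
    qed (use B\<psi> L2_measurable[OF C01_L2[OF \<psi> \<Omega>]] in auto)
    ultimately show "(\<integral>x. \<phi> x *\<^sub>R grad \<psi> x \<partial>lebesgue_on \<Omega>) = - (\<integral>x. \<psi> x *\<^sub>R g x \<partial>lebesgue_on \<Omega>)"
      by (simp add: eq_neg_iff_add_eq_0)
  qed
qed

text \<open>\<open>weak_grad\<close> is an arbitrary choice; this ties it almost everywhere to any
  gradient computed by hand.\<close>

lemma has_weak_grad_unique:
  assumes \<Omega>: "open \<Omega>" "bounded \<Omega>" and g: "has_weak_grad \<Omega> \<phi> g" and g': "has_weak_grad \<Omega> \<phi> g'"
  shows "AE x in lebesgue_on \<Omega>. g x = g' x"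
proof -
  have L: "g \<in> L2 \<Omega>" "g' \<in> L2 \<Omega>" using g g' by (auto simp: has_weak_grad_def)
  have "AE x in lebesgue_on \<Omega>. g x - g' x = 0"
  proof (rule C01_fundamental_lemma_vec[OF \<Omega> L2_diff[OF L]])
    fix \<psi> :: "real ^ 2 \<Rightarrow> real" assume \<psi>: "\<psi> \<in> C01 \<Omega>"
    obtain B where "B \<ge> 0" and B: "\<And>x. norm (\<psi> x) \<le> B"
      by (rule C01_bounded[OF \<psi> \<Omega>(1)]) (rule that)
    have i: "integrable (lebesgue_on \<Omega>) (\<lambda>x. \<psi> x *\<^sub>R f x)" if "f \<in> L2 \<Omega>" for f :: "real ^ 2 \<Rightarrow> real ^ 2"
      by (rule integrable_bounded_mult[OF L2_integrable[OF \<Omega> that] L2_measurable[OF C01_L2[OF \<psi> \<Omega>]], where B = B])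
        (use B in simp)
    have "(\<integral>x. \<phi> x *\<^sub>R grad \<psi> x \<partial>lebesgue_on \<Omega>) = - (\<integral>x. \<psi> x *\<^sub>R g x \<partial>lebesgue_on \<Omega>)"
      "(\<integral>x. \<phi> x *\<^sub>R grad \<psi> x \<partial>lebesgue_on \<Omega>) = - (\<integral>x. \<psi> x *\<^sub>R g' x \<partial>lebesgue_on \<Omega>)"
      using g g' \<psi> unfolding has_weak_grad_def by simp_all
    then have "(\<integral>x. \<psi> x *\<^sub>R g x \<partial>lebesgue_on \<Omega>) = (\<integral>x. \<psi> x *\<^sub>R g' x \<partial>lebesgue_on \<Omega>)"
      by simp
    then show "(\<integral>x. \<psi> x *\<^sub>R (g x - g' x) \<partial>lebesgue_on \<Omega>) = 0"
      using i[OF L(1)] i[OF L(2)] by (simp add: scaleR_diff_right)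
  qed
  then show ?thesis by eventually_elim simp
qed

lemma has_weak_grad_weak_grad:
  assumes "\<phi> \<in> H1 \<Omega>"
  shows "has_weak_grad \<Omega> \<phi> (weak_grad \<Omega> \<phi>)" "weak_grad \<Omega> \<phi> \<in> L2 \<Omega>" "\<phi> \<in> L2 \<Omega>"
proof -
  show 1: "has_weak_grad \<Omega> \<phi> (weak_grad \<Omega> \<phi>)"
    using assms unfolding H1_def weak_grad_def by (intro someI_ex[of "has_weak_grad \<Omega> \<phi>"]) blast
  then show "weak_grad \<Omega> \<phi> \<in> L2 \<Omega>" by (simp add: has_weak_grad_def)
  show "\<phi> \<in> L2 \<Omega>" using assms by (simp add: H1_def)
qed

lemma H01_subset_H1: "H01 \<Omega> \<subseteq> H1 \<Omega>"
  by (auto simp: H01_def)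

lemma C01_subset_H01:
  assumes \<Omega>: "open \<Omega>" "bounded \<Omega>"
  shows "C01 \<Omega> \<subseteq> H01 \<Omega>"
proof
  fix \<phi> :: "real ^ 2 \<Rightarrow> real" assume \<phi>: "\<phi> \<in> C01 \<Omega>"
  obtain B where "B \<ge> 0" and B: "\<And>x. norm (\<phi> x) \<le> B"
    by (rule C01_bounded[OF \<phi> \<Omega>(1)]) (rule that)
  obtain C where "C \<ge> 0" and C: "\<And>x. norm (grad \<phi> x) \<le> C"
    by (rule C01_grad_bounded[OF \<phi> \<Omega>(1)]) (rule that)
  have w: "has_weak_grad \<Omega> \<phi> (grad \<phi>)"
    by (rule has_weak_grad_classical[OF \<Omega> C01_grad_continuous(2)[OF \<phi> \<Omega>(1)]
          continuous_on_subset[OF C01_grad_continuous(1)[OF \<phi> \<Omega>(1)] subset_UNIV], of B C])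
      (use B C in auto)
  have H1: "\<phi> \<in> H1 \<Omega>" using w C01_L2[OF \<phi> \<Omega>] by (auto simp: H1_def)
  have ae: "AE x in lebesgue_on \<Omega>. grad \<phi> x = weak_grad \<Omega> \<phi> x"
    by (rule has_weak_grad_unique[OF \<Omega> w has_weak_grad_weak_grad(1)[OF H1]])
  have "L2_inner \<Omega> (\<lambda>x. grad \<phi> x - weak_grad \<Omega> \<phi> x) (\<lambda>x. grad \<phi> x - weak_grad \<Omega> \<phi> x) = L2_inner \<Omega> (\<lambda>x. 0 :: real ^ 2) (\<lambda>x. 0)"
  proof (rule L2_inner_cong_AE)
    show "AE x in lebesgue_on \<Omega>. grad \<phi> x - weak_grad \<Omega> \<phi> x = 0"
      "AE x in lebesgue_on \<Omega>. grad \<phi> x - weak_grad \<Omega> \<phi> x = 0"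
      using ae by (eventually_elim, simp)+
  qed (intro L2_diff L2_zero C01_grad_L2[OF \<phi> \<Omega>] has_weak_grad_weak_grad(2)[OF H1])+
  then have "L2_norm \<Omega> (\<lambda>x. grad \<phi> x - weak_grad \<Omega> \<phi> x) = 0" by (simp add: L2_norm_def L2_inner_def)
  moreover have "L2_norm \<Omega> (\<lambda>x. \<phi> x - \<phi> x) = 0" by (simp add: L2_norm_def L2_inner_def)
  ultimately show "\<phi> \<in> H01 \<Omega>"
    unfolding H01_def using H1 \<phi> by (auto intro!: exI[of _ "\<lambda>n. \<phi>"])
qed

text \<open>Test functions lie in \<open>H01\<close>, so two representatives of the divergence have
  equal pairings with all of them and the fundamental lemma applies.\<close>

lemma has_L2_div_unique:
  assumes \<Omega>: "open \<Omega>" "bounded \<Omega>" and d: "has_L2_div \<Omega> q d" and d': "has_L2_div \<Omega> q d'"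
  shows "AE x in lebesgue_on \<Omega>. d x = d' x"
proof -
  have L: "d \<in> L2 \<Omega>" "d' \<in> L2 \<Omega>" using d d' by (auto simp: has_L2_div_def)
  have "AE x in lebesgue_on \<Omega>. d x - d' x = 0"
  proof (rule C01_fundamental_lemma[OF \<Omega> L2_diff[OF L]])
    fix \<psi> :: "real ^ 2 \<Rightarrow> real" assume \<psi>: "\<psi> \<in> C01 \<Omega>"
    then have "\<psi> \<in> H01 \<Omega>" using C01_subset_H01[OF \<Omega>] by blast
    then have "L2_inner \<Omega> d \<psi> = L2_inner \<Omega> d' \<psi>" using d d' by (simp add: has_L2_div_def)
    then have "L2_inner \<Omega> (\<lambda>x. d x - d' x) \<psi> = 0"
      using L2_inner_diff_left[OF L C01_L2[OF \<psi> \<Omega>]] by simp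
    then show "(\<integral>x. \<psi> x * (d x - d' x) \<partial>lebesgue_on \<Omega>) = 0"
      by (simp add: L2_inner_def mult.commute)
  qed
  then show ?thesis by eventually_elim simp
qed

section \<open>Algebra of test fields and their classical divergence\<close>

lemma C01_linear:
  fixes f :: "real ^ 2 \<Rightarrow> 'b::euclidean_space" and T :: "'b \<Rightarrow> 'c::euclidean_space"
  assumes T: "bounded_linear T" and f: "f \<in> C01 \<Omega>" and \<Omega>: "open \<Omega>"
  shows "(\<lambda>x. T (f x)) \<in> C01 \<Omega>"
proof -
  obtain f' S where d: "\<And>x. (f has_derivative blinfun_apply (f' x)) (at x)" and c: "continuous_on UNIV f'"
    and S: "compact S" "S \<subseteq> \<Omega>" and S0: "\<And>x. x \<notin> S \<Longrightarrow> f x = 0" and "\<And>x. x \<notin> S \<Longrightarrow> f' x = 0"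
    by (rule C01E[OF f \<Omega>]) (rule that)
  show ?thesis
  proof (rule C01I[OF S])
    show "T (f x) = 0" if "x \<notin> S" for x
      using S0[OF that] T by (simp add: linear_0 bounded_linear.linear)
    show "((\<lambda>x. T (f x)) has_derivative blinfun_apply (Blinfun T o\<^sub>L f' x)) (at x)" for x
    proof -
      have "blinfun_apply (Blinfun T o\<^sub>L f' x) = (\<lambda>h. T (blinfun_apply (f' x) h))"
        by (rule ext) (simp add: bounded_linear_Blinfun_apply[OF T])
      then show ?thesis using bounded_linear.has_derivative[OF T d[of x]] by simp
    qed
    have "continuous_on UNIV (\<lambda>x. Blinfun T o\<^sub>L f' x)" by (intro continuous_intros c)
    then show "continuous_on \<Omega> (\<lambda>x. Blinfun T o\<^sub>L f' x)" by (rule continuous_on_subset) simp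
  qed
qed

lemma C01_add:
  fixes f g :: "real ^ 2 \<Rightarrow> 'b::euclidean_space"
  assumes f: "f \<in> C01 \<Omega>" and g: "g \<in> C01 \<Omega>" and \<Omega>: "open \<Omega>"
  shows "(\<lambda>x. f x + g x) \<in> C01 \<Omega>"
proof -
  obtain f' S where d: "\<And>x. (f has_derivative blinfun_apply (f' x)) (at x)" and c: "continuous_on UNIV f'"
    and S: "compact S" "S \<subseteq> \<Omega>" and S0: "\<And>x. x \<notin> S \<Longrightarrow> f x = 0" and "\<And>x. x \<notin> S \<Longrightarrow> f' x = 0"
    by (rule C01E[OF f \<Omega>]) (rule that)
  obtain g' R where e: "\<And>x. (g has_derivative blinfun_apply (g' x)) (at x)" and c': "continuous_on UNIV g'"
    and R: "compact R" "R \<subseteq> \<Omega>" and R0: "\<And>x. x \<notin> R \<Longrightarrow> g x = 0" and "\<And>x. x \<notin> R \<Longrightarrow> g' x = 0"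
    by (rule C01E[OF g \<Omega>]) (rule that)
  show ?thesis
  proof (rule C01I)
    show "compact (S \<union> R)" "S \<union> R \<subseteq> \<Omega>" using S R by auto
    show "f x + g x = 0" if "x \<notin> S \<union> R" for x
      using S0[of x] R0[of x] that by simp
    show "((\<lambda>x. f x + g x) has_derivative blinfun_apply (f' x + g' x)) (at x)" for x
    proof -
      have "blinfun_apply (f' x + g' x) = (\<lambda>h. blinfun_apply (f' x) h + blinfun_apply (g' x) h)"
        by (rule ext) (rule blinfun.add_left)
      then show ?thesis using has_derivative_add[OF d[of x] e[of x]] by simp
    qed
    have "continuous_on UNIV (\<lambda>x. f' x + g' x)" by (intro continuous_intros c c')
    then show "continuous_on \<Omega> (\<lambda>x. f' x + g' x)" by (rule continuous_on_subset) simp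
  qed
qed

lemma C01_zero: "(\<lambda>x. 0) \<in> C01 \<Omega>"
  by (rule C01I[of "{}" _ _ "\<lambda>x. 0"]) (auto simp: zero_blinfun.rep_eq)

lemma C01_sum:
  fixes f :: "'i \<Rightarrow> real ^ 2 \<Rightarrow> 'b::euclidean_space"
  assumes "\<And>i. i \<in> I \<Longrightarrow> f i \<in> C01 \<Omega>" and \<Omega>: "open \<Omega>"
  shows "(\<lambda>x. \<Sum>i\<in>I. f i x) \<in> C01 \<Omega>"
  using assms(1)
proof (induction I rule: infinite_finite_induct)
  case (insert i I)
  then show ?case using C01_add[OF _ _ \<Omega>, of "f i" "\<lambda>x. \<Sum>i\<in>I. f i x"] by simp
qed (auto simp: C01_zero)

lemma C01_scaleR:
  fixes f :: "real ^ 2 \<Rightarrow> 'b::euclidean_space"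
  shows "f \<in> C01 \<Omega> \<Longrightarrow> open \<Omega> \<Longrightarrow> (\<lambda>x. a *\<^sub>R f x) \<in> C01 \<Omega>"
  by (rule C01_linear[OF bounded_linear_scaleR_right])

lemma bounded_linear_column: "bounded_linear (column i :: real ^ 'c ^ 2 \<Rightarrow> real ^ 2)"
  by (rule linear_conv_bounded_linear[THEN iffD1], rule linearI) (simp_all add: column_def vec_eq_iff)

lemma C01_has_frechet_derivative:
  fixes q :: "real ^ 2 \<Rightarrow> 'b::euclidean_space"
  assumes "q \<in> C01 \<Omega>" "open \<Omega>"
  shows "(q has_derivative frechet_derivative q (at x)) (at x)"
proof -
  obtain f' S where d: "\<And>x. (q has_derivative blinfun_apply (f' x)) (at x)" and "continuous_on UNIV f'"
    and "compact S" "S \<subseteq> \<Omega>" and "\<And>x. x \<notin> S \<Longrightarrow> q x = 0" and "\<And>x. x \<notin> S \<Longrightarrow> f' x = 0"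
    by (rule C01E[OF assms]) (rule that)
  show ?thesis using d[of x] frechet_derivative_works differentiableI by blast
qed

lemma dvg_eq_sum_grad:
  fixes q :: "real ^ 2 \<Rightarrow> real ^ 2"
  assumes "q \<in> C01 \<Omega>" "open \<Omega>"
  shows "dvg q x = (\<Sum>i\<in>UNIV. grad (\<lambda>y. q y $ i) x $ i)"
proof -
  have "frechet_derivative (\<lambda>y. q y $ i) (at x) = (\<lambda>h. frechet_derivative q (at x) h $ i)" for i
    by (rule frechet_derivative_at[symmetric])
      (rule bounded_linear.has_derivative[OF bounded_linear_vec_nth C01_has_frechet_derivative[OF assms]])
  then show ?thesis by (simp add: dvg_def grad_def)
qed

text \<open>The components of q act as the test functions in the definition of the weak gradient of
  \<phi>. Hence \<phi> need not vanish on the boundary, and the absence of a boundary term will say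
  that the normal trace of q is zero.\<close>

lemma C01_integration_by_parts:
  fixes q :: "real ^ 2 \<Rightarrow> real ^ 2"
  assumes \<Omega>: "open \<Omega>" "bounded \<Omega>" and q: "q \<in> C01 \<Omega>"
  shows "dvg q \<in> L2 \<Omega>"
    and "\<phi> \<in> L2 \<Omega> \<Longrightarrow> has_weak_grad \<Omega> \<phi> g \<Longrightarrow> L2_inner \<Omega> q g = - L2_inner \<Omega> (dvg q) \<phi>"
proof -
  let ?M = "lebesgue_on \<Omega>"
  define \<psi> where "\<psi> i y = q y $ i" for i y
  have \<psi>: "\<psi> i \<in> C01 \<Omega>" for i
    unfolding \<psi>_def[abs_def] by (rule C01_linear[OF bounded_linear_vec_nth q \<Omega>(1)])
  have dv: "dvg q = (\<lambda>x. \<Sum>i\<in>UNIV. grad (\<psi> i) x $ i)"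
    unfolding \<psi>_def[abs_def] by (rule ext) (rule dvg_eq_sum_grad[OF q \<Omega>(1)])
  have gL: "(\<lambda>x. grad (\<psi> i) x $ i) \<in> L2 \<Omega>" for i
    by (rule L2_component[OF C01_grad_L2[OF \<psi> \<Omega>]])
  show "dvg q \<in> L2 \<Omega>" unfolding dv by (rule L2_sum[OF gL])
  assume \<phi>: "\<phi> \<in> L2 \<Omega>" and g: "has_weak_grad \<Omega> \<phi> g"
  have g2: "g \<in> L2 \<Omega>" using g by (simp add: has_weak_grad_def)
  have gi: "(\<lambda>x. g x $ i) \<in> L2 \<Omega>" for i by (rule L2_component[OF g2])
  have parts: "L2_inner \<Omega> (\<psi> i) (\<lambda>x. g x $ i) = - L2_inner \<Omega> (\<lambda>x. grad (\<psi> i) x $ i) \<phi>" for i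
  proof -
    obtain B where "B \<ge> 0" and B: "\<And>x. norm (grad (\<psi> i) x) \<le> B"
      by (rule C01_grad_bounded[OF \<psi>[of i] \<Omega>(1)]) (rule that)
    obtain C where "C \<ge> 0" and C: "\<And>x. norm (\<psi> i x) \<le> C"
      by (rule C01_bounded[OF \<psi>[of i] \<Omega>(1)]) (rule that)
    have i1: "integrable ?M (\<lambda>x. \<phi> x *\<^sub>R grad (\<psi> i) x)"
    proof (rule L2_integrable[OF \<Omega> L2_bounded_mult[OF \<phi>, where B = B]])
      show "(\<lambda>x. \<phi> x *\<^sub>R grad (\<psi> i) x) \<in> borel_measurable ?M"
        by (intro borel_measurable_scaleR L2_measurable[OF \<phi>] L2_measurable[OF C01_grad_L2[OF \<psi> \<Omega>]])
    qed (use B in \<open>simp add: mult.commute[of B] mult_left_mono\<close>)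
    have i2: "integrable ?M (\<lambda>x. \<psi> i x *\<^sub>R g x)"
      by (rule integrable_bounded_mult[OF L2_integrable[OF \<Omega> g2] L2_measurable[OF C01_L2[OF \<psi> \<Omega>]], where B = C])
        (use C in simp)
    have "(\<integral>x. \<phi> x *\<^sub>R grad (\<psi> i) x \<partial>?M) = - (\<integral>x. \<psi> i x *\<^sub>R g x \<partial>?M)"
      using g \<psi>[of i] unfolding has_weak_grad_def by simp
    then have "(\<integral>x. \<phi> x *\<^sub>R grad (\<psi> i) x \<partial>?M) \<bullet> axis i 1 = - ((\<integral>x. \<psi> i x *\<^sub>R g x \<partial>?M) \<bullet> axis i 1)"
      by simp
    moreover have "(\<integral>x. \<phi> x *\<^sub>R grad (\<psi> i) x \<partial>?M) \<bullet> axis i 1 = (\<integral>x. (\<phi> x *\<^sub>R grad (\<psi> i) x) \<bullet> axis i 1 \<partial>?M)"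
      by (rule integral_inner_left[symmetric]) (rule i1)
    moreover have "(\<integral>x. \<psi> i x *\<^sub>R g x \<partial>?M) \<bullet> axis i 1 = (\<integral>x. (\<psi> i x *\<^sub>R g x) \<bullet> axis i 1 \<partial>?M)"
      by (rule integral_inner_left[symmetric]) (rule i2)
    ultimately show ?thesis
      unfolding L2_inner_def cart_eq_inner_axis by (simp add: mult.commute)
  qed
  have "L2_inner \<Omega> q g = (\<integral>x. (\<Sum>i\<in>UNIV. \<psi> i x \<bullet> (g x $ i)) \<partial>?M)"
    by (simp add: L2_inner_def inner_vec_def \<psi>_def)
  also have "\<dots> = (\<Sum>i\<in>UNIV. L2_inner \<Omega> (\<psi> i) (\<lambda>x. g x $ i))"
    unfolding L2_inner_def
    by (rule Bochner_Integration.integral_sum) (rule L2_inner_integrable[OF C01_L2[OF \<psi> \<Omega>] gi])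
  also have "\<dots> = - (\<Sum>i\<in>UNIV. L2_inner \<Omega> (\<lambda>x. grad (\<psi> i) x $ i) \<phi>)"
    by (simp add: parts sum_negf)
  also have "(\<Sum>i\<in>UNIV. L2_inner \<Omega> (\<lambda>x. grad (\<psi> i) x $ i) \<phi>) = (\<integral>x. (\<Sum>i\<in>UNIV. (grad (\<psi> i) x $ i) \<bullet> \<phi> x) \<partial>?M)"
    unfolding L2_inner_def
    by (rule Bochner_Integration.integral_sum[symmetric]) (rule L2_inner_integrable[OF gL \<phi>])
  also have "\<dots> = L2_inner \<Omega> (dvg q) \<phi>"
    unfolding L2_inner_def dv by (simp add: inner_sum_left sum_distrib_right)
  finally show "L2_inner \<Omega> q g = - L2_inner \<Omega> (dvg q) \<phi>" .
qed

lemma C01_L2_div: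
  fixes q :: "real ^ 2 \<Rightarrow> real ^ 2"
  assumes \<Omega>: "open \<Omega>" "bounded \<Omega>" and q: "q \<in> C01 \<Omega>"
  shows "has_L2_div \<Omega> q (dvg q)" "AE x in lebesgue_on \<Omega>. L2_div \<Omega> q x = dvg q x"
    "\<And>\<phi>. \<phi> \<in> H1 \<Omega> \<Longrightarrow> normal_trace \<Omega> q \<phi> = 0"
proof -
  note ibp = C01_integration_by_parts[OF \<Omega> q]
  show h: "has_L2_div \<Omega> q (dvg q)"
    unfolding has_L2_div_def dist_div_def
    using ibp(2)[OF has_weak_grad_weak_grad(3,1)] H01_subset_H1
    by (auto simp: ibp(1) L2_inner_minus_right subset_iff)
  then have h': "has_L2_div \<Omega> q (L2_div \<Omega> q)"
    unfolding L2_div_def by (rule someI[of "has_L2_div \<Omega> q"])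
  show ae: "AE x in lebesgue_on \<Omega>. L2_div \<Omega> q x = dvg q x"
    by (rule has_L2_div_unique[OF \<Omega> h' h])
  show "normal_trace \<Omega> q \<phi> = 0" if \<phi>: "\<phi> \<in> H1 \<Omega>" for \<phi>
  proof -
    have "L2_inner \<Omega> (L2_div \<Omega> q) \<phi> = L2_inner \<Omega> (dvg q) \<phi>"
      using ae h' by (intro L2_inner_cong_AE) (auto simp: has_weak_grad_weak_grad(3)[OF \<phi>] ibp(1) has_L2_div_def)
    then show ?thesis
      unfolding normal_trace_def using ibp(2)[OF has_weak_grad_weak_grad(3,1)[OF \<phi>]] by simp
  qed
qed

text \<open>Links the two problems: the fields tested in \<open>TV\<close> lie in the space of the
  dual problem, and their classical divergence represents the distributional one.\<close>

lemma C01_H0div: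
  fixes p :: "real ^ 2 \<Rightarrow> real ^ 'c ^ 2"
  assumes \<Omega>: "open \<Omega>" "bounded \<Omega>" and p: "p \<in> C01 \<Omega>"
  shows "p \<in> H0div \<Omega>" "AE x in lebesgue_on \<Omega>. L2_mdiv \<Omega> p x = mdvg p x"
proof -
  have c: "(\<lambda>x. column i (p x)) \<in> C01 \<Omega>" for i
    by (rule C01_linear[OF bounded_linear_column p \<Omega>(1)])
  show "p \<in> H0div \<Omega>"
    unfolding H0div_def using C01_L2[OF p \<Omega>] C01_L2_div[OF \<Omega> c] by blast
  have "AE x in lebesgue_on \<Omega>. \<forall>i. L2_div \<Omega> (\<lambda>x. column i (p x)) x = dvg (\<lambda>x. column i (p x)) x"
    using C01_L2_div(2)[OF \<Omega> c] by (simp add: AE_all_countable)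
  then show "AE x in lebesgue_on \<Omega>. L2_mdiv \<Omega> p x = mdvg p x"
    by eventually_elim (simp add: L2_mdiv_def mdvg_def)
qed

section \<open>Shifted mollification on Lipschitz domains\<close>

text \<open>Above a Lipschitz graph every direction steeper than L leads strictly upwards, and this
  persists for a ball of directions around the vertical. One ball serves all points of the closure
  near z and all step sizes up to 1. At interior points the ball is centred at 0.\<close>

lemma lipschitz_domain_cone:
  assumes \<Omega>: "lipschitz_domain \<Omega>" and z: "z \<in> closure \<Omega>"
  shows "\<exists>r>0. \<exists>c. \<exists>\<rho>>0. \<forall>y \<in> closure \<Omega> \<inter> cball z r. \<forall>w \<in> cball c \<rho>. \<forall>t. 0 < t \<and> t \<le> 1 \<longrightarrow> y + t *\<^sub>R w \<in> \<Omega>"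
proof (cases "z \<in> \<Omega>")
  case True
  have "open \<Omega>" using \<Omega> by (simp add: lipschitz_domain_def)
  then obtain e where e: "e > 0" "ball z e \<subseteq> \<Omega>" using True open_contains_ball by blast
  have "y + t *\<^sub>R w \<in> \<Omega>" if "y \<in> cball z (e / 2)" "w \<in> cball 0 (e / 3)" "0 < t" "t \<le> 1" for y w t
  proof -
    have "norm (t *\<^sub>R w) \<le> 1 * norm w"
      using that(3,4) mult_right_mono[of t 1 "norm w"] by simp
    then have "norm (t *\<^sub>R w) \<le> e / 3" using that(2) by simp
    moreover have "dist z (y + t *\<^sub>R w) \<le> dist z y + norm (t *\<^sub>R w)"
      using dist_triangle[of z "y + t *\<^sub>R w" y] by (simp add: dist_norm)
    ultimately have "dist z (y + t *\<^sub>R w) < e" using that(1) e(1) by simp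
    then show ?thesis using e(2) by auto
  qed
  then show ?thesis
    using e(1) by (intro exI[of _ "e / 2"] conjI exI[of _ 0] exI[of _ "e / 3"] ballI allI impI) auto
next
  case False
  have op: "open \<Omega>" and lb: "lipschitz_boundary \<Omega>" using \<Omega> by (simp_all add: lipschitz_domain_def)
  have "z \<in> frontier \<Omega>" using z False op by (simp add: frontier_def interior_open)
  from bspec[OF lb[unfolded lipschitz_boundary_def] this]
  obtain r0 and T :: "real ^ 2 \<Rightarrow> real ^ 2" and \<gamma> L where r0: "r0 > 0" and T: "orthogonal_transformation T"
    and \<gamma>: "L-lipschitz_on UNIV \<gamma>"
    and eq: "\<Omega> \<inter> ball z r0 = {y \<in> ball z r0. \<gamma> (T y $ 1) < T y $ 2}"
    by (elim exE conjE) (rule that)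
  have L0: "L \<ge> 0" using \<gamma> by (rule lipschitz_on_nonneg)
  have lin: "linear T" and nT: "norm (T x) = norm x" for x
    using T by (auto simp: orthogonal_transformation)
  have cT: "continuous_on UNIV T" using lin by (simp add: linear_continuous_on linear_conv_bounded_linear)
  have c\<gamma>: "continuous_on UNIV \<gamma>" using \<gamma> by (rule lipschitz_on_continuous_on)
  \<comment> \<open>On the closure only the weak inequality survives; strictness is regained from
    the cone for t > 0.\<close>
  have le: "\<gamma> (T y $ 1) \<le> T y $ 2" if "y \<in> closure \<Omega>" "y \<in> ball z r0" for y
  proof -
    have "closed {y. \<gamma> (T y $ 1) \<le> T y $ 2}"
      by (intro closed_Collect_le continuous_on_compose2[OF c\<gamma>] bounded_linear.continuous_on[OF bounded_linear_vec_nth cT])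
        (rule subset_UNIV)
    moreover have "ball z r0 \<inter> \<Omega> \<subseteq> {y. \<gamma> (T y $ 1) \<le> T y $ 2}"
      unfolding Int_commute[of "ball z r0"] eq by auto
    ultimately have sub: "closure (ball z r0 \<inter> \<Omega>) \<subseteq> {y. \<gamma> (T y $ 1) \<le> T y $ 2}" by (rule closure_minimal[rotated])
    have "y \<in> ball z r0 \<inter> closure \<Omega>" using that by simp
    then have "y \<in> closure (ball z r0 \<inter> \<Omega>)"
      by (rule subsetD[OF open_Int_closure_subset[OF open_ball]])
    from subsetD[OF sub this] show ?thesis by simp
  qed
  have "vector [0, 1] \<in> range T" using orthogonal_transformation_surj[OF T] by simp
  then obtain e where "vector [0, 1] = T e" by (rule rangeE)
  then have e: "T e = vector [0, 1]" ..
  have ne: "norm e = 1" unfolding nT[of e, symmetric] e by (simp add: norm_vec_def L2_set_def UNIV_2)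
  \<comment> \<open>Two demands fix the constants. Steepness: \<rho> (L + 1) = s / 2 < s gives L
    \<rho> < s - \<rho>. Staying in the chart: r0 / 2 + s + \<rho> is at most r0 / 2 + 3 s / 2 = 7
    r0 / 8. The summand 1 covers L = 0.\<close>
  define s where "s = r0 / 4"
  define \<rho> where "\<rho> = s / (2 * (L + 1))"
  have s: "s > 0" using r0 by (simp add: s_def)
  have \<rho>: "\<rho> > 0" using s L0 by (simp add: \<rho>_def)
  have \<rho>L: "\<rho> * (L + 1) = s / 2" using L0 by (simp add: \<rho>_def field_simps)
  have "\<rho> * 1 \<le> \<rho> * (L + 1)" using \<rho> L0 by (intro mult_left_mono) auto
  then have \<rho>s: "\<rho> \<le> s / 2" using \<rho>L by simp
  have "y + t *\<^sub>R w \<in> \<Omega>" if y: "y \<in> closure \<Omega>" "y \<in> cball z (r0 / 2)" and w: "w \<in> cball (s *\<^sub>R e) \<rho>"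
    and t: "0 < t" "t \<le> 1" for y w t
  proof -
    define v where "v = w - s *\<^sub>R e"
    have v: "norm v \<le> \<rho>" using w by (simp add: v_def dist_norm norm_minus_commute)
    have weq: "w = s *\<^sub>R e + v" by (simp add: v_def)
    have Tw: "T w = s *\<^sub>R vector [0, 1] + T v"
      unfolding weq using lin by (simp add: linear_add linear_cmul e)
    have Tv: "\<bar>T v $ i\<bar> \<le> \<rho>" for i
      using component_le_norm_cart[of "T v" i] v nT[of v] by linarith
    have Tw1: "\<bar>T w $ 1\<bar> \<le> \<rho>" unfolding Tw using Tv[of 1] by simp
    have Tw2: "T w $ 2 \<ge> s - \<rho>" unfolding Tw using Tv[of 2] by simp
    have "L * \<bar>T w $ 1\<bar> \<le> L * \<rho>" using Tw1 L0 by (rule mult_left_mono)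
    also have "\<dots> < s - \<rho>" using \<rho>L s by (simp add: algebra_simps)
    finally have cone: "L * \<bar>T w $ 1\<bar> < T w $ 2" using Tw2 by linarith
    have "norm w \<le> norm (s *\<^sub>R e) + norm v" unfolding weq by (rule norm_triangle_ineq)
    then have nw: "norm w \<le> s + \<rho>" using v ne s by simp
    have "norm (t *\<^sub>R w) \<le> 1 * norm w" using t mult_right_mono[of t 1 "norm w"] by simp
    then have ntw: "norm (t *\<^sub>R w) \<le> s + \<rho>" using nw by simp
    have "dist z (y + t *\<^sub>R w) \<le> dist z y + norm (t *\<^sub>R w)"
      using dist_triangle[of z "y + t *\<^sub>R w" y] by (simp add: dist_norm)
    also have "\<dots> < r0" using y(2) ntw \<rho>s r0 by (simp add: s_def)
    finally have inb: "y + t *\<^sub>R w \<in> ball z r0" by simp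
    have Tsum: "T (y + t *\<^sub>R w) = T y + t *\<^sub>R T w" using lin by (simp add: linear_add linear_cmul)
    have "dist (\<gamma> (T (y + t *\<^sub>R w) $ 1)) (\<gamma> (T y $ 1)) \<le> L * dist (T (y + t *\<^sub>R w) $ 1) (T y $ 1)"
      using \<gamma> by (rule lipschitz_onD) auto
    then have "\<gamma> (T (y + t *\<^sub>R w) $ 1) \<le> \<gamma> (T y $ 1) + t * (L * \<bar>T w $ 1\<bar>)"
      unfolding Tsum using t by (simp add: dist_real_def abs_mult mult_ac)
    also have "\<dots> < T y $ 2 + t * (T w $ 2)"
      using le[OF y(1)] y(2) r0 mult_strict_left_mono[OF cone t(1)] by (intro add_le_less_mono) auto
    also have "\<dots> = T (y + t *\<^sub>R w) $ 2" unfolding Tsum by simp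
    finally have "y + t *\<^sub>R w \<in> {y \<in> ball z r0. \<gamma> (T y $ 1) < T y $ 2}" using inb by simp
    then show ?thesis unfolding eq[symmetric] by simp
  qed
  then show ?thesis
    using r0 \<rho> by (intro exI[of _ "r0 / 2"] conjI exI[of _ "s *\<^sub>R e"] exI[of _ \<rho>] ballI allI impI) auto
qed

text \<open>Bumps over a finite subcover of the compact closure, divided by their sum S. Positivity
  of S is known only on the closure, so derivatives are claimed only there. The vanishing sum of the
  \<theta>' is recorded because the extra terms of the product rule have to cancel.\<close>

lemma lipschitz_domain_partition:
  assumes \<Omega>: "lipschitz_domain \<Omega>"
  obtains Z :: "(real ^ 2) set" and r \<rho> :: "real ^ 2 \<Rightarrow> real" and c :: "real ^ 2 \<Rightarrow> real ^ 2"
    and \<theta> :: "real ^ 2 \<Rightarrow> real ^ 2 \<Rightarrow> real" and \<theta>' :: "real ^ 2 \<Rightarrow> real ^ 2 \<Rightarrow> real ^ 2"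
  where "finite Z" "\<And>z. z \<in> Z \<Longrightarrow> \<rho> z > 0"
    "\<And>z y w t. z \<in> Z \<Longrightarrow> y \<in> closure \<Omega> \<inter> cball z (r z) \<Longrightarrow> w \<in> cball (c z) (\<rho> z) \<Longrightarrow> 0 < t \<Longrightarrow> t \<le> 1 \<Longrightarrow> y + t *\<^sub>R w \<in> \<Omega>"
    "\<And>z y. z \<in> Z \<Longrightarrow> \<theta> z y \<noteq> 0 \<Longrightarrow> y \<in> cball z (r z)"
    "\<And>z y. z \<in> Z \<Longrightarrow> y \<in> closure \<Omega> \<Longrightarrow> (\<theta> z has_derivative (\<lambda>h. \<theta>' z y \<bullet> h)) (at y)"
    "\<And>z. z \<in> Z \<Longrightarrow> continuous_on (closure \<Omega>) (\<theta>' z)"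
    "\<And>z y. 0 \<le> \<theta> z y"
    "\<And>y. y \<in> closure \<Omega> \<Longrightarrow> (\<Sum>z\<in>Z. \<theta> z y) = 1"
    "\<And>y. y \<in> \<Omega> \<Longrightarrow> (\<Sum>z\<in>Z. \<theta>' z y) = 0"
proof -
  have op: "open \<Omega>" and bd: "bounded \<Omega>" using \<Omega> by (simp_all add: lipschitz_domain_def)
  have "\<exists>r c \<rho>. r > 0 \<and> \<rho> > 0 \<and> (\<forall>y \<in> closure \<Omega> \<inter> cball z r. \<forall>w \<in> cball c \<rho>. \<forall>t. 0 < t \<and> t \<le> 1 \<longrightarrow> y + t *\<^sub>R w \<in> \<Omega>)"
    if "z \<in> closure \<Omega>" for z
    using lipschitz_domain_cone[OF \<Omega> that] by blast
  then obtain r c \<rho> where r: "\<And>z. z \<in> closure \<Omega> \<Longrightarrow> r z > 0" and \<rho>: "\<And>z. z \<in> closure \<Omega> \<Longrightarrow> \<rho> z > 0"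
    and cone: "\<And>z y w t. z \<in> closure \<Omega> \<Longrightarrow> y \<in> closure \<Omega> \<inter> cball z (r z) \<Longrightarrow> w \<in> cball (c z) (\<rho> z) \<Longrightarrow> 0 < t \<Longrightarrow> t \<le> 1 \<Longrightarrow> y + t *\<^sub>R w \<in> \<Omega>"
    by metis
  have cc: "compact (closure \<Omega>)" using bd by (simp add: compact_closure)
  have cov: "closure \<Omega> \<subseteq> (\<Union>z\<in>closure \<Omega>. ball z (r z))"
  proof
    fix y assume "y \<in> closure \<Omega>"
    then show "y \<in> (\<Union>z\<in>closure \<Omega>. ball z (r z))" using r[of y] by (intro UN_I[of y]) auto
  qed
  obtain Z where Z: "Z \<subseteq> closure \<Omega>" "finite Z" "closure \<Omega> \<subseteq> (\<Union>z\<in>Z. ball z (r z))"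
    by (rule compactE_image[OF cc _ cov]) (rule open_ball, rule that)
  have ZD: "z \<in> closure \<Omega>" if "z \<in> Z" for z by (rule subsetD[OF Z(1) that])
  have rZ: "r z > 0" if "z \<in> Z" for z by (rule r[OF ZD[OF that]])
  define b where "b z y = bump ((1 / r z) *\<^sub>R (y - z))" for z y
  define b' where "b' z y = (1 / r z) *\<^sub>R bump_grad ((1 / r z) *\<^sub>R (y - z))" for z y
  define S where "S y = (\<Sum>z\<in>Z. b z y)" for y
  define S' where "S' y = (\<Sum>z\<in>Z. b' z y)" for y
  have bd: "(b z has_derivative (\<lambda>h. b' z y \<bullet> h)) (at y)" for z y
  proof -
    have "((\<lambda>y. (1 / r z) *\<^sub>R (y - z)) has_derivative (\<lambda>h. (1 / r z) *\<^sub>R h)) (at y)"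
      by (auto intro!: derivative_eq_intros)
    from has_derivative_compose[OF this bump_has_derivative]
    show ?thesis unfolding b_def[abs_def] b'_def by simp
  qed
  have Sd: "(S has_derivative (\<lambda>h. S' y \<bullet> h)) (at y)" for y
    unfolding S_def[abs_def] S'_def inner_sum_left by (rule has_derivative_sum[OF bd])
  have bnn: "b z y \<ge> 0" for z y by (simp add: b_def bump_nonneg)
  have bout: "y \<in> cball z (r z)" if "z \<in> Z" "b z y \<noteq> 0" for z y
  proof (rule ccontr)
    assume "y \<notin> cball z (r z)"
    then have "norm ((1 / r z) *\<^sub>R (y - z)) \<ge> 1"
      using rZ[OF that(1)] by (simp add: dist_norm norm_minus_commute)
    then have "b z y = 0" unfolding b_def by (rule bump_outside)
    with that show False by simp
  qed
  have Spos: "S y > 0" if "y \<in> closure \<Omega>" for y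
  proof -
    from subsetD[OF Z(3) that] obtain z where z: "z \<in> Z" "y \<in> ball z (r z)" by (rule UN_E)
    have "b z y > 0" unfolding b_def
      using z(2) rZ[OF z(1)] by (intro bump_pos) (simp add: dist_norm norm_minus_commute)
    moreover have "b z y \<le> S y" unfolding S_def
      by (rule member_le_sum[OF z(1)]) (auto simp: bnn Z(2))
    ultimately show ?thesis by linarith
  qed
  have Snn: "S y \<ge> 0" for y unfolding S_def by (intro sum_nonneg bnn)
  have cbg: "continuous_on UNIV bump_grad"
    by (rule lipschitz_on_continuous_on[of 12], rule lipschitz_onI) (auto simp: dist_norm bump_grad_Lipschitz)
  have cb': "continuous_on A (b' z)" for A z
    unfolding b'_def[abs_def]
    by (intro continuous_on_scaleR continuous_on_const continuous_on_compose2[OF cbg] continuous_intros) auto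
  have cb: "continuous_on A (b z)" for A z
    using has_derivative_continuous[OF bd] by (simp add: continuous_at_imp_continuous_on)
  have cS: "continuous_on A S" for A
    using has_derivative_continuous[OF Sd] by (simp add: continuous_at_imp_continuous_on)
  have cS': "continuous_on A S'" for A
    unfolding S'_def[abs_def] by (intro continuous_on_sum cb')
  define \<theta> where "\<theta> z y = b z y / S y" for z y
  define \<theta>' where "\<theta>' z y = (1 / S y) *\<^sub>R b' z y - (b z y / (S y * S y)) *\<^sub>R S' y" for z y
  have \<theta>d: "(\<theta> z has_derivative (\<lambda>h. \<theta>' z y \<bullet> h)) (at y)" if y: "y \<in> closure \<Omega>" for z y
  proof -
    have "S y \<noteq> 0" using Spos[OF y] by simp
    then have eq: "(\<lambda>h. \<theta>' z y \<bullet> h) = (\<lambda>h. (b' z y \<bullet> h * S y - b z y * (S' y \<bullet> h)) / (S y * S y))"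
      by (intro ext) (simp add: \<theta>'_def inner_diff_left field_simps)
    show ?thesis
      unfolding eq \<theta>_def[abs_def] by (rule has_derivative_divide'[OF bd Sd \<open>S y \<noteq> 0\<close>])
  qed
  have c\<theta>': "continuous_on (closure \<Omega>) (\<theta>' z)" for z
    unfolding \<theta>'_def[abs_def]
    by (intro continuous_on_diff continuous_on_scaleR continuous_on_divide continuous_on_const continuous_on_mult cS cS' cb cb')
      (simp_all add: Spos less_imp_neq[symmetric])
  have sum1: "(\<Sum>z\<in>Z. \<theta> z y) = 1" if "y \<in> closure \<Omega>" for y
    using Spos[OF that] by (simp add: \<theta>_def S_def flip: sum_divide_distrib)
  \<comment> \<open>The sum of the weights is constant on the open set \<Omega>, so its derivative
    vanishes; testing the summed gradient with itself gives 0.\<close>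
  have sum0: "(\<Sum>z\<in>Z. \<theta>' z y) = 0" if y: "y \<in> \<Omega>" for y
  proof -
    have y': "y \<in> closure \<Omega>" using y closure_subset by blast
    have "((\<lambda>y. \<Sum>z\<in>Z. \<theta> z y) has_derivative (\<lambda>h. \<Sum>z\<in>Z. \<theta>' z y \<bullet> h)) (at y)"
      by (rule has_derivative_sum[OF \<theta>d[OF y']])
    moreover have "((\<lambda>y. \<Sum>z\<in>Z. \<theta> z y) has_derivative (\<lambda>h. 0)) (at y)"
    proof (rule has_derivative_transform_within_open[OF _ op y])
      show "((\<lambda>y. 1::real) has_derivative (\<lambda>h. 0)) (at y)" by simp
      show "1 = (\<Sum>z\<in>Z. \<theta> z x)" if "x \<in> \<Omega>" for x
        using sum1[of x] closure_subset that by fastforce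
    qed
    ultimately have "(\<lambda>h. \<Sum>z\<in>Z. \<theta>' z y \<bullet> h) = (\<lambda>h. 0)" by (rule has_derivative_unique)
    then have "(\<Sum>z\<in>Z. \<theta>' z y) \<bullet> h = 0" for h
      unfolding inner_sum_left by (rule fun_cong)
    from this[of "\<Sum>z\<in>Z. \<theta>' z y"] show ?thesis by simp
  qed
  show thesis
  proof (rule that[of Z \<rho> r c \<theta> \<theta>'])
    show "\<rho> z > 0" if "z \<in> Z" for z by (rule \<rho>[OF ZD[OF that]])
    show "y + t *\<^sub>R w \<in> \<Omega>" if "z \<in> Z" "y \<in> closure \<Omega> \<inter> cball z (r z)" "w \<in> cball (c z) (\<rho> z)" "0 < t" "t \<le> 1" for z y w t
      by (rule cone[OF ZD[OF that(1)] that(2-5)])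
    show "y \<in> cball z (r z)" if "z \<in> Z" "\<theta> z y \<noteq> 0" for z y
      by (rule bout[OF that(1)]) (use that(2) in \<open>auto simp: \<theta>_def\<close>)
    \<comment> \<open>Valid on the whole plane, since a quotient by S y = 0 is 0.\<close>
    show "0 \<le> \<theta> z y" for z y by (simp add: \<theta>_def bnn Snn)
    show "finite Z" by (rule Z(2))
    show "(\<theta> z has_derivative (\<lambda>h. \<theta>' z y \<bullet> h)) (at y)" if "y \<in> closure \<Omega>" for z y by (rule \<theta>d[OF that])
    show "continuous_on (closure \<Omega>) (\<theta>' z)" for z by (rule c\<theta>')
    show "(\<Sum>z\<in>Z. \<theta> z y) = 1" if "y \<in> closure \<Omega>" for y by (rule sum1[OF that])
    show "(\<Sum>z\<in>Z. \<theta>' z y) = 0" if "y \<in> \<Omega>" for y by (rule sum0[OF that])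
  qed
qed

lemma dvg_sum:
  fixes f :: "'i \<Rightarrow> real ^ 2 \<Rightarrow> real ^ 2"
  assumes f: "\<And>i. i \<in> I \<Longrightarrow> f i \<in> C01 \<Omega>" and \<Omega>: "open \<Omega>"
  shows "dvg (\<lambda>x. \<Sum>i\<in>I. f i x) x = (\<Sum>i\<in>I. dvg (f i) x)"
proof -
  have "((\<lambda>x. \<Sum>i\<in>I. f i x) has_derivative (\<lambda>h. \<Sum>i\<in>I. frechet_derivative (f i) (at x) h)) (at x)"
    by (rule has_derivative_sum[OF C01_has_frechet_derivative[OF f \<Omega>]])
  then have "dvg (\<lambda>x. \<Sum>i\<in>I. f i x) x = (\<Sum>j\<in>UNIV. (\<Sum>i\<in>I. frechet_derivative (f i) (at x) (axis j 1)) $ j)"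
    by (rule dvg_eq)
  also have "\<dots> = (\<Sum>i\<in>I. \<Sum>j\<in>UNIV. frechet_derivative (f i) (at x) (axis j 1) $ j)"
    unfolding sum_component by (rule sum.swap)
  finally show ?thesis by (simp add: dvg_def)
qed

lemma dvg_scaleR:
  assumes f: "f \<in> C01 \<Omega>" and \<Omega>: "open \<Omega>"
  shows "dvg (\<lambda>x. a *\<^sub>R f x) x = a * dvg f x"
proof -
  have "((\<lambda>x. a *\<^sub>R f x) has_derivative (\<lambda>h. a *\<^sub>R frechet_derivative f (at x) h)) (at x)"
    by (rule has_derivative_scaleR_right[OF C01_has_frechet_derivative[OF f \<Omega>]])
  from dvg_eq[OF this] show ?thesis by (simp add: dvg_def sum_distrib_left)
qed

text \<open>The derivative falls on the kernel, giving the integral of \<open>G (x - y)\<close>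
  against \<theta> q; Green's identity for the product of \<open>k (x - y)\<close> and \<theta>
  moves it to d. For x near the boundary this product need not vanish there, so \<open>green\<close>
  is needed on all of \<open>H1\<close>: this is where the zero normal trace enters.\<close>

lemma dvg_mollified:
  fixes q :: "real ^ 2 \<Rightarrow> real ^ 2"
  assumes \<Omega>: "open \<Omega>" "bounded \<Omega>" and k: "smooth_kernel c \<rho> k G"
    and q: "q \<in> L2 \<Omega>" and d: "d \<in> L2 \<Omega>"
    and green: "\<And>\<phi>. \<phi> \<in> H1 \<Omega> \<Longrightarrow> L2_inner \<Omega> q (weak_grad \<Omega> \<phi>) + L2_inner \<Omega> d \<phi> = 0"
    and \<theta>d: "\<And>y. y \<in> \<Omega> \<Longrightarrow> (\<theta> has_derivative (\<lambda>h. \<theta>' y \<bullet> h)) (at y)" and \<theta>c: "continuous_on \<Omega> \<theta>'"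
    and \<theta>b: "\<And>y. y \<in> \<Omega> \<Longrightarrow> \<bar>\<theta> y\<bar> \<le> 1" and \<theta>b': "\<And>y. y \<in> \<Omega> \<Longrightarrow> norm (\<theta>' y) \<le> C"
  shows "(\<lambda>y. \<theta> y *\<^sub>R q y) \<in> L2 \<Omega>" and "(\<lambda>y. \<theta> y * d y + \<theta>' y \<bullet> q y) \<in> L2 \<Omega>"
    and "dvg (\<lambda>x. \<integral>y. k (x - y) *\<^sub>R (\<theta> y *\<^sub>R q y) \<partial>lebesgue_on \<Omega>) x
      = (\<integral>y. k (x - y) * (\<theta> y * d y + \<theta>' y \<bullet> q y) \<partial>lebesgue_on \<Omega>)"
proof -
  let ?M = "lebesgue_on \<Omega>"
  let ?F = "\<lambda>y. \<theta> y *\<^sub>R q y"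
  have \<Omega>m: "\<Omega> \<in> sets lebesgue" using \<Omega>(1) by simp
  obtain L B where kd: "\<And>z. (k has_derivative (\<lambda>h. G z \<bullet> h)) (at z)" and kk: "kernel (norm c + \<rho>) k"
    and L: "L \<ge> 0" "\<And>z w. norm (G z - G w) \<le> L * norm (z - w)" and B: "\<And>z. norm (G z) \<le> B"
    using k unfolding smooth_kernel_def by blast
  obtain A where A0: "A \<ge> 0" and A: "\<And>z. \<bar>k z\<bar> \<le> A"
    by (rule kernel_bounded[OF kk]) (rule that)
  have B0: "B \<ge> 0" using order_trans[OF norm_ge_zero B[of 0]] .
  note cG = smooth_kernel_continuous_grad[OF k]
  have ck: "continuous_on UNIV k" using kk by (simp add: kernel_def)
  have c\<theta>: "continuous_on \<Omega> \<theta>"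
    using has_derivative_continuous[OF \<theta>d] by (simp add: continuous_at_imp_continuous_on)
  note m\<theta> = continuous_imp_measurable_on_sets_lebesgue[OF c\<theta> \<Omega>m]
  note m\<theta>' = continuous_imp_measurable_on_sets_lebesgue[OF \<theta>c \<Omega>m]
  show F: "?F \<in> L2 \<Omega>"
  proof (rule L2_bounded_mult[OF q, where B = 1])
    show "?F \<in> borel_measurable ?M" by (intro borel_measurable_scaleR m\<theta> L2_measurable[OF q])
    show "norm (?F y) \<le> 1 * norm (q y)" if "y \<in> \<Omega>" for y
      using mult_right_mono[OF \<theta>b[OF that] norm_ge_zero[of "q y"]] by simp
  qed
  have g1: "(\<lambda>y. \<theta> y * d y) \<in> L2 \<Omega>"
  proof (rule L2_bounded_mult[OF d, where B = 1])
    show "(\<lambda>y. \<theta> y * d y) \<in> borel_measurable ?M" by (intro borel_measurable_times m\<theta> L2_measurable[OF d])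
    show "norm (\<theta> y * d y) \<le> 1 * norm (d y)" if "y \<in> \<Omega>" for y
      using mult_right_mono[OF \<theta>b[OF that] norm_ge_zero[of "d y"]] by (simp add: abs_mult)
  qed
  have g2: "(\<lambda>y. \<theta>' y \<bullet> q y) \<in> L2 \<Omega>"
  proof (rule L2_bounded_mult[OF q, where B = C])
    show "(\<lambda>y. \<theta>' y \<bullet> q y) \<in> borel_measurable ?M" by (intro borel_measurable_inner m\<theta>' L2_measurable[OF q])
    show "norm (\<theta>' y \<bullet> q y) \<le> C * norm (q y)" if "y \<in> \<Omega>" for y
      using Cauchy_Schwarz_ineq2[of "\<theta>' y" "q y"] mult_right_mono[OF \<theta>b'[OF that] norm_ge_zero[of "q y"]] by simp
  qed
  show g: "(\<lambda>y. \<theta> y * d y + \<theta>' y \<bullet> q y) \<in> L2 \<Omega>" by (rule L2_add[OF g1 g2])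
  note Fi = L2_integrable[OF \<Omega> F]
  obtain f' where f': "\<And>x. ((\<lambda>x. \<integral>y. k (x - y) *\<^sub>R ?F y \<partial>?M) has_derivative blinfun_apply (f' x)) (at x)"
    and f'_eq: "\<And>x h. blinfun_apply (f' x) h = (\<integral>y. (G (x - y) \<bullet> h) *\<^sub>R ?F y \<partial>?M)"
    using smooth_kernel_conv_C1(2)[OF k Fi] by blast
  note Gi = smooth_kernel_conv_C1(1)[OF k Fi]
  have "dvg (\<lambda>x. \<integral>y. k (x - y) *\<^sub>R ?F y \<partial>?M) x = (\<Sum>i\<in>UNIV. (\<integral>y. (G (x - y) \<bullet> axis i 1) *\<^sub>R ?F y \<partial>?M) $ i)"
    unfolding dvg_eq[OF f'] f'_eq ..
  also have "\<dots> = (\<Sum>i\<in>UNIV. (\<integral>y. ((G (x - y) \<bullet> axis i 1) *\<^sub>R ?F y) \<bullet> axis i 1 \<partial>?M))"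
    unfolding cart_eq_inner_axis by (intro sum.cong refl integral_inner_left[symmetric]) (rule Gi)
  also have "\<dots> = (\<integral>y. (\<Sum>i\<in>UNIV. ((G (x - y) \<bullet> axis i 1) *\<^sub>R ?F y) \<bullet> axis i 1) \<partial>?M)"
    by (intro Bochner_Integration.integral_sum[symmetric] integrable_inner_left) (rule Gi)
  also have "\<dots> = (\<integral>y. G (x - y) \<bullet> ?F y \<partial>?M)"
    by (simp add: inner_vec_def[of "G _"] inner_axis sum_distrib_left mult_ac)
  finally have dv: "dvg (\<lambda>x. \<integral>y. k (x - y) *\<^sub>R ?F y \<partial>?M) x = (\<integral>y. G (x - y) \<bullet> ?F y \<partial>?M)" .
  \<comment> \<open>Here x is fixed and y varies, hence the minus sign of G in \<phi>'.\<close>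
  define \<phi> where "\<phi> y = k (x - y) * \<theta> y" for y
  define \<phi>' where "\<phi>' y = k (x - y) *\<^sub>R \<theta>' y - \<theta> y *\<^sub>R G (x - y)" for y
  have \<phi>d: "(\<phi> has_derivative (\<lambda>h. \<phi>' y \<bullet> h)) (at y)" if y: "y \<in> \<Omega>" for y
  proof -
    have "((\<lambda>y. x - y) has_derivative (\<lambda>h. - h)) (at y)" by (auto intro!: derivative_eq_intros)
    from has_derivative_mult[OF has_derivative_compose[OF this kd] \<theta>d[OF y]]
    show ?thesis unfolding \<phi>_def[abs_def] \<phi>'_def by (simp add: inner_diff_left algebra_simps)
  qed
  have "continuous_on \<Omega> (\<lambda>y. k (x - y))"
    by (rule continuous_on_compose2[OF ck]) (auto intro!: continuous_intros)
  moreover have "continuous_on \<Omega> (\<lambda>y. G (x - y))"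
    by (rule continuous_on_compose2[OF cG]) (auto intro!: continuous_intros)
  ultimately have \<phi>c: "continuous_on \<Omega> \<phi>'"
    unfolding \<phi>'_def[abs_def] by (intro continuous_on_diff continuous_on_scaleR c\<theta> \<theta>c)
  have \<phi>b: "\<bar>\<phi> y\<bar> \<le> A" if "y \<in> \<Omega>" for y
    using mult_mono[OF A[of "x - y"] \<theta>b[OF that] A0 abs_ge_zero] by (simp add: \<phi>_def abs_mult)
  have \<phi>b': "norm (\<phi>' y) \<le> A * C + 1 * B" if "y \<in> \<Omega>" for y
  proof -
    have "norm (\<phi>' y) \<le> \<bar>k (x - y)\<bar> * norm (\<theta>' y) + \<bar>\<theta> y\<bar> * norm (G (x - y))"
      unfolding \<phi>'_def using norm_triangle_ineq4[of "k (x - y) *\<^sub>R \<theta>' y" "\<theta> y *\<^sub>R G (x - y)"] by simp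
    also have "\<dots> \<le> A * C + 1 * B"
      by (intro add_mono mult_mono A \<theta>b[OF that] \<theta>b'[OF that] B A0) auto
    finally show ?thesis .
  qed
  note w = has_weak_grad_classical[OF \<Omega> \<phi>d \<phi>c \<phi>b \<phi>b']
  have H1: "\<phi> \<in> H1 \<Omega>" using w by (auto simp: H1_def)
  have \<phi>'L: "\<phi>' \<in> L2 \<Omega>" using w(2) by (simp add: has_weak_grad_def)
  have "L2_inner \<Omega> q (weak_grad \<Omega> \<phi>) = L2_inner \<Omega> q \<phi>'"
    using has_weak_grad_unique[OF \<Omega> has_weak_grad_weak_grad(1)[OF H1] w(2)]
    by (intro L2_inner_cong_AE) (auto simp: q \<phi>'L has_weak_grad_weak_grad(2)[OF H1])
  with green[OF H1] have "L2_inner \<Omega> q \<phi>' + L2_inner \<Omega> d \<phi> = 0" by simp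
  then have "(\<integral>y. q y \<bullet> \<phi>' y + d y \<bullet> \<phi> y \<partial>?M) = 0"
    unfolding L2_inner_def using L2_inner_integrable[OF q \<phi>'L] L2_inner_integrable[OF d w(1)] by simp
  \<comment> \<open>Pointwise, Green's integrand is the difference of the two integrands to be
    identified.\<close>
  moreover have "q y \<bullet> \<phi>' y + d y \<bullet> \<phi> y = k (x - y) * (\<theta> y * d y + \<theta>' y \<bullet> q y) - G (x - y) \<bullet> ?F y" for y
    by (simp add: \<phi>'_def \<phi>_def inner_diff_right inner_commute[of "q y"] algebra_simps)
  moreover have "integrable ?M (\<lambda>y. k (x - y) * (\<theta> y * d y + \<theta>' y \<bullet> q y))"
    using kernel_conv_integrable[OF kk L2_integrable[OF \<Omega> g], of x] by simp
  moreover have "integrable ?M (\<lambda>y. G (x - y) \<bullet> ?F y)"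
  proof -
    have "(\<lambda>y. G (x - y)) \<in> borel_measurable borel"
      using borel_measurable_continuous_onI[OF cG] by measurable
    then have "(\<lambda>y. G (x - y)) \<in> L2 \<Omega>"
      by (intro L2_bounded[OF \<Omega> borel_measurable_imp_lebesgue_on B])
    then show ?thesis using F by (rule L2_inner_integrable)
  qed
  ultimately show "dvg (\<lambda>x. \<integral>y. k (x - y) *\<^sub>R ?F y \<partial>?M) x = (\<integral>y. k (x - y) * (\<theta> y * d y + \<theta>' y \<bullet> q y) \<partial>?M)"
    unfolding dv by simp
qed

text \<open>A contribution to the value at x requires y in the support of F and x - y in t times the
  ball of directions, so x lies in the sum of both sets. That sum is a compact image, and the cone
  property puts it inside \<Omega>.\<close>

lemma mollified_C01:
  fixes F :: "real ^ 2 \<Rightarrow> real ^ 2"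
  assumes \<Omega>: "open \<Omega>" "bounded \<Omega>" and t: "t > 0" and k: "smooth_kernel (t *\<^sub>R c) (t * \<rho>) k G"
    and F: "integrable (lebesgue_on \<Omega>) F" and F0: "\<And>y. F y \<noteq> 0 \<Longrightarrow> y \<in> cball z r"
    and cone: "\<And>y w. y \<in> closure \<Omega> \<inter> cball z r \<Longrightarrow> w \<in> cball c \<rho> \<Longrightarrow> y + t *\<^sub>R w \<in> \<Omega>"
  shows "(\<lambda>x. \<integral>y. k (x - y) *\<^sub>R F y \<partial>lebesgue_on \<Omega>) \<in> C01 \<Omega>"
proof -
  let ?M = "lebesgue_on \<Omega>"
  let ?A = "closure \<Omega> \<inter> cball z r"
  define S where "S = (\<lambda>(y, w). y + t *\<^sub>R w) ` (?A \<times> cball c \<rho>)"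
  have "compact (?A \<times> cball c \<rho>)"
    using \<Omega>(2) by (intro compact_Times compact_Int_closed) (simp_all add: compact_closure)
  then have S: "compact S"
    unfolding S_def by (intro compact_continuous_image) (auto simp: case_prod_beta intro!: continuous_intros)
  have S\<Omega>: "S \<subseteq> \<Omega>" unfolding S_def using cone by auto
  have ks: "w \<in> cball (t *\<^sub>R c) (t * \<rho>)" if "k w \<noteq> 0" for w
    using k that unfolding smooth_kernel_def by blast
  obtain f' where f': "\<And>x. ((\<lambda>x. \<integral>y. k (x - y) *\<^sub>R F y \<partial>?M) has_derivative blinfun_apply (f' x)) (at x)"
    and cf': "continuous_on UNIV f'"
    using smooth_kernel_conv_C1(2)[OF k F] by blast
  show ?thesis
  proof (rule C01I[OF S S\<Omega> _ f'])
    show "continuous_on \<Omega> f'" by (rule continuous_on_subset[OF cf' subset_UNIV])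
    fix x assume x: "x \<notin> S"
    have "k (x - y) *\<^sub>R F y = 0" if y: "y \<in> \<Omega>" for y
    proof (rule ccontr)
      assume "k (x - y) *\<^sub>R F y \<noteq> 0"
      then have 1: "x - y \<in> cball (t *\<^sub>R c) (t * \<rho>)" and 2: "y \<in> cball z r" using ks F0 by auto
      define w where "w = (1 / t) *\<^sub>R (x - y)"
      have tw: "x - y = t *\<^sub>R w" using t by (simp add: w_def)
      have "norm (t *\<^sub>R (c - w)) \<le> t * \<rho>" using 1 unfolding tw by (simp add: dist_norm scaleR_diff_right)
      then have "w \<in> cball c \<rho>" using t by (simp add: dist_norm)
      moreover have "y \<in> ?A" using y 2 closure_subset by blast
      ultimately have "(y, w) \<in> ?A \<times> cball c \<rho>" by (rule SigmaI[rotated])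
      then have "(\<lambda>(y, w). y + t *\<^sub>R w) (y, w) \<in> S" unfolding S_def by (rule imageI)
      moreover have "(\<lambda>(y, w). y + t *\<^sub>R w) (y, w) = x" using tw by (simp add: algebra_simps)
      ultimately show False using x by simp
    qed
    then have "(\<integral>y. k (x - y) *\<^sub>R F y \<partial>?M) = (\<integral>y. 0 \<partial>?M)"
      by (intro Bochner_Integration.integral_cong) (simp_all add: space_restrict_space)
    then show "(\<integral>y. k (x - y) *\<^sub>R F y \<partial>?M) = 0" by simp
  qed
qed

text \<open>The divergence of the piece z is a mollification of \<open>g z\<close>, the product rule
  expression for the divergence of \<theta> q, and tends weakly to it; summed over z the \<theta>'
  cancel and d remains. \<open>green\<close> encodes both that d is the divergence of q and that the
  normal trace is zero.\<close>

lemma column_approximation: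
  fixes q :: "real ^ 2 \<Rightarrow> real ^ 2"
  assumes \<Omega>l: "lipschitz_domain \<Omega>"
    and q: "q \<in> L2 \<Omega>" and q1: "AE y in lebesgue_on \<Omega>. norm (q y) \<le> 1" and d: "d \<in> L2 \<Omega>"
    and green: "\<And>\<phi>. \<phi> \<in> H1 \<Omega> \<Longrightarrow> L2_inner \<Omega> q (weak_grad \<Omega> \<phi>) + L2_inner \<Omega> d \<phi> = 0"
  shows "\<exists>Q. (\<forall>n. Q n \<in> C01 \<Omega> \<and> (\<forall>x. norm (Q n x) \<le> 1)) \<and>
    (\<forall>v \<in> L2 \<Omega>. (\<lambda>n. L2_inner \<Omega> v (dvg (Q n))) \<longlonglongrightarrow> L2_inner \<Omega> v d)"
proof -
  have \<Omega>: "open \<Omega>" "bounded \<Omega>" using \<Omega>l by (simp_all add: lipschitz_domain_def)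
  let ?M = "lebesgue_on \<Omega>"
  obtain Z r \<rho> c \<theta> \<theta>' where Z: "finite Z" and \<rho>: "\<And>z. z \<in> Z \<Longrightarrow> \<rho> z > 0"
    and cone: "\<And>z y w t. z \<in> Z \<Longrightarrow> y \<in> closure \<Omega> \<inter> cball z (r z) \<Longrightarrow> w \<in> cball (c z) (\<rho> z) \<Longrightarrow> 0 < t \<Longrightarrow> t \<le> 1 \<Longrightarrow> y + t *\<^sub>R w \<in> \<Omega>"
    and \<theta>s: "\<And>z y. z \<in> Z \<Longrightarrow> \<theta> z y \<noteq> 0 \<Longrightarrow> y \<in> cball z (r z)"
    and \<theta>d: "\<And>z y. z \<in> Z \<Longrightarrow> y \<in> closure \<Omega> \<Longrightarrow> (\<theta> z has_derivative (\<lambda>h. \<theta>' z y \<bullet> h)) (at y)"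
    and \<theta>c: "\<And>z. z \<in> Z \<Longrightarrow> continuous_on (closure \<Omega>) (\<theta>' z)"
    and \<theta>0: "\<And>z y. 0 \<le> \<theta> z y"
    and \<theta>1: "\<And>y. y \<in> closure \<Omega> \<Longrightarrow> (\<Sum>z\<in>Z. \<theta> z y) = 1"
    and \<theta>'0: "\<And>y. y \<in> \<Omega> \<Longrightarrow> (\<Sum>z\<in>Z. \<theta>' z y) = 0"
    by (rule lipschitz_domain_partition[OF \<Omega>l]) (rule that)
  have cl: "y \<in> closure \<Omega>" if "y \<in> \<Omega>" for y using subsetD[OF closure_subset that] .
  have cc: "compact (closure \<Omega>)" using \<Omega>(2) by (simp add: compact_closure)
  have \<theta>le: "\<bar>\<theta> z y\<bar> \<le> 1" if z: "z \<in> Z" and y: "y \<in> \<Omega>" for z y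
  proof -
    have "\<theta> z y \<le> (\<Sum>z\<in>Z. \<theta> z y)" by (rule member_le_sum[OF z]) (auto simp: \<theta>0 Z)
    then show ?thesis using \<theta>1[OF cl[OF y]] \<theta>0[of z y] by simp
  qed
  have "\<exists>C. \<forall>y\<in>\<Omega>. norm (\<theta>' z y) \<le> C" if z: "z \<in> Z" for z
  proof -
    have "bounded (\<theta>' z ` closure \<Omega>)"
      by (rule compact_imp_bounded[OF compact_continuous_image[OF \<theta>c[OF z] cc]])
    then obtain C where "\<forall>x\<in>\<theta>' z ` closure \<Omega>. norm x \<le> C" unfolding bounded_iff by blast
    then show ?thesis using cl by (intro exI[of _ C]) simp
  qed
  then obtain C where C: "\<And>z y. z \<in> Z \<Longrightarrow> y \<in> \<Omega> \<Longrightarrow> norm (\<theta>' z y) \<le> C z" by metis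
  have \<theta>c\<Omega>: "continuous_on \<Omega> (\<theta>' z)" if "z \<in> Z" for z
    by (rule continuous_on_subset[OF \<theta>c[OF that] closure_subset])

  \<comment> \<open>The cone property is stated for 0 < t <= 1, which t n = 1 / (n + 1) meets from n
    = 0 on.\<close>
  define t where "t n = inverse (real (Suc n))" for n
  have t: "t n > 0" "t n \<le> 1" for n by (simp_all add: t_def inverse_le_1_iff)
  have t0: "t \<longlonglongrightarrow> 0" unfolding t_def by (rule LIMSEQ_inverse_real_of_nat)
  \<comment> \<open>One kernel per n and z; the choice is meaningful only for z in Z, where \<rho> z
    > 0.\<close>
  define k where "k n z = (SOME k. \<exists>G. smooth_kernel (t n *\<^sub>R c z) (t n * \<rho> z) k G)" for n z
  have k: "\<exists>G. smooth_kernel (t n *\<^sub>R c z) (t n * \<rho> z) (k n z) G" if z: "z \<in> Z" for n z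
  proof -
    have "t n * \<rho> z > 0" using t(1)[of n] \<rho>[OF z] by simp
    then show ?thesis unfolding k_def by (rule someI_ex[OF smooth_kernel_exists])
  qed
  define R where "R z n = norm (t n *\<^sub>R c z) + t n * \<rho> z" for z n
  have kk: "kernel (R z n) (k n z)" if "z \<in> Z" for n z
    using k[OF that, of n] by (auto simp: smooth_kernel_def R_def)
  have R0: "R z \<longlonglongrightarrow> 0" for z
  proof -
    have "(\<lambda>n. norm (t n *\<^sub>R c z) + t n * \<rho> z) \<longlonglongrightarrow> norm (0 *\<^sub>R c z) + 0 * \<rho> z"
      by (intro tendsto_intros t0)
    then show ?thesis by (simp add: R_def[abs_def])
  qed

  define P where "P n z x = (\<integral>y. k n z (x - y) *\<^sub>R (\<theta> z y *\<^sub>R q y) \<partial>?M)" for n z x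
  define g where "g z y = \<theta> z y * d y + \<theta>' z y \<bullet> q y" for z y
  define q0 where "q0 n x = (\<Sum>z\<in>Z. P n z x)" for n x
  have FL: "(\<lambda>y. \<theta> z y *\<^sub>R q y) \<in> L2 \<Omega>" and gL: "g z \<in> L2 \<Omega>" if z: "z \<in> Z" for z
  proof -
    \<comment> \<open>The two memberships do not depend on the kernel, so any index would do; n = 0
      is taken.\<close>
    obtain G where G: "smooth_kernel (t 0 *\<^sub>R c z) (t 0 * \<rho> z) (k 0 z) G" using k[OF z] by blast
    note m = dvg_mollified[OF \<Omega> G q d green \<theta>d[OF z cl] \<theta>c\<Omega>[OF z] \<theta>le[OF z] C[OF z]]
    show "(\<lambda>y. \<theta> z y *\<^sub>R q y) \<in> L2 \<Omega>" by (rule m(1))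
    show "g z \<in> L2 \<Omega>" unfolding g_def[abs_def] by (rule m(2))
  qed
  have dvP: "dvg (P n z) x = (\<integral>y. k n z (x - y) * g z y \<partial>?M)" if z: "z \<in> Z" for n z x
  proof -
    obtain G where G: "smooth_kernel (t n *\<^sub>R c z) (t n * \<rho> z) (k n z) G" using k[OF z] by blast
    show ?thesis unfolding P_def[abs_def] g_def[abs_def]
      by (rule dvg_mollified(3)[OF \<Omega> G q d green \<theta>d[OF z cl] \<theta>c\<Omega>[OF z] \<theta>le[OF z] C[OF z]])
  qed
  have PC: "P n z \<in> C01 \<Omega>" if z: "z \<in> Z" for n z
  proof -
    obtain G where G: "smooth_kernel (t n *\<^sub>R c z) (t n * \<rho> z) (k n z) G" using k[OF z] by blast
    show ?thesis unfolding P_def[abs_def]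
    proof (rule mollified_C01[OF \<Omega> t(1) G L2_integrable[OF \<Omega> FL[OF z]]])
      show "y \<in> cball z (r z)" if "\<theta> z y *\<^sub>R q y \<noteq> 0" for y using \<theta>s[OF z] that by auto
      show "y + t n *\<^sub>R w \<in> \<Omega>" if "y \<in> closure \<Omega> \<inter> cball z (r z)" "w \<in> cball (c z) (\<rho> z)" for y w
        by (rule cone[OF z that t])
    qed
  qed
  have q0C: "q0 n \<in> C01 \<Omega>" for n
    unfolding q0_def[abs_def] by (rule C01_sum[OF PC \<Omega>(1)])

  \<comment> \<open>Near x each \<theta> z is within e' of its value at x and |q| <= 1, so the
    average \<open>P n z x\<close> has norm at most \<theta> z x + e'. The kernels differ from piece
    to piece, yet the weights frozen at x still sum to 1.\<close>
  have bound: "\<forall>\<^sub>F n in sequentially. \<forall>x. norm (q0 n x) \<le> 1 + e" if e: "e > 0" for e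
  proof -
    \<comment> \<open>The pieces contribute card Z errors, which must add up to at most e; the
      summand 1 avoids division by zero.\<close>
    define e' where "e' = e / (real (card Z) + 1)"
    have e': "e' > 0" using e by (simp add: e'_def)
    have "\<forall>\<^sub>F n in sequentially. \<forall>x\<in>\<Omega>. norm (P n z x) \<le> \<theta> z x + e'" if z: "z \<in> Z" for z
    proof -
      have "continuous_on (closure \<Omega>) (\<theta> z)"
        using has_derivative_continuous[OF \<theta>d[OF z]] by (simp add: continuous_at_imp_continuous_on)
      then have "uniformly_continuous_on (closure \<Omega>) (\<theta> z)" using cc by (rule compact_uniformly_continuous)
      from this[unfolded uniformly_continuous_on_def, rule_format, OF e']
      obtain \<delta> where \<delta>: "\<delta> > 0" and uc: "\<forall>x\<in>closure \<Omega>. \<forall>x'\<in>closure \<Omega>. dist x' x < \<delta> \<longrightarrow> dist (\<theta> z x') (\<theta> z x) < e'"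
        by blast
      have "\<forall>\<^sub>F n in sequentially. R z n < \<delta>" by (rule order_tendstoD(2)[OF R0 \<delta>])
      then show ?thesis
      proof eventually_elim
        fix n assume Rn: "R z n < \<delta>"
        show "\<forall>x\<in>\<Omega>. norm (P n z x) \<le> \<theta> z x + e'"
        proof
          fix x assume x: "x \<in> \<Omega>"
          show "norm (P n z x) \<le> \<theta> z x + e'"
            unfolding P_def
          proof (rule kernel_conv_bound[OF kk[OF z] _ L2_integrable[OF \<Omega> FL[OF z]]])
            show "AE y in ?M. norm (x - y) \<le> R z n \<longrightarrow> norm (\<theta> z y *\<^sub>R q y) \<le> \<theta> z x + e'"
              using q1 AE_space
            proof (eventually_elim, intro impI)
              fix y assume qy: "norm (q y) \<le> 1" and "y \<in> space ?M" and xy: "norm (x - y) \<le> R z n"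
              then have y: "y \<in> \<Omega>" by (simp add: space_restrict_space)
              have "dist y x < \<delta>" using Rn xy by (simp add: dist_norm norm_minus_commute)
              then have "dist (\<theta> z y) (\<theta> z x) < e'" using uc cl[OF x] cl[OF y] by blast
              then have "\<theta> z y \<le> \<theta> z x + e'" by (simp add: dist_real_def)
              moreover have "norm (\<theta> z y *\<^sub>R q y) \<le> \<theta> z y"
                using mult_left_mono[OF qy \<theta>0[of z y]] \<theta>0[of z y] by simp
              ultimately show "norm (\<theta> z y *\<^sub>R q y) \<le> \<theta> z x + e'" by simp
            qed
          qed (use \<theta>0[of z x] e' \<Omega>(1) in simp_all)
        qed
      qed
    qed
    then have "\<forall>\<^sub>F n in sequentially. \<forall>z\<in>Z. \<forall>x\<in>\<Omega>. norm (P n z x) \<le> \<theta> z x + e'"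
      using Z by (intro eventually_ball_finite) auto
    then show ?thesis
    proof eventually_elim
      fix n assume n: "\<forall>z\<in>Z. \<forall>x\<in>\<Omega>. norm (P n z x) \<le> \<theta> z x + e'"
      show "\<forall>x. norm (q0 n x) \<le> 1 + e"
      proof
        fix x
        show "norm (q0 n x) \<le> 1 + e"
        proof (cases "x \<in> \<Omega>")
          case True
          have "norm (q0 n x) \<le> (\<Sum>z\<in>Z. norm (P n z x))" unfolding q0_def by (rule norm_sum)
          also have "\<dots> \<le> (\<Sum>z\<in>Z. \<theta> z x + e')" using n True by (intro sum_mono) simp
          also have "\<dots> = 1 + real (card Z) * e'" using \<theta>1[OF cl[OF True]] by (simp add: sum.distrib)
          also have "\<dots> \<le> 1 + e"
          proof -
            have "real (card Z) * e' \<le> (real (card Z) + 1) * e'" using e' by (intro mult_right_mono) auto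
            also have "\<dots> = e" by (simp add: e'_def)
            finally show ?thesis by simp
          qed
          finally show ?thesis .
        next
          \<comment> \<open>Outside \<Omega> the weights are not controlled, but \<open>q0 n\<close>
            vanishes there by its support; the supremum below runs over the whole plane.\<close>
          case False
          obtain f' S where "\<And>x. (q0 n has_derivative blinfun_apply (f' x)) (at x)" "continuous_on UNIV f'"
            "compact S" and S: "S \<subseteq> \<Omega>" and S0: "\<And>x. x \<notin> S \<Longrightarrow> q0 n x = 0" and "\<And>x. x \<notin> S \<Longrightarrow> f' x = 0"
            by (rule C01E[OF q0C[of n] \<Omega>(1)]) (rule that)
          have "q0 n x = 0" using S False by (intro S0) blast
          then show ?thesis using e by simp
        qed
      qed
    qed
  qed
  \<comment> \<open>The overshoot of \<open>q0 n\<close>. The maximum with 1 keeps the divisor away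
    from 0 and gives the lower half of the limit for free.\<close>
  define a where "a n = max 1 (SUP x. norm (q0 n x))" for n
  have a1: "a n \<ge> 1" for n by (simp add: a_def)
  have qa: "norm (q0 n x) \<le> a n" for n x
  proof -
    obtain B where "B \<ge> 0" and B: "\<And>x. norm (q0 n x) \<le> B"
      by (rule C01_bounded[OF q0C[of n] \<Omega>(1)]) (rule that)
    have "norm (q0 n x) \<le> (SUP x. norm (q0 n x))"
      by (rule cSUP_upper) (auto intro!: bdd_aboveI[of _ B] B)
    then show ?thesis by (simp add: a_def)
  qed
  have alim: "a \<longlonglongrightarrow> 1"
  proof (rule order_tendstoI)
    show "\<forall>\<^sub>F n in sequentially. l < a n" if "l < 1" for l
      using that a1 by (intro always_eventually allI) (rule less_le_trans)
    show "\<forall>\<^sub>F n in sequentially. a n < u" if "1 < u" for u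
    proof -
      have "(u - 1) / 2 > 0" using that by simp
      from bound[OF this] show ?thesis
      proof eventually_elim
        fix n assume n: "\<forall>x. norm (q0 n x) \<le> 1 + (u - 1) / 2"
        then have "(SUP x. norm (q0 n x)) \<le> 1 + (u - 1) / 2" by (intro cSUP_least) auto
        moreover have "1 + (u - 1) / 2 < u" using that by (simp add: field_simps)
        ultimately have "(SUP x. norm (q0 n x)) < u" by (rule le_less_trans)
        then show "a n < u" using that by (simp add: a_def)
      qed
    qed
  qed
  define Q where "Q n x = (1 / a n) *\<^sub>R q0 n x" for n x
  have QC: "Q n \<in> C01 \<Omega>" for n unfolding Q_def[abs_def] by (rule C01_scaleR[OF q0C \<Omega>(1)])
  have Q1: "norm (Q n x) \<le> 1" for n x
    using qa[of n x] a1[of n] by (simp add: Q_def divide_le_eq)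
  have dvQ: "dvg (Q n) x = (1 / a n) * (\<Sum>z\<in>Z. \<integral>y. k n z (x - y) * g z y \<partial>?M)" for n x
  proof -
    have "dvg (Q n) x = (1 / a n) * dvg (q0 n) x"
      unfolding Q_def[abs_def] by (rule dvg_scaleR[OF q0C \<Omega>(1)])
    also have "dvg (q0 n) x = (\<Sum>z\<in>Z. dvg (P n z) x)"
      unfolding q0_def[abs_def] by (rule dvg_sum[OF PC \<Omega>(1)])
    finally show ?thesis by (simp add: dvP)
  qed
  have "(\<lambda>n. L2_inner \<Omega> v (dvg (Q n))) \<longlonglongrightarrow> L2_inner \<Omega> v d" if v: "v \<in> L2 \<Omega>" for v
  proof -
    have "L2_inner \<Omega> v (dvg (Q n)) = (1 / a n) * (\<Sum>z\<in>Z. \<integral>x. v x * (\<integral>y. k n z (x - y) * g z y \<partial>?M) \<partial>?M)" for n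
    proof -
      have "L2_inner \<Omega> v (dvg (Q n)) = (\<integral>x. (1 / a n) * (\<Sum>z\<in>Z. v x * (\<integral>y. k n z (x - y) * g z y \<partial>?M)) \<partial>?M)"
        unfolding L2_inner_def dvQ by (intro Bochner_Integration.integral_cong refl) (simp add: sum_distrib_left mult_ac)
      also have "\<dots> = (1 / a n) * (\<integral>x. (\<Sum>z\<in>Z. v x * (\<integral>y. k n z (x - y) * g z y \<partial>?M)) \<partial>?M)"
        by (rule integral_mult_right_zero)
      also have "(\<integral>x. (\<Sum>z\<in>Z. v x * (\<integral>y. k n z (x - y) * g z y \<partial>?M)) \<partial>?M) = (\<Sum>z\<in>Z. \<integral>x. v x * (\<integral>y. k n z (x - y) * g z y \<partial>?M) \<partial>?M)"
        by (rule Bochner_Integration.integral_sum) (rule kernel_form_bound(1)[OF kk \<Omega> v gL zero_less_one])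
      finally show ?thesis .
    qed
    moreover have "(\<lambda>n. (1 / a n) * (\<Sum>z\<in>Z. \<integral>x. v x * (\<integral>y. k n z (x - y) * g z y \<partial>?M) \<partial>?M)) \<longlonglongrightarrow> (1 / 1) * (\<Sum>z\<in>Z. L2_inner \<Omega> v (g z))"
      by (intro tendsto_mult tendsto_divide tendsto_const alim tendsto_sum kernel_form_tendsto[OF kk R0 \<Omega> v gL]) simp_all
    moreover have "(\<Sum>z\<in>Z. L2_inner \<Omega> v (g z)) = L2_inner \<Omega> v d"
    proof -
      have "(\<Sum>z\<in>Z. L2_inner \<Omega> v (g z)) = (\<integral>x. (\<Sum>z\<in>Z. v x \<bullet> g z x) \<partial>?M)"
        unfolding L2_inner_def by (rule Bochner_Integration.integral_sum[symmetric]) (rule L2_inner_integrable[OF v gL])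
      also have "\<dots> = L2_inner \<Omega> v d"
        unfolding L2_inner_def
      proof (rule Bochner_Integration.integral_cong[OF refl])
        fix x assume "x \<in> space ?M"
        then have x: "x \<in> \<Omega>" by (simp add: space_restrict_space)
        \<comment> \<open>The weights sum to 1 and their gradients to 0, so d is recovered.\<close>
        have "(\<Sum>z\<in>Z. g z x) = (\<Sum>z\<in>Z. \<theta> z x) * d x + (\<Sum>z\<in>Z. \<theta>' z x) \<bullet> q x"
          by (simp add: g_def sum.distrib sum_distrib_right inner_sum_left)
        also have "\<dots> = d x" using \<theta>1[OF cl[OF x]] \<theta>'0[OF x] by simp
        finally show "(\<Sum>z\<in>Z. v x \<bullet> g z x) = v x \<bullet> d x" by (simp flip: sum_distrib_left)
      qed
      finally show ?thesis .
    qed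
    ultimately show ?thesis by simp
  qed
  with QC Q1 show ?thesis by (intro exI[of _ Q]) blast
qed

section \<open>The dual problem\<close>

lemma has_L2_div_L2_div: "\<exists>d. has_L2_div \<Omega> q d \<Longrightarrow> has_L2_div \<Omega> q (L2_div \<Omega> q)"
  unfolding L2_div_def by (rule someI_ex[of "has_L2_div \<Omega> q"])

text \<open>The constraint on the dual variable is columnwise, so the columns are approximated
  independently and then assembled. Every assembled field is admissible in \<open>TV\<close>, and
  the bound passes to the weak limit.\<close>

lemma column_approximation_TV:
  fixes p :: "real ^ 2 \<Rightarrow> real ^ 2 ^ 2" and v :: "real ^ 2 \<Rightarrow> real ^ 2"
  assumes \<Omega>l: "lipschitz_domain \<Omega>" and p: "p \<in> column_ball \<Omega> (H0div \<Omega>)" and v: "v \<in> L2 \<Omega>"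
  shows "L2_mdiv \<Omega> p \<in> L2 \<Omega>" and "ereal (L2_inner \<Omega> v (L2_mdiv \<Omega> p)) \<le> TV \<Omega> v"
proof -
  have \<Omega>: "open \<Omega>" "bounded \<Omega>" using \<Omega>l by (simp_all add: lipschitz_domain_def)
  let ?M = "lebesgue_on \<Omega>"
  define q where "q i x = column i (p x)" for i x
  define d where "d i = L2_div \<Omega> (q i)" for i
  have pH: "p \<in> H0div \<Omega>" and p1: "AE x in ?M. norm (q i x) \<le> 1" for i
    using p by (auto simp: column_ball_def q_def)
  have pL: "p \<in> L2 \<Omega>" using pH by (simp add: H0div_def)
  have ex: "\<exists>d. has_L2_div \<Omega> (q i) d" and tr: "\<And>\<phi>. \<phi> \<in> H1 \<Omega> \<Longrightarrow> normal_trace \<Omega> (q i) \<phi> = 0" for i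
    using pH unfolding H0div_def q_def[abs_def] by blast+
  have dL: "d i \<in> L2 \<Omega>" for i
    using has_L2_div_L2_div[OF ex[of i]] by (simp add: d_def has_L2_div_def)
  have qL: "q i \<in> L2 \<Omega>" for i
    unfolding q_def[abs_def] by (rule L2_bounded_linear[OF bounded_linear_column pL])
  have md: "L2_mdiv \<Omega> p = (\<lambda>x. \<Sum>i\<in>UNIV. d i x *\<^sub>R axis i 1)"
    by (rule ext) (simp add: vec_eq_iff L2_mdiv_def d_def q_def[abs_def] axis_def if_distrib[of "\<lambda>x. _ * x"] cong: if_cong)
  show mdL: "L2_mdiv \<Omega> p \<in> L2 \<Omega>" unfolding md by (rule L2_sum[OF L2_scaleR_const[OF dL]])
  have vi: "(\<lambda>x. v x $ i) \<in> L2 \<Omega>" for i by (rule L2_component[OF v])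
  have "\<exists>Q. (\<forall>n. Q n \<in> C01 \<Omega> \<and> (\<forall>x. norm (Q n x) \<le> 1)) \<and>
    (\<forall>v \<in> L2 \<Omega>. (\<lambda>n. L2_inner \<Omega> v (dvg (Q n))) \<longlonglongrightarrow> L2_inner \<Omega> v (d i))" for i
    by (rule column_approximation[OF \<Omega>l qL p1 dL]) (use tr in \<open>simp add: normal_trace_def d_def\<close>)
  then have "\<exists>Q. \<forall>i. (\<forall>n. Q i n \<in> C01 \<Omega> \<and> (\<forall>x. norm (Q i n x) \<le> 1)) \<and>
    (\<forall>v \<in> L2 \<Omega>. (\<lambda>n. L2_inner \<Omega> v (dvg (Q i n))) \<longlonglongrightarrow> L2_inner \<Omega> v (d i))"
    by (intro choice allI)
  then obtain Q where Q: "\<And>i n. Q i n \<in> C01 \<Omega>" "\<And>i n x. norm (Q i n x) \<le> 1"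
    and Ql: "\<And>i v. v \<in> L2 \<Omega> \<Longrightarrow> (\<lambda>n. L2_inner \<Omega> v (dvg (Q i n))) \<longlonglongrightarrow> L2_inner \<Omega> v (d i)"
    by blast
  \<comment> \<open>\<open>E i\<close> places a vector in column i with zeros elsewhere; being
    linear it preserves \<open>C01\<close>.\<close>
  define E where "E i u = (\<chi> j. \<chi> i'. if i' = i then u $ j else (0 :: real))" for i :: 2 and u :: "real ^ 2"
  have E: "bounded_linear (E i)" for i
    by (rule linear_conv_bounded_linear[THEN iffD1], rule linearI) (simp_all add: E_def vec_eq_iff)
  define P where "P n x = (\<Sum>i\<in>UNIV. E i (Q i n x))" for n x
  have PC: "P n \<in> C01 \<Omega>" for n
    unfolding P_def[abs_def] by (intro C01_sum C01_linear[OF E] Q \<Omega>(1))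
  have Pc: "column i (P n x) = Q i n x" for i n x
    by (simp add: P_def E_def column_def vec_eq_iff if_distrib cong: if_cong)
  have PB: "P n \<in> column_ball \<Omega> (C01 \<Omega>)" for n
    using PC Q(2) by (simp add: column_ball_def Pc)
  have Pd: "mdvg (P n) x $ i = dvg (Q i n) x" for i n x
    by (simp add: mdvg_def Pc)
  have le: "ereal (\<Sum>i\<in>UNIV. L2_inner \<Omega> (\<lambda>x. v x $ i) (dvg (Q i n))) \<le> TV \<Omega> v" for n
  proof -
    have "(\<Sum>i\<in>UNIV. L2_inner \<Omega> (\<lambda>x. v x $ i) (dvg (Q i n))) = (\<integral>x. (\<Sum>i\<in>UNIV. (v x $ i) \<bullet> dvg (Q i n) x) \<partial>?M)"
      unfolding L2_inner_def
      by (rule Bochner_Integration.integral_sum[symmetric])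
        (rule L2_inner_integrable[OF vi C01_integration_by_parts(1)[OF \<Omega> Q(1)]])
    also have "\<dots> = (\<integral>x. v x \<bullet> mdvg (P n) x \<partial>?M)"
      by (simp add: inner_vec_def Pd)
    finally show ?thesis unfolding TV_def using PB[of n] by (auto intro: SUP_upper2)
  qed
  have "(\<lambda>n. \<Sum>i\<in>UNIV. L2_inner \<Omega> (\<lambda>x. v x $ i) (dvg (Q i n))) \<longlonglongrightarrow> (\<Sum>i\<in>UNIV. L2_inner \<Omega> (\<lambda>x. v x $ i) (d i))"
    by (intro tendsto_sum Ql vi)
  then have "(\<lambda>n. ereal (\<Sum>i\<in>UNIV. L2_inner \<Omega> (\<lambda>x. v x $ i) (dvg (Q i n)))) \<longlonglongrightarrow> ereal (\<Sum>i\<in>UNIV. L2_inner \<Omega> (\<lambda>x. v x $ i) (d i))"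
    by (rule tendsto_ereal)
  then have "ereal (\<Sum>i\<in>UNIV. L2_inner \<Omega> (\<lambda>x. v x $ i) (d i)) \<le> TV \<Omega> v"
    by (rule LIMSEQ_le_const2) (use le in blast)
  moreover have "(\<Sum>i\<in>UNIV. L2_inner \<Omega> (\<lambda>x. v x $ i) (d i)) = L2_inner \<Omega> v (L2_mdiv \<Omega> p)"
  proof -
    have "(\<Sum>i\<in>UNIV. L2_inner \<Omega> (\<lambda>x. v x $ i) (d i)) = (\<integral>x. (\<Sum>i\<in>UNIV. (v x $ i) \<bullet> d i x) \<partial>?M)"
      unfolding L2_inner_def
      by (rule Bochner_Integration.integral_sum[symmetric]) (rule L2_inner_integrable[OF vi dL])
    also have "\<dots> = L2_inner \<Omega> v (L2_mdiv \<Omega> p)"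
      unfolding L2_inner_def by (simp add: inner_vec_def L2_mdiv_def d_def q_def[abs_def])
    finally show ?thesis .
  qed
  ultimately show "ereal (L2_inner \<Omega> v (L2_mdiv \<Omega> p)) \<le> TV \<Omega> v" by simp
qed

text \<open>Puts the divergence free fields into the form of an annihilator, as
  \<open>L2_projection_exists\<close> demands.\<close>

lemma div_free_iff: "div_free \<Omega> = {\<tau> \<in> L2 \<Omega>. \<forall>w \<in> (\<lambda>\<phi> x. - weak_grad \<Omega> \<phi> x) ` H01 \<Omega>. L2_inner \<Omega> \<tau> w = 0}"
  by (simp add: div_free_def dist_div_def)

lemma div_free_L2: "f \<in> div_free \<Omega> \<Longrightarrow> f \<in> L2 \<Omega>"
  by (simp add: div_free_def)

lemma weak_grad_H01_L2: "\<phi> \<in> H01 \<Omega> \<Longrightarrow> (\<lambda>x. - weak_grad \<Omega> \<phi> x) \<in> L2 \<Omega>"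
  using H01_subset_H1 has_weak_grad_weak_grad(2) by (blast intro: L2_minus)

lemma div_free_add_scaleR:
  assumes "f \<in> div_free \<Omega>" "g \<in> div_free \<Omega>"
  shows "(\<lambda>x. f x + s *\<^sub>R g x) \<in> div_free \<Omega>"
  using assms weak_grad_H01_L2
  by (auto simp: div_free_iff L2_add L2_scaleR L2_inner_add_left L2_inner_scaleR_left)

text \<open>Once existence is known, the choice in \<open>L2_proj\<close> is harmless. The second
  part lets the projection be dropped in pairings with divergence free fields; it stands in for
  linearity of \<open>L2_proj\<close>, which is never claimed.\<close>

lemma L2_proj_div_free:
  fixes f :: "real ^ 2 \<Rightarrow> real ^ 2"
  assumes f: "f \<in> L2 \<Omega>"
  shows "L2_proj \<Omega> (div_free \<Omega>) f \<in> div_free \<Omega>"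
    and "k \<in> div_free \<Omega> \<Longrightarrow> L2_inner \<Omega> (L2_proj \<Omega> (div_free \<Omega>) f) k = L2_inner \<Omega> f k"
proof -
  have "\<exists>g \<in> div_free \<Omega>. \<forall>k \<in> div_free \<Omega>. L2_inner \<Omega> (\<lambda>x. f x - g x) k = 0"
    by (rule L2_projection_exists[OF f _ div_free_iff]) (use weak_grad_H01_L2 in blast)
  then have "\<exists>g. g \<in> div_free \<Omega> \<and> (\<forall>k \<in> div_free \<Omega>. L2_inner \<Omega> (\<lambda>x. f x - g x) k = 0)" by blast
  from someI_ex[OF this]
  have *: "L2_proj \<Omega> (div_free \<Omega>) f \<in> div_free \<Omega>"
    "\<forall>k \<in> div_free \<Omega>. L2_inner \<Omega> (\<lambda>x. f x - L2_proj \<Omega> (div_free \<Omega>) f x) k = 0"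
    unfolding L2_proj_def by blast+
  show "L2_proj \<Omega> (div_free \<Omega>) f \<in> div_free \<Omega>" by (rule *(1))
  show "L2_inner \<Omega> (L2_proj \<Omega> (div_free \<Omega>) f) k = L2_inner \<Omega> f k" if k: "k \<in> div_free \<Omega>"
    using bspec[OF *(2) k] L2_inner_diff_left[OF f div_free_L2[OF *(1)] div_free_L2[OF k]] by simp
qed

lemma has_L2_div_affine:
  assumes q: "q \<in> L2 \<Omega>" "q' \<in> L2 \<Omega>" and d: "has_L2_div \<Omega> q d" "has_L2_div \<Omega> q' d'"
  shows "has_L2_div \<Omega> (\<lambda>x. a *\<^sub>R q x + b *\<^sub>R q' x) (\<lambda>x. a *\<^sub>R d x + b *\<^sub>R d' x)"
  unfolding has_L2_div_def dist_div_def
proof (intro conjI ballI)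
  have dL: "d \<in> L2 \<Omega>" "d' \<in> L2 \<Omega>" using d by (auto simp: has_L2_div_def)
  show "(\<lambda>x. a *\<^sub>R d x + b *\<^sub>R d' x) \<in> L2 \<Omega>" by (intro L2_add L2_scaleR dL)
  fix \<phi> assume \<phi>: "\<phi> \<in> H01 \<Omega>"
  have \<phi>L: "\<phi> \<in> L2 \<Omega>" using \<phi> H01_subset_H1 has_weak_grad_weak_grad(3) by blast
  have "L2_inner \<Omega> q (\<lambda>x. - weak_grad \<Omega> \<phi> x) = L2_inner \<Omega> d \<phi>"
    "L2_inner \<Omega> q' (\<lambda>x. - weak_grad \<Omega> \<phi> x) = L2_inner \<Omega> d' \<phi>"
    using d \<phi> by (simp_all add: has_L2_div_def dist_div_def)
  then show "L2_inner \<Omega> (\<lambda>x. a *\<^sub>R q x + b *\<^sub>R q' x) (\<lambda>x. - weak_grad \<Omega> \<phi> x) = L2_inner \<Omega> (\<lambda>x. a *\<^sub>R d x + b *\<^sub>R d' x) \<phi>"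
    by (simp only: L2_inner_add_left[OF L2_scaleR L2_scaleR] q dL \<phi>L weak_grad_H01_L2[OF \<phi>] L2_inner_scaleR_left)
qed

text \<open>\<open>L2_div\<close> is a chosen representative, so it is linear only almost
  everywhere, by uniqueness. The traces and \<open>L2_mdiv\<close> of the combination are both
  reduced to the affine combination of the given representatives.\<close>

lemma column_ball_H0div_convex:
  fixes p p' :: "real ^ 2 \<Rightarrow> real ^ 'c ^ 2"
  assumes \<Omega>: "open \<Omega>" "bounded \<Omega>" and p: "p \<in> column_ball \<Omega> (H0div \<Omega>)" and p': "p' \<in> column_ball \<Omega> (H0div \<Omega>)"
    and ab: "a \<ge> 0" "b \<ge> 0" "a + b = 1"
  shows "(\<lambda>x. a *\<^sub>R p x + b *\<^sub>R p' x) \<in> column_ball \<Omega> (H0div \<Omega>)"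
    and "AE x in lebesgue_on \<Omega>. L2_mdiv \<Omega> (\<lambda>x. a *\<^sub>R p x + b *\<^sub>R p' x) x = a *\<^sub>R L2_mdiv \<Omega> p x + b *\<^sub>R L2_mdiv \<Omega> p' x"
proof -
  let ?M = "lebesgue_on \<Omega>"
  let ?r = "\<lambda>x. a *\<^sub>R p x + b *\<^sub>R p' x"
  have L: "p \<in> L2 \<Omega>" "p' \<in> L2 \<Omega>" using p p' by (simp_all add: column_ball_def H0div_def)
  note colL = L2_bounded_linear[OF bounded_linear_column]
  have col: "column i (?r x) = a *\<^sub>R column i (p x) + b *\<^sub>R column i (p' x)" for i x
    by (simp add: column_def vec_eq_iff)
  define d where "d i = L2_div \<Omega> (\<lambda>x. column i (p x))" for i
  define d' where "d' i = L2_div \<Omega> (\<lambda>x. column i (p' x))" for i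
  have hd: "has_L2_div \<Omega> (\<lambda>x. column i (p x)) (d i)" and hd': "has_L2_div \<Omega> (\<lambda>x. column i (p' x)) (d' i)" for i
    using p p' unfolding d_def d'_def column_ball_def H0div_def by (blast intro: has_L2_div_L2_div)+
  have tr: "normal_trace \<Omega> (\<lambda>x. column i (p x)) \<phi> = 0" "normal_trace \<Omega> (\<lambda>x. column i (p' x)) \<phi> = 0"
    if "\<phi> \<in> H1 \<Omega>" for i \<phi>
    using p p' that unfolding column_ball_def H0div_def by blast+
  have hr: "has_L2_div \<Omega> (\<lambda>x. column i (?r x)) (\<lambda>x. a *\<^sub>R d i x + b *\<^sub>R d' i x)" for i
    unfolding col by (rule has_L2_div_affine[OF colL[OF L(1)] colL[OF L(2)] hd hd'])
  have hr': "has_L2_div \<Omega> (\<lambda>x. column i (?r x)) (L2_div \<Omega> (\<lambda>x. column i (?r x)))" for i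
    using hr by (blast intro: has_L2_div_L2_div)
  have ae: "AE x in ?M. L2_div \<Omega> (\<lambda>x. column i (?r x)) x = a *\<^sub>R d i x + b *\<^sub>R d' i x" for i
    by (rule has_L2_div_unique[OF \<Omega> hr' hr])
  have dL: "d i \<in> L2 \<Omega>" "d' i \<in> L2 \<Omega>" for i using hd[of i] hd'[of i] by (simp_all add: has_L2_div_def)
  have trr: "normal_trace \<Omega> (\<lambda>x. column i (?r x)) \<phi> = 0" if \<phi>: "\<phi> \<in> H1 \<Omega>" for i \<phi>
  proof -
    note \<phi>L = has_weak_grad_weak_grad(2,3)[OF \<phi>]
    have "L2_inner \<Omega> (L2_div \<Omega> (\<lambda>x. column i (?r x))) \<phi> = L2_inner \<Omega> (\<lambda>x. a *\<^sub>R d i x + b *\<^sub>R d' i x) \<phi>"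
      using ae hr[of i] hr'[of i] \<phi>L by (intro L2_inner_cong_AE) (auto simp: has_L2_div_def)
    also have "\<dots> = a * L2_inner \<Omega> (d i) \<phi> + b * L2_inner \<Omega> (d' i) \<phi>"
      by (simp only: L2_inner_add_left[OF L2_scaleR L2_scaleR] dL \<phi>L L2_inner_scaleR_left)
    finally have 1: "L2_inner \<Omega> (L2_div \<Omega> (\<lambda>x. column i (?r x))) \<phi> = a * L2_inner \<Omega> (d i) \<phi> + b * L2_inner \<Omega> (d' i) \<phi>" .
    have 2: "L2_inner \<Omega> (\<lambda>x. column i (?r x)) (weak_grad \<Omega> \<phi>)
      = a * L2_inner \<Omega> (\<lambda>x. column i (p x)) (weak_grad \<Omega> \<phi>) + b * L2_inner \<Omega> (\<lambda>x. column i (p' x)) (weak_grad \<Omega> \<phi>)"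
      unfolding col by (simp only: L2_inner_add_left[OF L2_scaleR L2_scaleR] colL L \<phi>L L2_inner_scaleR_left)
    have "normal_trace \<Omega> (\<lambda>x. column i (?r x)) \<phi> = a * normal_trace \<Omega> (\<lambda>x. column i (p x)) \<phi> + b * normal_trace \<Omega> (\<lambda>x. column i (p' x)) \<phi>"
      unfolding normal_trace_def 1 2 d_def d'_def by (simp add: distrib_left)
    then show ?thesis using tr[OF \<phi>] by simp
  qed
  have "AE x in ?M. norm (column i (?r x)) \<le> 1" for i
  proof -
    have "AE x in ?M. norm (column i (p x)) \<le> 1" "AE x in ?M. norm (column i (p' x)) \<le> 1"
      using p p' by (simp_all add: column_ball_def)
    then show ?thesis
    proof eventually_elim
      fix x assume n: "norm (column i (p x)) \<le> 1" "norm (column i (p' x)) \<le> 1"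
      have "norm (column i (?r x)) \<le> a * norm (column i (p x)) + b * norm (column i (p' x))"
        unfolding col using ab norm_triangle_ineq[of "a *\<^sub>R column i (p x)" "b *\<^sub>R column i (p' x)"] by simp
      also have "\<dots> \<le> a * 1 + b * 1" using n ab by (intro add_mono mult_left_mono) auto
      finally show "norm (column i (?r x)) \<le> 1" using ab by simp
    qed
  qed
  then show "?r \<in> column_ball \<Omega> (H0div \<Omega>)"
    unfolding column_ball_def H0div_def using L2_add[OF L2_scaleR[OF L(1)] L2_scaleR[OF L(2)]] hr trr by blast
  have "AE x in ?M. \<forall>i. L2_div \<Omega> (\<lambda>x. column i (?r x)) x = a *\<^sub>R d i x + b *\<^sub>R d' i x"
    using ae by (simp add: AE_all_countable)
  then show "AE x in ?M. L2_mdiv \<Omega> ?r x = a *\<^sub>R L2_mdiv \<Omega> p x + b *\<^sub>R L2_mdiv \<Omega> p' x"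
    by eventually_elim (simp add: L2_mdiv_def vec_eq_iff d_def d'_def)
qed

lemma mdvg_L2:
  fixes p :: "real ^ 2 \<Rightarrow> real ^ 'c ^ 2"
  assumes \<Omega>: "open \<Omega>" "bounded \<Omega>" and p: "p \<in> C01 \<Omega>"
  shows "mdvg p \<in> L2 \<Omega>"
proof -
  have dL: "dvg (\<lambda>y. column i (p y)) \<in> L2 \<Omega>" for i
    by (rule C01_integration_by_parts(1)[OF \<Omega> C01_linear[OF bounded_linear_column p \<Omega>(1)]])
  have "(\<lambda>x. dvg (\<lambda>y. column i (p y)) x *\<^sub>R (axis i 1 :: real ^ 'c)) \<in> L2 \<Omega>" for i
    by (rule L2_scaleR_const[OF dL])
  moreover have "mdvg p = (\<lambda>x. \<Sum>i\<in>UNIV. dvg (\<lambda>y. column i (p y)) x *\<^sub>R axis i 1)"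
    by (rule ext) (simp add: vec_eq_iff mdvg_def axis_def if_distrib[of "\<lambda>x. _ * x"] cong: if_cong)
  ultimately show ?thesis by (simp add: L2_sum)
qed

theorem corollary2:
  fixes \<Omega> :: "(real ^ 2) set" and \<delta> :: real
    and \<tau>0 \<tau> :: "real ^ 2 \<Rightarrow> real ^ 2" and p :: "real ^ 2 \<Rightarrow> real ^ 2 ^ 2"
  assumes "lipschitz_domain \<Omega>" and "\<delta> > 0" and "\<tau>0 \<in> div_free \<Omega>"
    and "is_arg_min
           (\<lambda>\<sigma> :: real ^ 2 \<Rightarrow> real ^ 2. TV \<Omega> \<sigma> + ereal (1 / (2 * \<delta>) * (L2_norm \<Omega> (\<lambda>x. \<sigma> x - \<tau>0 x))\<^sup>2))
           (\<lambda>\<sigma>. \<sigma> \<in> BV \<Omega> \<inter> L2 \<Omega> \<and> \<sigma> \<in> div_free \<Omega>) \<tau>"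
    and "is_arg_min
           (\<lambda>q :: real ^ 2 \<Rightarrow> real ^ 2 ^ 2.
              (L2_norm \<Omega> (\<lambda>x. L2_proj \<Omega> (div_free \<Omega>) (L2_mdiv \<Omega> q) x - inverse \<delta> *\<^sub>R \<tau>0 x))\<^sup>2)
           (\<lambda>q. q \<in> column_ball \<Omega> (H0div \<Omega>)) p"
  shows "AE x in lebesgue_on \<Omega>. \<tau> x = \<tau>0 x - \<delta> *\<^sub>R L2_proj \<Omega> (div_free \<Omega>) (L2_mdiv \<Omega> p) x"
proof -
  have \<Omega>: "open \<Omega>" "bounded \<Omega>" using assms(1) by (simp_all add: lipschitz_domain_def)
  let ?K = "div_free \<Omega>"
  let ?B = "column_ball \<Omega> (H0div \<Omega>) :: (real ^ 2 \<Rightarrow> real ^ 2 ^ 2) set"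
  let ?in = "L2_inner \<Omega>"
  note \<delta> = assms(2) and \<tau>0 = assms(3)
  note KL = div_free_L2
  define u where "u q = L2_proj \<Omega> ?K (L2_mdiv \<Omega> q)" for q :: "real ^ 2 \<Rightarrow> real ^ 2 ^ 2"
  define f where "f x = inverse \<delta> *\<^sub>R \<tau>0 x" for x
  have p: "p \<in> ?B"
    and pmin: "\<And>q. q \<in> ?B \<Longrightarrow> ?in (\<lambda>x. u p x - f x) (\<lambda>x. u p x - f x) \<le> ?in (\<lambda>x. u q x - f x) (\<lambda>x. u q x - f x)"
    using assms(5) unfolding is_arg_min_def u_def f_def L2_norm_square by (auto simp: not_less)
  have uK: "u q \<in> ?K" if "q \<in> ?B" for q
    unfolding u_def by (rule L2_proj_div_free(1)[OF column_approximation_TV(1)[OF assms(1) that L2_zero]])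
  have u_in: "?in (u q) k = ?in (L2_mdiv \<Omega> q) k" if "q \<in> ?B" "k \<in> ?K" for q k
    unfolding u_def by (rule L2_proj_div_free(2)[OF column_approximation_TV(1)[OF assms(1) that(1) L2_zero] that(2)])
  have upL: "u p \<in> L2 \<Omega>" by (rule KL[OF uK[OF p]])
  have zK: "(\<lambda>x. 0) \<in> ?K" by (simp add: div_free_iff L2_zero) (simp add: L2_inner_def)
  have fK: "f \<in> ?K" using div_free_add_scaleR[OF zK \<tau>0, of "inverse \<delta>"] by (simp add: f_def[abs_def])
  have fL: "f \<in> L2 \<Omega>" by (rule KL[OF fK])
  define \<sigma> where "\<sigma> x = \<tau>0 x - \<delta> *\<^sub>R u p x" for x
  have \<sigma>K: "\<sigma> \<in> ?K" using div_free_add_scaleR[OF \<tau>0 uK[OF p], of "- \<delta>"] by (simp add: \<sigma>_def[abs_def])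
  have \<sigma>L: "\<sigma> \<in> L2 \<Omega>" by (rule KL[OF \<sigma>K])
  have \<tau>0L: "\<tau>0 \<in> L2 \<Omega>" by (rule KL[OF \<tau>0])

  have variational: "?in \<sigma> (u q) \<le> ?in \<sigma> (u p)" if q: "q \<in> ?B" for q
  proof -
    have uqL: "u q \<in> L2 \<Omega>" by (rule KL[OF uK[OF q]])
    define e where "e x = u p x - f x" for x
    define h where "h x = u q x - u p x" for x
    have eL: "e \<in> L2 \<Omega>" unfolding e_def[abs_def] by (rule L2_diff[OF upL fL])
    have hL: "h \<in> L2 \<Omega>" unfolding h_def[abs_def] by (rule L2_diff[OF uqL upL])
    have eK: "e \<in> ?K" using div_free_add_scaleR[OF uK[OF p] fK, of "- 1"] by (simp add: e_def[abs_def])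
    have hK: "h \<in> ?K" using div_free_add_scaleR[OF uK[OF q] uK[OF p], of "- 1"] by (simp add: h_def[abs_def])
    \<comment> \<open>Minimality of p tested at the point with parameter s on the segment from p to
      q, which stays admissible by convexity; e is the residual at p and h the direction.\<close>
    have expand: "?in e e \<le> ?in e e + 2 * (s * ?in e h) + s * (s * ?in h h)" if s: "0 \<le> s" "s \<le> 1" for s
    proof -
      define r where "r x = (1 - s) *\<^sub>R p x + s *\<^sub>R q x" for x
      have s': "1 - s \<ge> 0" "(1 - s) + s = 1" using s by simp_all
      have rB: "r \<in> ?B" unfolding r_def[abs_def] by (rule column_ball_H0div_convex(1)[OF \<Omega> p q s'(1) s(1) s'(2)])
      have rae: "AE x in lebesgue_on \<Omega>. L2_mdiv \<Omega> r x = (1 - s) *\<^sub>R L2_mdiv \<Omega> p x + s *\<^sub>R L2_mdiv \<Omega> q x"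
        unfolding r_def[abs_def] by (rule column_ball_H0div_convex(2)[OF \<Omega> p q s'(1) s(1) s'(2)])
      have mL: "L2_mdiv \<Omega> y \<in> L2 \<Omega>" if "y \<in> ?B" for y
        by (rule column_approximation_TV(1)[OF assms(1) that L2_zero])
      \<comment> \<open>The chosen projection of a combination need not literally be the combination
        of the projections. The residuals w and w' are both divergence free and have equal pairings
        with all divergence free fields; using w and w' themselves as such fields yields equal
        norms.\<close>
      define w where "w x = u r x - f x" for x
      define w' where "w' x = e x + s *\<^sub>R h x" for x
      have wK: "w \<in> ?K" using div_free_add_scaleR[OF uK[OF rB] fK, of "- 1"] by (simp add: w_def[abs_def])
      have w'K: "w' \<in> ?K" using div_free_add_scaleR[OF eK hK, of s] by (simp add: w'_def[abs_def])
      have eq: "?in w k = ?in w' k" if k: "k \<in> ?K" for k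
      proof -
        have kL: "k \<in> L2 \<Omega>" by (rule KL[OF k])
        have "?in (u r) k = ?in (L2_mdiv \<Omega> r) k" by (rule u_in[OF rB k])
        also have "\<dots> = ?in (\<lambda>x. (1 - s) *\<^sub>R L2_mdiv \<Omega> p x + s *\<^sub>R L2_mdiv \<Omega> q x) k"
          using rae by (intro L2_inner_cong_AE) (auto intro!: L2_add L2_scaleR mL p q rB kL)
        also have "\<dots> = (1 - s) * ?in (L2_mdiv \<Omega> p) k + s * ?in (L2_mdiv \<Omega> q) k"
          by (simp only: L2_inner_add_left[OF L2_scaleR L2_scaleR] mL p q kL L2_inner_scaleR_left)
        also have "\<dots> = (1 - s) * ?in (u p) k + s * ?in (u q) k"
          using u_in[OF p k] u_in[OF q k] by simp
        finally have ur: "?in (u r) k = (1 - s) * ?in (u p) k + s * ?in (u q) k" .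
        have "?in w k = ?in (u r) k - ?in f k"
          unfolding w_def[abs_def] by (rule L2_inner_diff_left[OF KL[OF uK[OF rB]] fL kL])
        moreover have "?in w' k = ?in e k + s * ?in h k"
          unfolding w'_def[abs_def] L2_inner_add_left[OF eL L2_scaleR[OF hL] kL] L2_inner_scaleR_left ..
        moreover have "?in e k = ?in (u p) k - ?in f k"
          unfolding e_def[abs_def] by (rule L2_inner_diff_left[OF upL fL kL])
        moreover have "?in h k = ?in (u q) k - ?in (u p) k"
          unfolding h_def[abs_def] by (rule L2_inner_diff_left[OF uqL upL kL])
        ultimately show ?thesis using ur by (simp add: algebra_simps)
      qed
      have "?in e e \<le> ?in w w" using pmin[OF rB] by (simp add: e_def[abs_def] w_def[abs_def])
      also have "\<dots> = ?in w' w'" using eq[OF wK] eq[OF w'K] by (simp add: L2_inner_commute[of \<Omega> w w'])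
      also have "\<dots> = ?in e e + 2 * (s * ?in e h) + s * (s * ?in h h)"
        unfolding w'_def[abs_def] L2_inner_square_add[OF eL L2_scaleR[OF hL]] L2_inner_scaleR_left L2_inner_scaleR_right ..
      finally show ?thesis .
    qed
    have "?in e h \<ge> 0"
    proof (rule ccontr)
      assume "\<not> ?in e h \<ge> 0"
      then have neg: "?in e h < 0" by simp
      have hh: "?in h h \<ge> 0" by (rule L2_inner_self_nonneg)
      \<comment> \<open>This s satisfies s (|h|^2 + 1) <= -<e, h>, hence 2 <e, h> + s |h|^2 <= <e,
        h> - s < 0, against \<open>expand\<close>. The minimum with 1 keeps s on the
        segment.\<close>
      define s where "s = min 1 (- ?in e h / (?in h h + 1))"
      have pos: "?in h h + 1 > 0" using hh by linarith
      have "0 < - ?in e h / (?in h h + 1)" by (rule divide_pos_pos[OF _ pos]) (use neg in linarith)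
      then have s: "0 < s" "s \<le> 1" unfolding s_def by linarith+
      have "s \<le> - ?in e h / (?in h h + 1)" unfolding s_def by linarith
      then have "s * (?in h h + 1) \<le> - ?in e h" using pos_le_divide_eq[OF pos] by blast
      then have "2 * ?in e h + s * ?in h h < 0" using neg s(1) by (simp add: algebra_simps)
      then have "s * (2 * ?in e h + s * ?in h h) < 0" using s(1) by (intro mult_pos_neg)
      with expand[of s] s show False by (simp add: algebra_simps)
    qed
    \<comment> \<open>\<sigma> is the negative multiple -\<delta> e of the residual, which reverses
      the sign of the first-order condition.\<close>
    moreover have "?in \<sigma> h = - \<delta> * ?in e h"
    proof -
      have "\<sigma> = (\<lambda>x. (- \<delta>) *\<^sub>R e x)"
        using \<delta> by (intro ext) (simp add: \<sigma>_def e_def f_def scaleR_diff_right)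
      then show ?thesis by (simp only: L2_inner_scaleR_left)
    qed
    ultimately have "?in \<sigma> h \<le> 0" using \<delta> by (simp add: mult_nonneg_nonneg)
    moreover have "?in \<sigma> h = ?in \<sigma> (u q) - ?in \<sigma> (u p)"
      unfolding h_def[abs_def] by (rule L2_inner_diff_right[OF uqL upL \<sigma>L])
    ultimately show ?thesis by simp
  qed

  have TV\<sigma>: "TV \<Omega> \<sigma> \<le> ereal (?in \<sigma> (u p))"
    unfolding TV_def
  proof (rule SUP_least)
    fix q :: "real ^ 2 \<Rightarrow> real ^ 2 ^ 2" assume q: "q \<in> column_ball \<Omega> (C01 \<Omega>)"
    then have qC: "q \<in> C01 \<Omega>" by (simp add: column_ball_def)
    have qB: "q \<in> ?B" using q C01_H0div(1)[OF \<Omega> qC] by (simp add: column_ball_def)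
    have "(\<integral>x. \<sigma> x \<bullet> mdvg q x \<partial>lebesgue_on \<Omega>) = ?in \<sigma> (mdvg q)" by (simp add: L2_inner_def)
    \<comment> \<open>The classical and the chosen distributional divergence agree almost
      everywhere, which is enough inside the integral.\<close>
    also have "\<dots> = ?in \<sigma> (L2_mdiv \<Omega> q)"
      using C01_H0div(2)[OF \<Omega> qC]
      by (intro L2_inner_cong_AE) (auto intro: \<sigma>L mdvg_L2[OF \<Omega> qC] column_approximation_TV(1)[OF assms(1) qB L2_zero])
    also have "\<dots> = ?in \<sigma> (u q)" using u_in[OF qB \<sigma>K] by (simp add: L2_inner_commute)
    also have "\<dots> \<le> ?in \<sigma> (u p)" by (rule variational[OF qB])
    finally show "ereal (\<integral>x. \<sigma> x \<bullet> mdvg q x \<partial>lebesgue_on \<Omega>) \<le> ereal (?in \<sigma> (u p))" by simp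
  qed
  \<comment> \<open>Finite total variation makes \<sigma> a feasible competitor of \<tau>; it comes
    from the bound just proved.\<close>
  have \<sigma>BV: "\<sigma> \<in> BV \<Omega>"
    unfolding BV_def L1_def using L2_integrable[OF \<Omega> \<sigma>L] TV\<sigma> by (auto intro: le_less_trans)
  have \<tau>K: "\<tau> \<in> ?K" and \<tau>min: "TV \<Omega> \<tau> + ereal (1 / (2 * \<delta>) * ?in (\<lambda>x. \<tau> x - \<tau>0 x) (\<lambda>x. \<tau> x - \<tau>0 x))
      \<le> TV \<Omega> \<sigma> + ereal (1 / (2 * \<delta>) * ?in (\<lambda>x. \<sigma> x - \<tau>0 x) (\<lambda>x. \<sigma> x - \<tau>0 x))"
    using assms(4) \<sigma>BV \<sigma>L \<sigma>K unfolding is_arg_min_def L2_norm_square by (auto simp: not_less)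
  have \<tau>L: "\<tau> \<in> L2 \<Omega>" by (rule KL[OF \<tau>K])
  \<comment> \<open>The projection drops out because \<tau> itself satisfies the constraint.\<close>
  have "?in \<tau> (L2_mdiv \<Omega> p) = ?in \<tau> (u p)" using u_in[OF p \<tau>K] by (simp add: L2_inner_commute)
  then have TV\<tau>: "ereal (?in \<tau> (u p)) \<le> TV \<Omega> \<tau>"
    using column_approximation_TV(2)[OF assms(1) p \<tau>L] by simp
  \<comment> \<open>Both total variations are replaced by real numbers, from below for \<tau> and
    from above for \<sigma>; after that the inequality can leave \<open>ereal\<close>.\<close>
  have "ereal (?in \<tau> (u p)) + ereal (1 / (2 * \<delta>) * ?in (\<lambda>x. \<tau> x - \<tau>0 x) (\<lambda>x. \<tau> x - \<tau>0 x))
    \<le> ereal (?in \<sigma> (u p)) + ereal (1 / (2 * \<delta>) * ?in (\<lambda>x. \<sigma> x - \<tau>0 x) (\<lambda>x. \<sigma> x - \<tau>0 x))"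
    using add_mono[OF TV\<tau> order_refl] \<tau>min add_mono[OF TV\<sigma> order_refl] by (meson order_trans)
  then have ineq: "?in \<tau> (u p) + 1 / (2 * \<delta>) * ?in (\<lambda>x. \<tau> x - \<tau>0 x) (\<lambda>x. \<tau> x - \<tau>0 x)
    \<le> ?in \<sigma> (u p) + 1 / (2 * \<delta>) * ?in (\<lambda>x. \<sigma> x - \<tau>0 x) (\<lambda>x. \<sigma> x - \<tau>0 x)" by simp
  define e where "e x = \<tau> x - \<sigma> x" for x
  have eL: "e \<in> L2 \<Omega>" unfolding e_def[abs_def] by (rule L2_diff[OF \<tau>L \<sigma>L])
  define U where "U = ?in (u p) (u p)"
  define E where "E = ?in e e"
  define X where "X = ?in e (u p)"
  have "(\<lambda>x. \<sigma> x - \<tau>0 x) = (\<lambda>x. (- \<delta>) *\<^sub>R u p x)" by (rule ext) (simp add: \<sigma>_def)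
  then have N\<sigma>: "?in (\<lambda>x. \<sigma> x - \<tau>0 x) (\<lambda>x. \<sigma> x - \<tau>0 x) = \<delta> * (\<delta> * U)"
    by (simp add: L2_inner_scaleR_left L2_inner_scaleR_right L2_inner_minus_left L2_inner_minus_right U_def)
  have "(\<lambda>x. \<tau> x - \<tau>0 x) = (\<lambda>x. e x - \<delta> *\<^sub>R u p x)" by (rule ext) (simp add: e_def \<sigma>_def)
  then have N\<tau>: "?in (\<lambda>x. \<tau> x - \<tau>0 x) (\<lambda>x. \<tau> x - \<tau>0 x) = E - 2 * (\<delta> * X) + \<delta> * (\<delta> * U)"
    using L2_inner_square_diff[OF eL L2_scaleR[OF upL, of \<delta>]]
    by (simp add: L2_inner_scaleR_left L2_inner_scaleR_right U_def E_def X_def)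
  have X: "X = ?in \<tau> (u p) - ?in \<sigma> (u p)"
    unfolding X_def e_def[abs_def] by (rule L2_inner_diff_left[OF \<tau>L \<sigma>L upL])
  \<comment> \<open>The terms in U cancel, and the cross term -X of the square cancels the
    difference X of the linear terms; only the norm square of e is left.\<close>
  have "1 / (2 * \<delta>) * E \<le> 0"
    using ineq \<delta> unfolding N\<sigma> N\<tau> right_diff_distrib distrib_left by (simp add: X)
  then have "E \<le> 0" using \<delta> by (simp add: divide_le_0_iff)
  then have "AE x in lebesgue_on \<Omega>. e x = 0" unfolding E_def by (rule L2_inner_self_eq_0[OF eL])
  then show ?thesis by eventually_elim (simp add: e_def \<sigma>_def u_def)
qed

end
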